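(* Let $c,q\in C^\infty(\mathbb{T}^1)$ be complex-valued smooth functions and let $L$ be the differential operator on $\mathbb{T}^1\times\mathbb{R}$ given by $$L=\partial_t+c(t)\partial_x+q(t).$$ Set $c_0=\frac{1}{2\pi}\int_0^{2\pi}c(t)\,dt$, $q_0=\frac{1}{2\pi}\int_0^{2\pi}q(t)\,dt$ and $b=\operatorname{Im}(c)$. Then $L$ is Schwartz globally hypoelliptic if and only if the set $$Z_{L_0}=\{(k,\xi)\in\mathbb{Z}\times\mathbb{R} : k+c_0\xi-iq_0=0\}$$ is empty and $b$ does not change sign on $\mathbb{T}^1$.
   Context: $\mathbb{T}^1=\mathbb{R}/2\pi\mathbb{Z}$; functions on $\mathbb{T}^1$ are identified with $2\pi$-periodic functions on $\mathbb{R}$. The Schwartz space $\mathcal{S}(\mathbb{T}^1\times\mathbb{R})$ is the space of $f\in C^\infty(\mathbb{T}^1\times\mathbb{R})$ with $\sup_{t,x}|x^\gamma\partial_t^\alpha\partial_x^\beta f(t,x)|<\infty$ for all $\alpha,\beta,\gamma\in\mathbb{N}_0$, with the Fréchet topology given by these seminorms; $\mathcal{S}'(\mathbb{T}^1\times\mathbb{R})$ is its topological dual, on which $L$ acts in the distributional sense. $L$ is called Schwartz globally hypoelliptic if whenever $u\in\mathcal{S}'(\mathbb{T}^1\times\mathbb{R})$ satisfies $Lu\in\mathcal{S}(\mathbb{T}^1\times\mathbb{R})$, then $u\in\mathcal{S}(\mathbb{T}^1\times\mathbb{R})$. *)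

theory Defs
  imports "HOL-Analysis.Analysis"
begin

text \<open>Functions on T^1 x R are functions real x real => complex that are
  2pi-periodic in the first (t) variable.\<close>

definition periodic_t :: "(real \<times> real \<Rightarrow> complex) \<Rightarrow> bool" where
  "periodic_t f \<longleftrightarrow> (\<forall>t x. f (t + 2 * pi, x) = f (t, x))"

definition periodic1 :: "(real \<Rightarrow> complex) \<Rightarrow> bool" where
  "periodic1 c \<longleftrightarrow> (\<forall>t. c (t + 2 * pi) = c t)"

definition pdt :: "(real \<times> real \<Rightarrow> complex) \<Rightarrow> real \<times> real \<Rightarrow> complex" where
  "pdt f = (\<lambda>p. vector_derivative (\<lambda>s. f (s, snd p)) (at (fst p)))"

definition pdx :: "(real \<times> real \<Rightarrow> complex) \<Rightarrow> real \<times> real \<Rightarrow> complex" where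
  "pdx f = (\<lambda>p. vector_derivative (\<lambda>y. f (fst p, y)) (at (snd p)))"

inductive_set partials :: "(real \<times> real \<Rightarrow> complex) \<Rightarrow> (real \<times> real \<Rightarrow> complex) set"
  for f where
  base: "f \<in> partials f"
| dt: "g \<in> partials f \<Longrightarrow> pdt g \<in> partials f"
| dx: "g \<in> partials f \<Longrightarrow> pdx g \<in> partials f"

definition smooth2 :: "(real \<times> real \<Rightarrow> complex) \<Rightarrow> bool" where
  "smooth2 f \<longleftrightarrow> (\<forall>g \<in> partials f. continuous_on UNIV g \<and>
      (\<forall>t x. (\<lambda>s. g (s, x)) differentiable (at t) \<and> (\<lambda>y. g (t, y)) differentiable (at x)))"

definition vd :: "(real \<Rightarrow> complex) \<Rightarrow> real \<Rightarrow> complex" where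
  "vd c = (\<lambda>t. vector_derivative c (at t))"

definition smooth1 :: "(real \<Rightarrow> complex) \<Rightarrow> bool" where
  "smooth1 c \<longleftrightarrow> (\<forall>n t. (vd ^^ n) c differentiable (at t))"

definition dmix :: "nat \<Rightarrow> nat \<Rightarrow> (real \<times> real \<Rightarrow> complex) \<Rightarrow> real \<times> real \<Rightarrow> complex" where
  "dmix \<alpha> \<beta> f = (pdt ^^ \<alpha>) ((pdx ^^ \<beta>) f)"

definition schwartz :: "(real \<times> real \<Rightarrow> complex) set" where
  "schwartz = {f. periodic_t f \<and> smooth2 f \<and>
      (\<forall>\<alpha> \<beta> \<gamma>. bounded (range (\<lambda>p. of_real (snd p ^ \<gamma>) * dmix \<alpha> \<beta> f p)))}"

definition seminorm_S :: "nat \<Rightarrow> nat \<Rightarrow> nat \<Rightarrow> (real \<times> real \<Rightarrow> complex) \<Rightarrow> real" where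
  "seminorm_S \<alpha> \<beta> \<gamma> f = (SUP p. norm (of_real (snd p ^ \<gamma>) * dmix \<alpha> \<beta> f p))"

text \<open>Tempered distributions S'(T^1 x R): linear functionals on S, continuous
  for the Frechet topology given by the seminorms (equivalently: bounded by
  finitely many seminorms).\<close>

definition tempered :: "((real \<times> real \<Rightarrow> complex) \<Rightarrow> complex) \<Rightarrow> bool" where
  "tempered u \<longleftrightarrow>
     (\<forall>\<phi>\<in>schwartz. \<forall>\<psi>\<in>schwartz. u (\<lambda>p. \<phi> p + \<psi> p) = u \<phi> + u \<psi>) \<and>
     (\<forall>\<phi>\<in>schwartz. \<forall>a. u (\<lambda>p. a * \<phi> p) = a * u \<phi>) \<and>
     (\<exists>C N. \<forall>\<phi>\<in>schwartz.
        norm (u \<phi>) \<le> C * (\<Sum>\<alpha>\<le>N. \<Sum>\<beta>\<le>N. \<Sum>\<gamma>\<le>N. seminorm_S \<alpha> \<beta> \<gamma> \<phi>))"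

definition fun_distr :: "(real \<times> real \<Rightarrow> complex) \<Rightarrow> (real \<times> real \<Rightarrow> complex) \<Rightarrow> complex" where
  "fun_distr g \<phi> = (LINT p:{0..2*pi} \<times> UNIV|lborel. g p * \<phi> p)"

text \<open>Formal transpose of L = dt + c(t) dx + q(t):  L^T phi = -dt phi - c dx phi + q phi,
  so that (L u)(phi) = u (L^T phi) in the distributional sense.\<close>

definition L_transpose :: "(real \<Rightarrow> complex) \<Rightarrow> (real \<Rightarrow> complex) \<Rightarrow>
    (real \<times> real \<Rightarrow> complex) \<Rightarrow> real \<times> real \<Rightarrow> complex" where
  "L_transpose c q \<phi> = (\<lambda>p. - pdt \<phi> p - c (fst p) * pdx \<phi> p + q (fst p) * \<phi> p)"

definition schwartz_GH :: "(real \<Rightarrow> complex) \<Rightarrow> (real \<Rightarrow> complex) \<Rightarrow> bool" where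
  "schwartz_GH c q \<longleftrightarrow>
     (\<forall>u. tempered u \<longrightarrow>
        (\<exists>g\<in>schwartz. \<forall>\<phi>\<in>schwartz. u (L_transpose c q \<phi>) = fun_distr g \<phi>) \<longrightarrow>
        (\<exists>f\<in>schwartz. \<forall>\<phi>\<in>schwartz. u \<phi> = fun_distr f \<phi>))"

definition mean_T :: "(real \<Rightarrow> complex) \<Rightarrow> complex" where
  "mean_T c = integral {0..2*pi} c / of_real (2 * pi)"

definition Z_L0 :: "(real \<Rightarrow> complex) \<Rightarrow> (real \<Rightarrow> complex) \<Rightarrow> (int \<times> real) set" where
  "Z_L0 c q = {(k, \<xi>). of_int k + mean_T c * of_real \<xi> - \<i> * mean_T q = 0}"

end

theory Submission
  imports Defs "HOL-Probability.Probability"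
begin

text \<open>Fourier transform in \<open>x\<close> turns \<open>L u = f\<close> into the periodic ordinary differential equation
  \<open>v' + (i \<xi> c + q) v = F\<close>, whose solution is an explicit integral over one period divided by
  \<open>1 - exp (- 2 \<pi> (i \<xi> c\<^sub>0 + q\<^sub>0))\<close>. The denominator vanishes nowhere iff \<open>Z\<close> is empty, and if moreover
  \<open>Im c\<close> does not change sign, the kernel divided by it is bounded uniformly in \<open>\<xi>\<close>. Since
  \<open>\<partial>\<^sub>\<xi> v\<close> solves the same equation with another right-hand side, \<open>v\<close> is Schwartz whenever \<open>F\<close> is,
  so \<open>L\<close> and its transpose are onto the Schwartz space, which gives hypoellipticity by duality.

  Conversely, an element \<open>(k, \<xi>)\<close> of \<open>Z\<close> gives a non-decaying solution
  \<open>exp (i \<xi> x - i \<xi> C - Q)\<close> of \<open>L u = 0\<close>, where \<open>C' = c\<close> and \<open>Q' = q\<close>. If \<open>Im c\<close> changes sign from plus to minus, \<open>Im C\<close>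
  has a local maximum at some \<open>t*\<close>, and \<open>\<theta> exp (- Q) h (x - C + C(t*))\<close>, with a cutoff \<open>\<theta>\<close> and a function \<open>h\<close>
  that is holomorphic in the upper half-plane, decays rapidly and is singular at \<open>0\<close>, is not smooth, while
  \<open>L\<close> maps it to a Schwartz function: \<open>\<theta>'\<close> lives where the argument of \<open>h\<close> stays off the real axis.\<close>

section \<open>Smooth functions of one variable\<close>

text \<open>For sufficiency the obstacle is uniformity in \<xi>: kernel and denominator may both
  grow like exp (2 pi b0 \<xi>), with b0 the mean of Im c. If Im c keeps its sign, Im C is monotone,
  so over one period the growth exponent of the kernel stays between 0 and 2 pi b0 \<xi>, and the
  denominator is at least a constant multiple of the larger of the two exponentials. Duality asks
  for solvability of the transpose as well. That operator is minus the one with q replaced by - q,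
  and both conditions survive this change. For necessity the obstacle is that c and q need not have
  mean zero, so that C and Q are not functions on the circle. Since the cutoff confines the
  counterexample to an arc, c and q may be altered off that arc until their means vanish. The
  function h is a multiple of z^(3/2) exp (- z^2): it has one continuous derivative on the closed
  half-plane, enough to compute L u classically and to integrate by parts, but no second derivative
  at 0.\<close>

primrec diff_times :: "nat \<Rightarrow> (real \<Rightarrow> complex) \<Rightarrow> bool" where
  "diff_times 0 f = True"
| "diff_times (Suc n) f = ((\<forall>t. f differentiable at t) \<and> diff_times n (vd f))"

text \<open>Iterates of \<open>vd\<close> do not combine well with products.
  \<open>diff_times\<close> instead peels one derivative off the function itself, so an induction on
  n with the function arbitrary uses the product or chain rule once per step.\<close>

lemma smooth1_iff_diff_times: "smooth1 f \<longleftrightarrow> (\<forall>n. diff_times n f)"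
proof -
  have "diff_times n f \<longleftrightarrow> (\<forall>m<n. \<forall>t. (vd ^^ m) f differentiable at t)" for n
  proof (induction n arbitrary: f)
    case (Suc n)
    have "(\<forall>m<Suc n. \<forall>t. (vd ^^ m) f differentiable at t) \<longleftrightarrow>
      (\<forall>t. f differentiable at t) \<and> (\<forall>m<n. \<forall>t. (vd ^^ Suc m) f differentiable at t)"
      by (auto simp: All_less_Suc2 simp del: funpow.simps(2)) 
    also have "\<dots> \<longleftrightarrow> diff_times (Suc n) f"
      by (simp add: Suc.IH funpow_Suc_right del: funpow.simps(2))
    finally show ?case by simp
  qed simp
  then show ?thesis unfolding smooth1_def by blast
qed

lemma diff_times_SucI:
  assumes "\<And>t. (f has_vector_derivative f' t) (at t)" "diff_times n f'"
  shows "diff_times (Suc n) f"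
proof -
  have "vd f = f'"
    unfolding vd_def using assms(1) by (auto intro!: vector_derivative_at)
  with assms(2) show ?thesis
    using differentiableI_vector[OF assms(1)] by simp
qed

lemma diff_times_SucD:
  assumes "diff_times (Suc n) f"
  shows "(f has_vector_derivative vd f t) (at t)" "diff_times n (vd f)"
  using assms vector_derivative_works[of f "at t"] by (simp_all add: vd_def)

lemma diff_times_mono: "diff_times (Suc n) f \<Longrightarrow> diff_times n f"
  by (induction n arbitrary: f) auto

lemma diff_times_const [simp]: "diff_times n (\<lambda>_. a)"
proof (induction n arbitrary: a)
  case (Suc n)
  show ?case
    by (rule diff_times_SucI[where f'="\<lambda>_. 0"]) (auto simp: Suc)
qed simp

lemma diff_times_add: "diff_times n f \<Longrightarrow> diff_times n g \<Longrightarrow> diff_times n (\<lambda>t. f t + g t)"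
proof (induction n arbitrary: f g)
  case (Suc n)
  show ?case
    by (rule diff_times_SucI[where f'="\<lambda>t. vd f t + vd g t"])
      (use Suc diff_times_SucD in \<open>auto intro!: derivative_eq_intros\<close>)
qed simp

lemma diff_times_mult: "diff_times n f \<Longrightarrow> diff_times n g \<Longrightarrow> diff_times n (\<lambda>t. f t * g t)"
proof (induction n arbitrary: f g)
  case (Suc n)
  show ?case
  proof (rule diff_times_SucI)
    show "((\<lambda>t. f t * g t) has_vector_derivative (f t * vd g t + vd f t * g t)) (at t)" for t
      using diff_times_SucD(1)[OF Suc.prems(1)] diff_times_SucD(1)[OF Suc.prems(2)]
      by (rule has_vector_derivative_mult)
    show "diff_times n (\<lambda>t. f t * vd g t + vd f t * g t)"
      using Suc.prems[THEN diff_times_mono] Suc.prems[THEN diff_times_SucD(2)]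
      by (intro diff_times_add Suc.IH)
  qed
qed simp

text \<open>All derivatives \<open>G k\<close> of the outer function are supplied at once because
  the induction step turns \<open>G k\<close> into \<open>G (Suc k)\<close> times
  \<open>vd f\<close>. The set S admits outer functions with a singularity, such as the
  inverse.\<close>

lemma diff_times_chain:
  assumes g: "\<And>k z. z \<in> S \<Longrightarrow> (G k has_field_derivative G (Suc k) z) (at z)"
    and "diff_times n f" "\<And>t. f t \<in> S"
  shows "diff_times n (\<lambda>t. G k (f t))"
  using assms(2,3)
proof (induction n arbitrary: k)
  case (Suc n)
  show ?case
  proof (rule diff_times_SucI)
    show "((\<lambda>t. G k (f t)) has_vector_derivative (vd f t * G (Suc k) (f t))) (at t)" for t
      using field_vector_diff_chain_at[OF diff_times_SucD(1)[OF Suc.prems(1)] g[OF Suc.prems(2)]]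
      by (simp add: o_def)
    show "diff_times n (\<lambda>t. vd f t * G (Suc k) (f t))"
      using Suc.prems(1)[THEN diff_times_mono] Suc.prems(1)[THEN diff_times_SucD(2)] Suc.prems(2)
      by (intro diff_times_mult Suc.IH)
  qed
qed simp

lemma smooth1_const: "smooth1 (\<lambda>_. a)"
  by (simp add: smooth1_iff_diff_times)

lemma smooth1_add: "smooth1 f \<Longrightarrow> smooth1 g \<Longrightarrow> smooth1 (\<lambda>t. f t + g t)"
  by (simp add: smooth1_iff_diff_times diff_times_add)

lemma smooth1_mult: "smooth1 f \<Longrightarrow> smooth1 g \<Longrightarrow> smooth1 (\<lambda>t. f t * g t)"
  by (simp add: smooth1_iff_diff_times diff_times_mult)

lemma smooth1_minus: "smooth1 f \<Longrightarrow> smooth1 (\<lambda>t. - f t)"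
  using smooth1_mult[OF smooth1_const[of "-1"]] by simp

lemma smooth1_diff: "smooth1 f \<Longrightarrow> smooth1 g \<Longrightarrow> smooth1 (\<lambda>t. f t - g t)"
  using smooth1_add[OF _ smooth1_minus, of f g] by simp

lemma smooth1_exp: "smooth1 f \<Longrightarrow> smooth1 (\<lambda>t. exp (f t))"
  using diff_times_chain[of UNIV "\<lambda>_. exp"] by (auto simp: smooth1_iff_diff_times)

lemma smooth1_inverse:
  assumes "smooth1 f" "\<And>t. f t \<noteq> 0"
  shows "smooth1 (\<lambda>t. inverse (f t))"
proof -
  \<comment> \<open>The k-th derivative of inverse z.\<close>
  define G :: "nat \<Rightarrow> complex \<Rightarrow> complex" where
    "G k z = (-1) ^ k * fact k * inverse z ^ Suc k" for k z
  have "(G k has_field_derivative G (Suc k) z) (at z)" if "z \<in> - {0}" for k z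
  proof -
    have "((\<lambda>z. inverse z ^ Suc k) has_field_derivative
        of_nat (Suc k) * (- (inverse z ^ Suc (Suc 0)) * inverse z ^ k)) (at z)"
      using DERIV_power[OF DERIV_inverse, of z "Suc k"] that by simp
    from DERIV_cmult[OF this, of "(-1) ^ k * fact k"] show ?thesis
      unfolding G_def by (rule DERIV_cong) (simp add: algebra_simps)
  qed
  then have "diff_times n (\<lambda>t. G 0 (f t))" for n
    using diff_times_chain[of "- {0}" G n f 0] assms by (auto simp: smooth1_iff_diff_times)
  then show ?thesis
    by (simp add: smooth1_iff_diff_times G_def)
qed

lemma smooth1_deriv:
  assumes "smooth1 f"
  shows "(f has_vector_derivative vd f t) (at t)" "smooth1 (vd f)"
  using assms diff_times_SucD(1)[of 0 f] diff_times_SucD(2)[of _ f]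
  unfolding smooth1_iff_diff_times by blast+

lemma smooth1I:
  assumes "\<And>t. (f has_vector_derivative f' t) (at t)" "smooth1 f'"
  shows "smooth1 f"
  unfolding smooth1_iff_diff_times
proof
  show "diff_times n f" for n
    using diff_times_SucI[OF assms(1)] assms(2)
    by (cases n) (auto simp: smooth1_iff_diff_times simp del: diff_times.simps(2))
qed

lemma smooth1_continuous: "smooth1 f \<Longrightarrow> continuous_on UNIV f"
  by (intro continuous_at_imp_continuous_on ballI has_vector_derivative_continuous[OF smooth1_deriv(1)])

text \<open>The outer function lives on the reals only, so \<open>diff_times_chain\<close> does not
  apply. The induction varies the outer function and keeps r fixed.\<close>

lemma smooth1_compose_real:
  fixes r r' :: "real \<Rightarrow> real"
  assumes "smooth1 f" "smooth1 (\<lambda>t. of_real (r t))"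
  shows "smooth1 (\<lambda>t. f (r t))"
proof -
  define r' where "r' t = Re (vd (\<lambda>t. of_real (r t)) t)" for t
  have r: "(r has_real_derivative r' t) (at t)" for t
    using bounded_linear.has_vector_derivative[OF bounded_linear_Re smooth1_deriv(1)[OF assms(2), of t]]
    by (simp add: r'_def has_real_derivative_iff_has_vector_derivative)
  have r'': "vd (\<lambda>t. of_real (r t)) = (\<lambda>t. complex_of_real (r' t))"
    unfolding vd_def using r
    by (intro ext vector_derivative_at)
      (auto intro!: has_vector_derivative_of_real simp: has_real_derivative_iff_has_vector_derivative)
  have "diff_times n (\<lambda>t. f (r t))" if "smooth1 f" for n f
    using that
  proof (induction n arbitrary: f)
    case (Suc n)
    show ?case
    proof (rule diff_times_SucI)
      show "((\<lambda>t. f (r t)) has_vector_derivative of_real (r' t) * vd f (r t)) (at t)" for t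
        using vector_diff_chain_at[of r "r' t" t f "vd f (r t)"] r[of t] smooth1_deriv(1)[OF Suc.prems]
        by (simp add: o_def has_real_derivative_iff_has_vector_derivative scaleR_conv_of_real)
      show "diff_times n (\<lambda>t. of_real (r' t) * vd f (r t))"
        using smooth1_deriv(2)[OF assms(2)] r'' smooth1_deriv(2)[OF Suc.prems] Suc.IH
        by (intro diff_times_mult) (auto simp: smooth1_iff_diff_times)
    qed
  qed simp
  then show ?thesis
    using assms(1) by (simp add: smooth1_iff_diff_times)
qed

lemma smooth1_of_real_id: "smooth1 (\<lambda>t. of_real t)"
  by (rule smooth1I[where f'="\<lambda>_. 1"]) (auto intro!: derivative_eq_intros smooth1_const)

lemma smooth1_cos: "smooth1 (\<lambda>t. of_real (cos (t - a)))"
proof -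
  have "smooth1 (\<lambda>t. (exp (\<i> * (of_real t - of_real a)) + exp (- (\<i> * (of_real t - of_real a)))) * (1/2))"
    by (intro smooth1_mult smooth1_add smooth1_exp smooth1_minus smooth1_diff smooth1_const smooth1_of_real_id)
  then show ?thesis
    by (simp flip: cos_of_real add: cos_exp_eq)
qed

section \<open>Flat functions and smooth cutoffs\<close>

definition flat :: "nat \<Rightarrow> real \<Rightarrow> complex" where
  "flat k x = (if x > 0 then of_real (inverse x ^ k * exp (- inverse x)) else 0)"

lemma norm_flat: "x > 0 \<Longrightarrow> norm (flat k x) = inverse x ^ k * exp (- inverse x)"
  by (simp add: flat_def norm_mult norm_power norm_inverse)

text \<open>The powers of inverse x make the family closed under differentiation, so smoothness of
  exp (- 1 / x) follows for all k simultaneously. At 0 the difference quotient is inverse y ^ (k +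
  1) * exp (- inverse y), which tends to 0.\<close>

lemma flat_deriv: "(flat k has_vector_derivative (- of_nat k * flat (Suc k) x + flat (k + 2) x)) (at x)"
proof -
  consider "x > 0" | "x < 0" | "x = 0" by linarith
  then show ?thesis
  proof cases
    case 1
    have p: "((\<lambda>x. inverse x ^ k) has_real_derivative - real k * inverse x ^ Suc k) (at x)"
    proof (cases k)
      case (Suc m)
      show ?thesis
        using 1 Suc by (intro DERIV_cong[OF DERIV_power[OF DERIV_inverse]]) (auto simp: algebra_simps)
    qed simp
    have e: "((\<lambda>x. exp (- inverse x)) has_real_derivative inverse x ^ 2 * exp (- inverse x)) (at x)"
      using 1 by (auto intro!: derivative_eq_intros simp: power2_eq_square)
    have "((\<lambda>x. inverse x ^ k * exp (- inverse x)) has_real_derivative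
        (- real k * (inverse x ^ Suc k * exp (- inverse x)) + inverse x ^ (k+2) * exp (- inverse x))) (at x)"
      by (rule DERIV_cong[OF DERIV_mult[OF p e]]) (simp add: power_add power2_eq_square mult_ac)
    then have "((\<lambda>x. complex_of_real (inverse x ^ k * exp (- inverse x))) has_vector_derivative
        of_real (- real k * (inverse x ^ Suc k * exp (- inverse x)) + inverse x ^ (k+2) * exp (- inverse x))) (at x)"
      by (intro has_vector_derivative_of_real) (simp add: has_real_derivative_iff_has_vector_derivative)
    then show ?thesis
      by (rule has_vector_derivative_transform_within_open[where S="{0<..}", THEN has_vector_derivative_eq_rhs])
        (use 1 in \<open>auto simp: flat_def\<close>)
  next
    case 2
    have "((\<lambda>_. 0::complex) has_vector_derivative 0) (at x)" by simp
    then show ?thesis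
      by (rule has_vector_derivative_transform_within_open[where S="{..<0}", THEN has_vector_derivative_eq_rhs])
        (use 2 in \<open>auto simp: flat_def\<close>)
  next
    case 3
    have "((\<lambda>y::real. inverse y * (inverse y ^ k * exp (- inverse y))) \<longlongrightarrow> 0) (at_right 0)"
    proof -
      have "((\<lambda>y::real. inverse y ^ Suc k / exp (inverse y)) \<longlongrightarrow> 0) (at_right 0)"
        using filterlim_compose[OF tendsto_power_div_exp_0 filterlim_inverse_at_top_right] .
      then show ?thesis by (simp add: exp_minus divide_inverse mult.assoc)
    qed
    then have "((\<lambda>y::real. norm (inverse y) * norm (flat k y)) \<longlongrightarrow> 0) (at_right 0)"
      by (rule Lim_transform_eventually) (auto simp: eventually_at_filter norm_flat)
    moreover have "((\<lambda>y::real. norm (inverse y) * norm (flat k y)) \<longlongrightarrow> 0) (at_left 0)"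
      by (rule Lim_transform_eventually[where f="\<lambda>_. 0"])
        (auto simp: eventually_at_filter flat_def)
    ultimately have "((\<lambda>y::real. norm (inverse y) * norm (flat k y)) \<longlongrightarrow> 0) (at 0)"
      by (simp add: filterlim_at_split)
    then have "(flat k has_vector_derivative 0) (at 0)"
      by (simp add: has_vector_derivative_def has_derivative_at flat_def[of _ 0] divide_inverse
          norm_inverse mult.commute)
    then show ?thesis using 3 by (simp add: flat_def)
  qed
qed

lemma smooth1_flat: "smooth1 (flat k)"
  unfolding smooth1_iff_diff_times
proof
  show "diff_times n (flat k)" for n
  proof (induction n arbitrary: k)
    case (Suc n)
    show ?case
      by (rule diff_times_SucI[OF flat_deriv]) (intro diff_times_add diff_times_mult diff_times_const Suc)
  qed simp
qed

definition smooth_step :: "real \<Rightarrow> complex" where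
  "smooth_step x = flat 0 x / (flat 0 x + flat 0 (1 - x))"

lemma smooth_step_eq [simp]: "x \<le> 0 \<Longrightarrow> smooth_step x = 0" "x \<ge> 1 \<Longrightarrow> smooth_step x = 1"
  by (auto simp: smooth_step_def flat_def)

lemma smooth1_smooth_step: "smooth1 smooth_step"
proof -
  \<comment> \<open>x and 1 - x are never both nonpositive, so one of the two summands is positive
    and the other nonnegative.\<close>
  have *: "flat 0 x + flat 0 (1 - x) \<noteq> 0" for x
  proof -
    have "Re (flat 0 x + flat 0 (1 - x)) > 0"
      by (cases "x > 0"; cases "x < 1") (auto simp: flat_def add_pos_pos)
    then show ?thesis by (metis less_irrefl zero_complex.sel(1))
  qed
  have **: "smooth1 (\<lambda>x. flat 0 (1 - x))"
    using smooth1_compose_real[OF smooth1_flat, where r="\<lambda>x. 1 - x"]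
      smooth1_diff[OF smooth1_const[of 1] smooth1_of_real_id] by simp
  show ?thesis
    unfolding smooth_step_def divide_inverse
    by (intro smooth1_mult smooth1_flat smooth1_inverse smooth1_add * **)
qed


section \<open>A graded form of the Schwartz space\<close>

definition rapid :: "(real \<times> real \<Rightarrow> complex) \<Rightarrow> bool" where
  "rapid f \<longleftrightarrow> periodic_t f \<and> continuous_on UNIV f \<and>
     (\<forall>\<gamma>. \<exists>K. \<forall>p. \<bar>snd p\<bar> ^ \<gamma> * norm (f p) \<le> K)"

lemma rapidI:
  assumes "periodic_t f" "continuous_on UNIV f"
    "\<And>\<gamma>. \<exists>K. \<forall>t x. \<bar>x\<bar> ^ \<gamma> * norm (f (t, x)) \<le> K"
  shows "rapid f"
  using assms by (simp add: rapid_def)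

lemma rapidD:
  assumes "rapid f"
  shows "f (t + 2 * pi, x) = f (t, x)" "continuous_on UNIV f"
  using assms by (auto simp: rapid_def periodic_t_def)

lemma rapid_bound:
  assumes "rapid f"
  obtains K where "K \<ge> 0" "\<And>t x. \<bar>x\<bar> ^ \<gamma> * norm (f (t, x)) \<le> K"
proof -
  obtain K where K: "\<And>t x. \<bar>x\<bar> ^ \<gamma> * norm (f (t, x)) \<le> K"
    using assms unfolding rapid_def by (metis snd_conv)
  moreover have "0 \<le> K"
    using K[of 0 0] by (meson mult_nonneg_nonneg norm_ge_zero order_trans abs_ge_zero zero_le_power)
  ultimately show ?thesis using that by blast
qed

lemma rapid_add:
  assumes "rapid f" "rapid g"
  shows "rapid (\<lambda>p. f p + g p)"
proof (rule rapidI)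
  show "periodic_t (\<lambda>p. f p + g p)"
    using assms by (auto simp: periodic_t_def rapidD)
  show "continuous_on UNIV (\<lambda>p. f p + g p)"
    by (intro continuous_on_add rapidD assms)
  fix \<gamma>
  obtain K1 where K1: "\<And>t x. \<bar>x\<bar> ^ \<gamma> * norm (f (t, x)) \<le> K1"
    using rapid_bound[OF assms(1)] by blast
  obtain K2 where K2: "\<And>t x. \<bar>x\<bar> ^ \<gamma> * norm (g (t, x)) \<le> K2"
    using rapid_bound[OF assms(2)] by blast
  have "\<bar>x\<bar> ^ \<gamma> * norm (f (t, x) + g (t, x)) \<le> K1 + K2" for t x
  proof -
    have "\<bar>x\<bar> ^ \<gamma> * norm (f (t, x) + g (t, x)) \<le> \<bar>x\<bar> ^ \<gamma> * (norm (f (t, x)) + norm (g (t, x)))"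
      by (intro mult_left_mono norm_triangle_ineq) auto
    also have "\<dots> \<le> K1 + K2"
      using add_mono[OF K1 K2] by (simp add: algebra_simps)
    finally show ?thesis .
  qed
  then show "\<exists>K. \<forall>t x. \<bar>x\<bar> ^ \<gamma> * norm (f (t, x) + g (t, x)) \<le> K" by blast
qed

lemma rapid_poly_mult:
  assumes "rapid f" "continuous_on UNIV g" "periodic_t g"
    "\<And>t x. norm (g (t, x)) \<le> M * \<bar>x\<bar> ^ m"
  shows "rapid (\<lambda>p. g p * f p)"
proof (rule rapidI)
  show "periodic_t (\<lambda>p. g p * f p)"
    using assms by (auto simp: periodic_t_def rapidD)
  show "continuous_on UNIV (\<lambda>p. g p * f p)"
    by (intro continuous_on_mult rapidD assms)
  fix \<gamma>
  obtain K where K: "K \<ge> 0" "\<And>t x. \<bar>x\<bar> ^ (\<gamma> + m) * norm (f (t, x)) \<le> K"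
    using rapid_bound[OF assms(1)] by metis
  have "\<bar>x\<bar> ^ \<gamma> * norm (g (t, x) * f (t, x)) \<le> \<bar>M\<bar> * K" for t x
  proof -
    have "norm (g (t, x)) \<le> \<bar>M\<bar> * \<bar>x\<bar> ^ m"
      by (rule order_trans[OF assms(4)]) (intro mult_right_mono; simp)
    then have "\<bar>x\<bar> ^ \<gamma> * norm (g (t, x) * f (t, x)) \<le> \<bar>x\<bar> ^ \<gamma> * ((\<bar>M\<bar> * \<bar>x\<bar> ^ m) * norm (f (t, x)))"
      unfolding norm_mult by (intro mult_left_mono mult_right_mono) auto
    also have "\<dots> = \<bar>M\<bar> * (\<bar>x\<bar> ^ (\<gamma> + m) * norm (f (t, x)))"
      by (simp add: power_add)
    also have "\<dots> \<le> \<bar>M\<bar> * K"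
      by (intro mult_left_mono K) auto
    finally show ?thesis .
  qed
  then show "\<exists>K. \<forall>t x. \<bar>x\<bar> ^ \<gamma> * norm (g (t, x) * f (t, x)) \<le> K" by blast
qed

text \<open>Counts how many partial derivatives, in any order, exist and decay rapidly. Closure
  properties become inductions on n, and functions of finite smoothness, such as the singular
  packet, are covered by n = 1.\<close>

primrec rapid_diff :: "nat \<Rightarrow> (real \<times> real \<Rightarrow> complex) \<Rightarrow> bool" where
  "rapid_diff 0 f = rapid f"
| "rapid_diff (Suc n) f = (rapid f \<and>
    (\<forall>t x. (\<lambda>s. f (s, x)) differentiable (at t) \<and> (\<lambda>y. f (t, y)) differentiable (at x)) \<and>
    rapid_diff n (pdt f) \<and> rapid_diff n (pdx f))"

lemma rapid_diff_SucI:
  assumes "rapid f"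
    "\<And>t x. ((\<lambda>s. f (s, x)) has_vector_derivative ft (t, x)) (at t)"
    "\<And>t x. ((\<lambda>y. f (t, y)) has_vector_derivative fx (t, x)) (at x)"
    "rapid_diff n ft" "rapid_diff n fx"
  shows "rapid_diff (Suc n) f"
proof -
  have "pdt f = ft" "pdx f = fx"
    unfolding pdt_def pdx_def using assms(2,3) by (auto intro!: vector_derivative_at)
  with assms(1,4,5) show ?thesis
    using differentiableI_vector[OF assms(2)] differentiableI_vector[OF assms(3)] by simp
qed

lemma rapid_diff_SucD:
  assumes "rapid_diff (Suc n) f"
  shows "((\<lambda>s. f (s, x)) has_vector_derivative pdt f (t, x)) (at t)"
    "((\<lambda>y. f (t, y)) has_vector_derivative pdx f (t, x)) (at x)"
    "rapid_diff n (pdt f)" "rapid_diff n (pdx f)"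
  using assms by (auto simp: pdt_def pdx_def vector_derivative_works[symmetric])

lemma rapid_diff_imp_rapid: "rapid_diff n f \<Longrightarrow> rapid f"
  by (cases n) auto

lemma rapid_diff_mono: "rapid_diff (Suc n) f \<Longrightarrow> rapid_diff n f"
proof (induction n arbitrary: f)
  case (Suc n)
  then show ?case by (subst rapid_diff.simps, subst (asm) rapid_diff.simps) blast
qed auto

lemma rapid_diff_le: "rapid_diff n f \<Longrightarrow> m \<le> n \<Longrightarrow> rapid_diff m f"
  by (induction n) (auto simp: le_Suc_eq simp del: rapid_diff.simps dest: rapid_diff_mono)

lemma rapid_diff_add: "rapid_diff n f \<Longrightarrow> rapid_diff n g \<Longrightarrow> rapid_diff n (\<lambda>p. f p + g p)"
proof (induction n arbitrary: f g)
  case (Suc n)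
  note f = rapid_diff_SucD[OF Suc.prems(1)] and g = rapid_diff_SucD[OF Suc.prems(2)]
  show ?case
    by (rule rapid_diff_SucI[where ft="\<lambda>p. pdt f p + pdt g p" and fx="\<lambda>p. pdx f p + pdx g p"])
      (simp_all only: rapid_add[OF Suc.prems[THEN rapid_diff_imp_rapid]] Suc.IH[OF f(3) g(3)] Suc.IH[OF f(4) g(4)]
        has_vector_derivative_add[OF f(1) g(1)] has_vector_derivative_add[OF f(2) g(2)])
qed (simp add: rapid_add)

section \<open>Multipliers of polynomial growth\<close>

definition temperate :: "(real \<times> real \<Rightarrow> complex) \<Rightarrow> bool" where
  "temperate g \<longleftrightarrow> periodic_t g \<and> continuous_on UNIV g \<and>
     (\<exists>M m. \<forall>t x. norm (g (t, x)) \<le> M * \<bar>x\<bar> ^ m)"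

text \<open>The derivatives are existentially quantified so that a multiplier is handled by
  exhibiting them, without evaluating \<open>pdt\<close> and \<open>pdx\<close>.\<close>

primrec temperate_diff :: "nat \<Rightarrow> (real \<times> real \<Rightarrow> complex) \<Rightarrow> bool" where
  "temperate_diff 0 g = temperate g"
| "temperate_diff (Suc n) g = (temperate g \<and>
    (\<exists>gt gx. (\<forall>t x. ((\<lambda>s. g (s, x)) has_vector_derivative gt (t, x)) (at t)) \<and>
       (\<forall>t x. ((\<lambda>y. g (t, y)) has_vector_derivative gx (t, x)) (at x)) \<and>
       temperate_diff n gt \<and> temperate_diff n gx))"

lemma temperate_diff_SucI:
  assumes "temperate g"
    "\<And>t x. ((\<lambda>s. g (s, x)) has_vector_derivative gt (t, x)) (at t)"
    "\<And>t x. ((\<lambda>y. g (t, y)) has_vector_derivative gx (t, x)) (at x)"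
    "temperate_diff n gt" "temperate_diff n gx"
  shows "temperate_diff (Suc n) g"
  using assms unfolding temperate_diff.simps by blast

lemma temperate_diff_imp_temperate: "temperate_diff n g \<Longrightarrow> temperate g"
  by (cases n) auto

lemma temperate_diff_mono: "temperate_diff (Suc n) g \<Longrightarrow> temperate_diff n g"
proof (induction n arbitrary: g)
  case (Suc n)
  then show ?case by (subst temperate_diff.simps, subst (asm) temperate_diff.simps) blast
qed auto

lemma rapid_temperate_mult: "temperate g \<Longrightarrow> rapid f \<Longrightarrow> rapid (\<lambda>p. g p * f p)"
  using rapid_poly_mult unfolding temperate_def by blast

lemma rapid_diff_temperate_mult:
  "temperate_diff n g \<Longrightarrow> rapid_diff n f \<Longrightarrow> rapid_diff n (\<lambda>p. g p * f p)"
proof (induction n arbitrary: f g)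
  case 0
  then show ?case by (simp add: rapid_temperate_mult)
next
  case (Suc n)
  obtain gt gx where g: "\<And>t x. ((\<lambda>s. g (s, x)) has_vector_derivative gt (t, x)) (at t)"
     "\<And>t x. ((\<lambda>y. g (t, y)) has_vector_derivative gx (t, x)) (at x)"
     "temperate_diff n gt" "temperate_diff n gx"
    using Suc.prems(1) by auto
  note f = rapid_diff_SucD[OF Suc.prems(2)]
  note f0 = rapid_diff_mono[OF Suc.prems(2)] and g0 = temperate_diff_mono[OF Suc.prems(1)]
  show ?case
  proof (rule rapid_diff_SucI)
    show "rapid (\<lambda>p. g p * f p)"
      by (rule rapid_temperate_mult[OF temperate_diff_imp_temperate rapid_diff_imp_rapid, OF g0 f0])
    show "((\<lambda>s. g (s, x) * f (s, x)) has_vector_derivative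
        (\<lambda>p. g p * pdt f p + gt p * f p) (t, x)) (at t)" for t x
      using has_vector_derivative_mult[OF g(1) f(1)] by simp
    show "((\<lambda>y. g (t, y) * f (t, y)) has_vector_derivative
        (\<lambda>p. g p * pdx f p + gx p * f p) (t, x)) (at x)" for t x
      using has_vector_derivative_mult[OF g(2) f(2)] by simp
    show "rapid_diff n (\<lambda>p. g p * pdt f p + gt p * f p)"
      by (rule rapid_diff_add[OF Suc.IH[OF g0 f(3)] Suc.IH[OF g(3) f0]])
    show "rapid_diff n (\<lambda>p. g p * pdx f p + gx p * f p)"
      by (rule rapid_diff_add[OF Suc.IH[OF g0 f(4)] Suc.IH[OF g(4) f0]])
  qed
qed

lemma rapid_imp_temperate:
  assumes "rapid f"
  shows "temperate f"
proof -
  obtain K where "\<And>t x. \<bar>x\<bar> ^ 0 * norm (f (t, x)) \<le> K"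
    using rapid_bound[OF assms] by blast
  then have "\<exists>M m. \<forall>t x. norm (f (t, x)) \<le> M * \<bar>x\<bar> ^ m"
    by (intro exI[of _ K] exI[of _ 0]) simp
  with assms show ?thesis
    by (auto simp: temperate_def rapid_def)
qed

lemma rapid_diff_imp_temperate_diff: "rapid_diff n f \<Longrightarrow> temperate_diff n f"
proof (induction n arbitrary: f)
  case (Suc n)
  show ?case
    using rapid_imp_temperate[OF rapid_diff_imp_rapid[OF Suc.prems]] rapid_diff_SucD[OF Suc.prems] Suc.IH
    unfolding temperate_diff.simps by blast
qed (simp add: rapid_imp_temperate)

lemma temperate_diff_const: "temperate_diff n (\<lambda>_. a)"
proof (induction n arbitrary: a)
  case 0
  have "\<exists>M m. \<forall>t x::real. norm a \<le> M * \<bar>x\<bar> ^ m"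
    by (intro exI[of _ "norm a"] exI[of _ 0]) simp
  then show ?case by (simp add: temperate_def periodic_t_def)
next
  case (Suc n)
  show ?case
    by (rule temperate_diff_SucI[where gt="\<lambda>_. 0" and gx="\<lambda>_. 0"])
      (use temperate_diff_imp_temperate[OF Suc] Suc in auto)
qed

lemma rapid_diff_cmult: "rapid_diff n f \<Longrightarrow> rapid_diff n (\<lambda>p. a * f p)"
  by (rule rapid_diff_temperate_mult[OF temperate_diff_const])

lemma temperate_diff_x: "temperate_diff n (\<lambda>p. of_real (snd p))"
proof -
  have x: "temperate (\<lambda>p. of_real (snd p))"
  proof -
    have "\<exists>M m. \<forall>t x::real. norm (complex_of_real x) \<le> M * \<bar>x\<bar> ^ m"
      by (intro exI[of _ "1::real"] exI[of _ 1]) simp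
    then show ?thesis
      by (simp add: temperate_def periodic_t_def) (intro continuous_intros)
  qed
  show ?thesis
  proof (cases n)
    case (Suc m)
    show ?thesis
      unfolding Suc
      by (rule temperate_diff_SucI[where gt="\<lambda>_. 0" and gx="\<lambda>_. 1"])
        (use x temperate_diff_const in \<open>auto intro!: derivative_eq_intros\<close>)
  qed (use x in simp)
qed

section \<open>Periodic functions, translations and elementary multipliers\<close>

lemma periodic1_multiple:
  assumes "\<And>t. c (t + 2 * pi) = c t"
  shows "c (t + of_int k * (2 * pi)) = c t"
proof (induction k arbitrary: t rule: int_induct[where k=0])
  case (step1 i)
  show ?case
    using step1(2)[of "t + 2 * pi"] assms by (simp add: algebra_simps)
next
  case (step2 i)
  show ?case
    using step2(2)[of "t - 2 * pi"] assms[of "t - 2 * pi"] by (simp add: algebra_simps)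
qed simp

lemma periodic_shift:
  fixes t a :: real
  obtains k :: int where "a \<le> t + of_int k * (2 * pi)" "t + of_int k * (2 * pi) < a + 2 * pi"
proof -
  define k where "k = - \<lfloor>(t - a) / (2 * pi)\<rfloor>"
  have "of_int (- k) \<le> (t - a) / (2 * pi)" "(t - a) / (2 * pi) < of_int (- k) + 1"
    unfolding k_def minus_minus by linarith+
  then have "a \<le> t + of_int k * (2 * pi)" "t + of_int k * (2 * pi) < a + 2 * pi"
    by (simp_all add: field_simps)
  then show ?thesis by (rule that)
qed

lemma periodic_bounded:
  fixes c :: "real \<Rightarrow> 'a :: real_normed_vector"
  assumes "\<And>t. c (t + 2 * pi) = c t" "continuous_on UNIV c"
  obtains M where "M \<ge> 0" "\<And>t. norm (c t) \<le> M"
proof -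
  have "bounded (c ` {0..2 * pi})"
    by (intro compact_imp_bounded compact_continuous_image continuous_on_subset[OF assms(2)]) auto
  then obtain M where M: "\<And>t. t \<in> {0..2 * pi} \<Longrightarrow> norm (c t) \<le> M"
    unfolding bounded_iff by blast
  have "norm (c t) \<le> M" for t
  proof -
    obtain k :: int where "0 \<le> t + of_int k * (2 * pi)" "t + of_int k * (2 * pi) < 0 + 2 * pi"
      by (rule periodic_shift)
    with M[of "t + of_int k * (2 * pi)"] show ?thesis
      by (simp add: periodic1_multiple[of c, OF assms(1)])
  qed
  moreover have "0 \<le> M" using calculation[of 0] norm_ge_zero order_trans by blast
  ultimately show ?thesis using that by blast
qed

lemma has_vector_derivative_shift:
  fixes f :: "real \<Rightarrow> 'a :: real_normed_vector"
  assumes "(f has_vector_derivative f') (at (t + a))"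
  shows "((\<lambda>s. f (s + a)) has_vector_derivative f') (at t)"
proof -
  have "((\<lambda>s. s + a) has_vector_derivative 1) (at t)"
    by (auto intro!: derivative_eq_intros)
  from vector_diff_chain_at[OF this assms] show ?thesis
    by (simp add: o_def)
qed

lemma has_vector_derivative_reflect:
  fixes f :: "real \<Rightarrow> 'a :: real_normed_vector"
  assumes "(f has_vector_derivative f') (at (a - t))"
  shows "((\<lambda>s. f (a - s)) has_vector_derivative - f') (at t)"
proof -
  have "((\<lambda>s. a - s) has_vector_derivative - 1) (at t)"
    by (auto intro!: derivative_eq_intros)
  from vector_diff_chain_at[OF this assms] show ?thesis
    by (simp add: o_def)
qed

lemma has_vector_derivative_iexp:
  "((\<lambda>x. exp (\<i> * of_real (a * x))) has_vector_derivative \<i> * of_real a * exp (\<i> * of_real (a * x))) (at x)"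
proof -
  have "((\<lambda>x. \<i> * of_real (a * x)) has_vector_derivative \<i> * of_real a) (at x)"
    by (auto intro!: derivative_eq_intros simp: scaleR_conv_of_real)
  from field_vector_diff_chain_at[OF this DERIV_exp] show ?thesis
    by (simp add: o_def)
qed

lemma periodic1_vd:
  assumes "smooth1 a" "periodic1 a"
  shows "periodic1 (vd a)"
proof -
  have "vd a (t + 2 * pi) = vd a t" for t
  proof -
    have "((\<lambda>s. a (s + 2 * pi)) has_vector_derivative vd a (t + 2 * pi)) (at t)"
      by (rule has_vector_derivative_shift[OF smooth1_deriv(1)[OF assms(1)]])
    moreover have "(\<lambda>s. a (s + 2 * pi)) = a"
      using assms(2) by (auto simp: periodic1_def)
    ultimately show ?thesis
      by (simp add: vd_def vector_derivative_at)
  qed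
  then show ?thesis by (simp add: periodic1_def)
qed

lemma temperate_diff_t:
  assumes "smooth1 a" "periodic1 a"
  shows "temperate_diff n (\<lambda>p. a (fst p))"
  using assms
proof (induction n arbitrary: a)
  case (0 a)
  obtain M where "\<And>t. norm (a t) \<le> M"
    using periodic_bounded[of a] 0 smooth1_continuous by (metis periodic1_def)
  then have "\<exists>M m. \<forall>t x::real. norm (a (fst (t, x))) \<le> M * \<bar>x\<bar> ^ m"
    by (intro exI[of _ M] exI[of _ 0]) simp
  then show ?case
    using 0 continuous_on_compose2[OF smooth1_continuous continuous_on_fst[OF continuous_on_id], of a]
    by (auto simp: temperate_def periodic_t_def periodic1_def)
next
  case (Suc n)
  show ?case
  proof (rule temperate_diff_SucI)
    show "temperate (\<lambda>p. a (fst p))"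
      by (rule temperate_diff_imp_temperate[OF Suc.IH[OF Suc.prems]])
    show "((\<lambda>s. a (fst (s, x))) has_vector_derivative (\<lambda>p. vd a (fst p)) (t, x)) (at t)" for t x :: real
      using smooth1_deriv(1)[OF Suc.prems(1)] by simp
    show "((\<lambda>y. a (fst (t, y))) has_vector_derivative (\<lambda>_. 0) (t, x)) (at x)" for t x :: real
      by simp
    show "temperate_diff n (\<lambda>p. vd a (fst p))"
      using Suc.IH[OF smooth1_deriv(2)[OF Suc.prems(1)] periodic1_vd[OF Suc.prems]] .
  qed (rule temperate_diff_const)
qed

lemma temperate_diff_wave:
  "temperate_diff n (\<lambda>p. a * exp (\<i> * of_real (\<xi> * snd p)))"
proof (induction n arbitrary: a)
  case (0 a)
  have "\<exists>M m. \<forall>t x::real. norm (a * exp (\<i> * of_real (\<xi> * x))) \<le> M * \<bar>x\<bar> ^ m"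
    by (intro exI[of _ "norm a"] exI[of _ 0]) (simp add: norm_mult)
  then show ?case
    by (simp add: temperate_def periodic_t_def) (intro continuous_intros)
next
  case (Suc n)
  show ?case
  proof (rule temperate_diff_SucI)
    show "temperate (\<lambda>p. a * exp (\<i> * of_real (\<xi> * snd p)))"
      by (rule temperate_diff_imp_temperate[OF Suc])
    show "((\<lambda>s. a * exp (\<i> * of_real (\<xi> * snd (s, x)))) has_vector_derivative (\<lambda>_. 0) (t, x)) (at t)"
      for t x :: real by simp
    from has_vector_derivative_mult_right[OF has_vector_derivative_iexp]
    show "((\<lambda>y. a * exp (\<i> * of_real (\<xi> * snd (t, y)))) has_vector_derivative
        (\<lambda>p. a * (\<i> * of_real \<xi>) * exp (\<i> * of_real (\<xi> * snd p))) (t, x)) (at x)" for t x :: real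
      by (simp add: mult.assoc)
    show "temperate_diff n (\<lambda>p. a * (\<i> * of_real \<xi>) * exp (\<i> * of_real (\<xi> * snd p)))"
      by (rule Suc)
  qed (rule temperate_diff_const)
qed

text \<open>Write f (s, y) as f (s, a) plus the integral of \<open>fx\<close> from a to y and
  differentiate in s under the integral. This expresses \<open>ft\<close> as an integral of
  \<open>fxt\<close>, whose derivative in y is then the integrand. Differentiability of
  \<open>ft\<close> in x is part of the conclusion, and this is what the \<xi>-derivative of the
  solution operator will require.\<close>

lemma mixed_partials_commute:
  fixes f ft fx fxt :: "real \<times> real \<Rightarrow> complex"
  assumes ft: "\<And>t x. ((\<lambda>s. f (s, x)) has_vector_derivative ft (t, x)) (at t)"
    and fx: "\<And>t x. ((\<lambda>y. f (t, y)) has_vector_derivative fx (t, x)) (at x)"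
    and fxt: "\<And>t x. ((\<lambda>s. fx (s, x)) has_vector_derivative fxt (t, x)) (at t)"
    and cx: "continuous_on UNIV fx" and cxt: "continuous_on UNIV fxt"
  shows "((\<lambda>y. ft (t, y)) has_vector_derivative fxt (t, x)) (at x)"
proof -
  have sec: "continuous_on S (\<lambda>y. g (s, y))" if "continuous_on UNIV g"
    for S and g :: "real \<times> real \<Rightarrow> complex" and s
    by (rule continuous_on_compose2[OF that]) (auto intro!: continuous_intros)
  \<comment> \<open>Any base point to the left of x works.\<close>
  define a where "a = x - 1"
  have fint: "f (s, y) = f (s, a) + integral {a..y} (\<lambda>y. fx (s, y))" if "y \<ge> a" for s y
  proof -
    have "((\<lambda>y. fx (s, y)) has_integral (f (s, y) - f (s, a))) {a..y}"
      by (rule fundamental_theorem_of_calculus[where f="\<lambda>y. f (s, y)", OF that])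
        (rule has_vector_derivative_at_within[OF fx])
    then show ?thesis by (simp add: integral_unique)
  qed
  have ftint: "ft (t, y) = ft (t, a) + integral {a..y} (\<lambda>y. fxt (t, y))" if "y \<ge> a" for y
  proof -
    have "((\<lambda>s. integral (cbox a y) (\<lambda>z. fx (s, z))) has_vector_derivative
        integral (cbox a y) (\<lambda>z. fxt (t, z))) (at t within UNIV)"
      using fxt by (intro leibniz_rule_vector_derivative)
        (auto intro!: integrable_continuous_interval sec cx continuous_on_subset[OF cxt])
    then have "((\<lambda>s. f (s, a) + integral {a..y} (\<lambda>z. fx (s, z))) has_vector_derivative
        ft (t, a) + integral {a..y} (\<lambda>z. fxt (t, z))) (at t)"
      by (intro has_vector_derivative_add ft) simp
    moreover have "(\<lambda>s. f (s, a) + integral {a..y} (\<lambda>z. fx (s, z))) = (\<lambda>s. f (s, y))"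
      using fint[OF that] by auto
    ultimately show ?thesis
      using vector_derivative_unique_at ft by metis
  qed
  have "((\<lambda>y. ft (t, a) + integral {a..y} (\<lambda>y. fxt (t, y))) has_vector_derivative 0 + fxt (t, x))
      (at x within {a..x + 1})"
    by (intro has_vector_derivative_add has_vector_derivative_const integral_has_vector_derivative sec cxt)
      (auto simp: a_def)
  then have "((\<lambda>y. ft (t, a) + integral {a..y} (\<lambda>y. fxt (t, y))) has_vector_derivative fxt (t, x)) (at x)"
    by (simp add: a_def at_within_Icc_at)
  then show ?thesis
  proof (rule has_vector_derivative_transform_within_open)
    show "open {a<..}" "x \<in> {a<..}" by (auto simp: a_def)
    show "ft (t, a) + integral {a..y} (\<lambda>y. fxt (t, y)) = ft (t, y)" if "y \<in> {a<..}" for y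
      using ftint[of y] that by simp
  qed
qed

section \<open>Partial derivatives of Schwartz functions\<close>

lemma partials_trans: "g \<in> partials f \<Longrightarrow> h \<in> partials g \<Longrightarrow> h \<in> partials f"
  by (rotate_tac 1, induction rule: partials.induct) (auto intro: partials.intros)

lemma smooth2_partials: "smooth2 f \<Longrightarrow> g \<in> partials f \<Longrightarrow> smooth2 g"
  unfolding smooth2_def using partials_trans by blast

lemma smooth2D:
  assumes "smooth2 f"
  shows "((\<lambda>s. f (s, x)) has_vector_derivative pdt f (t, x)) (at t)"
    "((\<lambda>y. f (t, y)) has_vector_derivative pdx f (t, x)) (at x)"
    "smooth2 (pdt f)" "smooth2 (pdx f)" "continuous_on UNIV f"
proof -
  show "smooth2 (pdt f)" "smooth2 (pdx f)"
    using smooth2_partials[OF assms] by (auto intro: partials.intros)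
  have "\<forall>t x. (\<lambda>s. f (s, x)) differentiable (at t) \<and> (\<lambda>y. f (t, y)) differentiable (at x)"
    and "continuous_on UNIV f"
    using assms partials.base unfolding smooth2_def by auto
  then show "((\<lambda>s. f (s, x)) has_vector_derivative pdt f (t, x)) (at t)"
    "((\<lambda>y. f (t, y)) has_vector_derivative pdx f (t, x)) (at x)" "continuous_on UNIV f"
    by (auto simp: pdt_def pdx_def vector_derivative_works[symmetric])
qed

lemma pdx_pdt_commute: "smooth2 f \<Longrightarrow> pdx (pdt f) = pdt (pdx f)"
proof (rule ext)
  fix p assume f: "smooth2 f"
  note f1 = smooth2D[OF f] and f2 = smooth2D[OF smooth2D(4)[OF f]]
  have "((\<lambda>y. pdt f (fst p, y)) has_vector_derivative pdt (pdx f) (fst p, snd p)) (at (snd p))"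
    by (rule mixed_partials_commute[OF f1(1,2) f2(1,5) smooth2D(5)[OF f2(3)]])
  then show "pdx (pdt f) p = pdt (pdx f) p"
    by (simp add: pdx_def[of "pdt f"] vector_derivative_at)
qed

text \<open>In \<open>dmix\<close> the x-derivatives act first, so a t-derivative taken before them
  has to be moved past all of them.\<close>

lemma dmix_pdt:
  assumes "smooth2 f"
  shows "dmix \<alpha> \<beta> (pdt f) = dmix (Suc \<alpha>) \<beta> f"
proof -
  have "(pdx ^^ \<beta>) (pdt f) = pdt ((pdx ^^ \<beta>) f) \<and> smooth2 ((pdx ^^ \<beta>) f)"
    by (induction \<beta>) (auto simp: assms pdx_pdt_commute smooth2D)
  then show ?thesis
    by (simp add: dmix_def funpow_Suc_right del: funpow.simps(2))
qed

lemma dmix_pdx: "dmix \<alpha> \<beta> (pdx f) = dmix \<alpha> (Suc \<beta>) f"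
  by (simp add: dmix_def funpow_Suc_right del: funpow.simps(2))

lemma dmix_in_partials: "dmix \<alpha> \<beta> f \<in> partials f"
proof -
  have "(pdx ^^ \<beta>) f \<in> partials f"
    by (induction \<beta>) (auto intro: partials.intros)
  then show ?thesis
    unfolding dmix_def by (induction \<alpha>) (auto intro: partials.intros)
qed

lemma periodic_t_pdt:
  assumes "periodic_t f" "smooth2 f"
  shows "periodic_t (pdt f)"
proof -
  have "pdt f (t + 2 * pi, x) = pdt f (t, x)" for t x
  proof -
    have "((\<lambda>s. f (s + 2 * pi, x)) has_vector_derivative pdt f (t + 2 * pi, x)) (at t)"
      by (rule has_vector_derivative_shift[OF smooth2D(1)[OF assms(2)]])
    moreover have "(\<lambda>s. f (s + 2 * pi, x)) = (\<lambda>s. f (s, x))"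
      using assms(1) by (auto simp: periodic_t_def)
    ultimately show ?thesis
      using vector_derivative_unique_at smooth2D(1)[OF assms(2)] by metis
  qed
  then show ?thesis by (simp add: periodic_t_def)
qed

lemma schwartz_pdt:
  assumes "f \<in> schwartz"
  shows "pdt f \<in> schwartz"
  using assms by (simp add: schwartz_def dmix_pdt smooth2D periodic_t_pdt)

lemma schwartz_pdx:
  assumes "f \<in> schwartz"
  shows "pdx f \<in> schwartz"
  using assms by (simp add: schwartz_def dmix_pdx smooth2D) (simp add: periodic_t_def pdx_def)

lemma schwartz_imp_rapid:
  assumes "f \<in> schwartz"
  shows "rapid f"
proof (rule rapidI)
  show "periodic_t f" "continuous_on UNIV f"
    using assms smooth2D by (auto simp: schwartz_def)
  fix \<gamma>
  have "bounded (range (\<lambda>p. of_real (snd p ^ \<gamma>) * dmix 0 0 f p))"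
    using assms unfolding schwartz_def by blast
  then obtain K where "\<forall>p. norm (of_real (snd p ^ \<gamma>) * f p) \<le> K"
    unfolding bounded_iff dmix_def by (simp only: funpow.simps id_apply ball_simps) blast
  then have "\<forall>t x. norm (of_real (snd (t, x) ^ \<gamma>) * f (t, x)) \<le> K" by blast
  then show "\<exists>K. \<forall>t x. \<bar>x\<bar> ^ \<gamma> * norm (f (t, x)) \<le> K"
    by (auto simp: norm_mult norm_power)
qed

text \<open>The bridge to the graded spaces: from here on, membership in \<open>schwartz\<close> is
  proved by induction on n. One direction rests on closure under \<open>pdt\<close> and
  \<open>pdx\<close>, the other on every iterated partial derivative being \<open>rapid_diff\<close>
  of all orders.\<close>

lemma schwartz_iff: "f \<in> schwartz \<longleftrightarrow> (\<forall>n. rapid_diff n f)"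
proof
  assume f: "f \<in> schwartz"
  have "rapid_diff n f" if "f \<in> schwartz" for n f
    using that
  proof (induction n arbitrary: f)
    case (Suc n)
    then have "smooth2 f" by (simp add: schwartz_def)
    then show ?case
      using Suc by (intro rapid_diff_SucI[OF schwartz_imp_rapid smooth2D(1,2)] Suc.IH schwartz_pdt schwartz_pdx)
  qed (simp add: schwartz_imp_rapid)
  then show "\<forall>n. rapid_diff n f" using f by blast
next
  assume f: "\<forall>n. rapid_diff n f"
  have partial: "\<forall>n. rapid_diff n g" if "g \<in> partials f" for g
    using that by (induction) (use f rapid_diff_SucD in blast)+
  have "continuous_on UNIV g \<and> (\<forall>t x. (\<lambda>s. g (s, x)) differentiable (at t) \<and> (\<lambda>y. g (t, y)) differentiable (at x))"
    if "g \<in> partials f" for g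
  proof -
    have "rapid_diff (Suc 0) g" using partial[OF that] by blast
    then show ?thesis using rapidD(2) by auto
  qed
  then have "smooth2 f" by (simp add: smooth2_def)
  moreover have "periodic_t f"
    using f rapid_diff_imp_rapid by (auto simp: rapid_def)
  moreover have "bounded (range (\<lambda>p. of_real (snd p ^ \<gamma>) * dmix \<alpha> \<beta> f p))" for \<alpha> \<beta> \<gamma>
  proof -
    have "rapid (dmix \<alpha> \<beta> f)"
      using partial[OF dmix_in_partials] rapid_diff_imp_rapid by blast
    then obtain K where "\<And>t x. \<bar>x\<bar> ^ \<gamma> * norm (dmix \<alpha> \<beta> f (t, x)) \<le> K"
      using rapid_bound by metis
    then show ?thesis
      unfolding bounded_iff by (auto simp: norm_mult norm_power intro!: exI[of _ K])
  qed
  ultimately show "f \<in> schwartz" by (simp add: schwartz_def)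
qed

lemma schwartz_cmult: "f \<in> schwartz \<Longrightarrow> (\<lambda>p. a * f p) \<in> schwartz"
  by (simp add: schwartz_iff rapid_diff_cmult)

lemma schwartz_mult_t: "smooth1 a \<Longrightarrow> periodic1 a \<Longrightarrow> f \<in> schwartz \<Longrightarrow> (\<lambda>p. a (fst p) * f p) \<in> schwartz"
  using rapid_diff_temperate_mult[OF temperate_diff_t] by (simp add: schwartz_iff)

lemma schwartz_mult_x: "f \<in> schwartz \<Longrightarrow> (\<lambda>p. of_real (snd p) * f p) \<in> schwartz"
  using rapid_diff_temperate_mult[OF temperate_diff_x] by (simp add: schwartz_iff)

lemma schwartz_derivs:
  assumes "f \<in> schwartz"
  shows "((\<lambda>s. f (s, x)) has_vector_derivative pdt f (t, x)) (at t)"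
    "((\<lambda>y. f (t, y)) has_vector_derivative pdx f (t, x)) (at x)"
  using assms smooth2D by (auto simp: schwartz_def)

section \<open>Integration over the cylinder\<close>

lemma integrable_Cauchy_density: "integrable lborel (\<lambda>x::real. inverse (1 + x\<^sup>2))"
  using integrable_inverse_1_plus_square by (simp add: set_integrable_def)

text \<open>Decay of orders 0 and 2 adds up to the majorant 1 / (1 + x^2), which serves for all
  integrals in x.\<close>

lemma rapid_Cauchy_bound:
  assumes "rapid f"
  obtains K where "K \<ge> 0" "\<And>t x. norm (f (t, x)) \<le> K * inverse (1 + x\<^sup>2)"
proof -
  obtain K0 where K0: "K0 \<ge> 0" "\<And>t x. \<bar>x\<bar> ^ 0 * norm (f (t, x)) \<le> K0"
    using rapid_bound[OF assms] by metis
  obtain K2 where K2: "K2 \<ge> 0" "\<And>t x. \<bar>x\<bar> ^ 2 * norm (f (t, x)) \<le> K2"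
    using rapid_bound[OF assms] by metis
  have "norm (f (t, x)) \<le> (K0 + K2) * inverse (1 + x\<^sup>2)" for t x
  proof -
    have "(1 + x\<^sup>2) * norm (f (t, x)) \<le> K0 + K2"
      using add_mono[OF K0(2)[of x t] K2(2)[of x t]] by (simp add: algebra_simps)
    moreover have "1 + x\<^sup>2 > 0" by (simp add: add_pos_nonneg)
    ultimately show ?thesis by (simp add: field_simps)
  qed
  with K0 K2 that[of "K0 + K2"] show ?thesis by simp
qed

lemma section_measurable:
  fixes f :: "real \<times> real \<Rightarrow> complex"
  assumes "continuous_on UNIV f"
  shows "(\<lambda>x. f (t, x)) \<in> borel_measurable borel" "f \<in> borel_measurable borel"
    "continuous_on S (\<lambda>x. f (t, x))" "continuous_on S (\<lambda>t. f (t, x))"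
proof -
  show c: "continuous_on S (\<lambda>x. f (t, x))" "continuous_on S (\<lambda>t. f (t, x))" for S t x
    by (rule continuous_on_compose2[OF assms]; auto intro!: continuous_intros)+
  show "(\<lambda>x. f (t, x)) \<in> borel_measurable borel" "f \<in> borel_measurable borel"
    using c(1) assms by (auto intro: borel_measurable_continuous_onI)
qed

lemma rapid_integrable_x:
  assumes "rapid f"
  shows "integrable lborel (\<lambda>x. f (t, x))"
proof -
  obtain K where K0: "K \<ge> 0" and K: "\<And>t x. norm (f (t, x)) \<le> K * inverse (1 + x\<^sup>2)"
    using rapid_Cauchy_bound[OF assms] by metis
  show ?thesis
  proof (rule Bochner_Integration.integrable_bound)
    show "integrable lborel (\<lambda>x. K * inverse (1 + x\<^sup>2))"
      using integrable_Cauchy_density by simp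
    show "AE x in lborel. norm (f (t, x)) \<le> norm (K * inverse (1 + x\<^sup>2))"
      using K0 by (auto intro!: AE_I2 order_trans[OF K] simp: abs_mult)
  qed (use section_measurable[OF rapidD(2)[OF assms]] in simp)
qed

definition int2 :: "(real \<times> real \<Rightarrow> complex) \<Rightarrow> complex" where
  "int2 f = (LINT p:{0..2*pi} \<times> UNIV|lborel. f p)"

lemma integrable_cylinder_density:
  "integrable lborel (\<lambda>p::real\<times>real. indicator {0..2*pi} (fst p) * inverse (1 + (snd p)\<^sup>2) :: real)"
proof -
  have "integrable (lborel \<Otimes>\<^sub>M lborel) (\<lambda>p::real\<times>real. indicator {0..2*pi} (fst p) * inverse (1 + (snd p)\<^sup>2) :: real)"
  proof (rule lborel_pair.Fubini_integrable)
    show "integrable lborel (\<lambda>x. LINT y|lborel. norm (indicator {0..2*pi} (fst (x, y)) * inverse (1 + (snd (x, y::real))\<^sup>2) :: real))"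
    proof -
      have "(\<lambda>x::real. LINT y|lborel. norm (indicator {0..2*pi} (fst (x, y)) * inverse (1 + (snd (x, y::real))\<^sup>2) :: real))
        = (\<lambda>x. indicator {0..2*pi} x *\<^sub>R (LINT y|lborel. inverse (1 + y\<^sup>2)))"
        by (auto simp: indicator_def abs_mult)
      then show ?thesis by simp
    qed
  qed (use integrable_Cauchy_density in \<open>auto simp: borel_prod[symmetric]\<close>)
  then show ?thesis by (simp add: lborel_prod)
qed

lemma int2_integrable:
  assumes "rapid f"
  shows "set_integrable lborel ({0..2*pi} \<times> UNIV) f"
proof -
  obtain K where K0: "K \<ge> 0" and K: "\<And>t x. norm (f (t, x)) \<le> K * inverse (1 + x\<^sup>2)"
    using rapid_Cauchy_bound[OF assms] by metis
  have [measurable]: "f \<in> borel_measurable borel"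
    using section_measurable[OF rapidD(2)[OF assms]] by simp
  show ?thesis
    unfolding set_integrable_def
  proof (rule Bochner_Integration.integrable_bound)
    show "integrable lborel (\<lambda>p::real\<times>real. K * (indicator {0..2*pi} (fst p) * inverse (1 + (snd p)\<^sup>2)))"
      using integrable_cylinder_density by simp
    show "AE p in lborel. norm (indicator ({0..2*pi} \<times> UNIV) p *\<^sub>R f p)
        \<le> norm (K * (indicator {0..2*pi} (fst p) * inverse (1 + (snd p)\<^sup>2)))"
      using K0 by (intro AE_I2) (auto simp: indicator_def intro!: order_trans[OF K] simp: abs_mult)
  qed (auto intro!: borel_measurable_scaleR borel_measurable_indicator borel_closed closed_Times)
qed

lemma
  assumes "rapid f"
  shows int2_iterated: "int2 f = (LINT t|lborel. indicator {0..2*pi} t *\<^sub>R (LINT x|lborel. f (t, x)))"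
    and int2_iterated': "int2 f = (LINT x|lborel. (LINT t|lborel. indicator {0..2*pi} t *\<^sub>R f (t, x)))"
proof -
  have I: "integrable (lborel \<Otimes>\<^sub>M lborel) (\<lambda>(t, x). indicator {0..2*pi} t *\<^sub>R f (t, x))"
    using int2_integrable[OF assms] unfolding set_integrable_def lborel_prod
    by (simp add: indicator_times case_prod_unfold)
  have e: "int2 f = integral\<^sup>L (lborel \<Otimes>\<^sub>M lborel) (\<lambda>(t, x). indicator {0..2*pi} t *\<^sub>R f (t, x))"
    unfolding int2_def set_lebesgue_integral_def lborel_prod
    by (simp add: indicator_times case_prod_unfold)
  show "int2 f = (LINT t|lborel. indicator {0..2*pi} t *\<^sub>R (LINT x|lborel. f (t, x)))"
    unfolding e lborel_pair.integral_fst'[OF I, symmetric] by simp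
  show "int2 f = (LINT x|lborel. (LINT t|lborel. indicator {0..2*pi} t *\<^sub>R f (t, x)))"
    unfolding e lborel_pair.integral_snd[OF I, symmetric] by simp
qed

lemma int2_add: "rapid f \<Longrightarrow> rapid g \<Longrightarrow> int2 (\<lambda>p. f p + g p) = int2 f + int2 g"
  unfolding int2_def by (intro set_integral_add int2_integrable)

lemma int2_cmult: "int2 (\<lambda>p. a * f p) = a * int2 f"
  unfolding int2_def by (rule set_integral_mult_right)

text \<open>The decay bound makes g (n) and g (- n) tend to 0, so the integrals of g' over {-n..n}
  do too; they converge to the full integral by domination with norm (g' x).\<close>

lemma lborel_integral_derivative_eq_0:
  fixes g :: "real \<Rightarrow> complex"
  assumes g: "\<And>x. (g has_vector_derivative g' x) (at x)" "continuous_on UNIV g'"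
    "integrable lborel g'" "\<And>x. \<bar>x\<bar> * norm (g x) \<le> K"
  shows "(LINT x|lborel. g' x) = 0"
proof (rule LIMSEQ_unique)
  show "(\<lambda>n. LINT x|lborel. indicator {- real n..real n} x *\<^sub>R g' x) \<longlonglongrightarrow> (LINT x|lborel. g' x)"
  proof (rule integral_dominated_convergence[where w="\<lambda>x. norm (g' x)"])
    show "AE x in lborel. (\<lambda>n. indicator {- real n..real n} x *\<^sub>R g' x) \<longlonglongrightarrow> g' x"
    proof (rule AE_I2, rule tendsto_eventually)
      fix x :: real
      obtain N where "\<bar>x\<bar> \<le> real N" using real_arch_simple by blast
      then have "x \<in> {- real n..real n}" if "N \<le> n" for n
        using of_nat_mono[OF that, where 'a=real] by auto
      then show "\<forall>\<^sub>F n in sequentially. indicator {- real n..real n} x *\<^sub>R g' x = g' x"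
        by (intro eventually_sequentiallyI[of N]) simp
    qed
  qed (use g(3) in \<open>auto simp: indicator_def\<close>)
  have e: "(LINT x|lborel. indicator {- real n..real n} x *\<^sub>R g' x) = g (real n) - g (- real n)" for n
    using g(1) by (intro integral_FTC_atLeastAtMost continuous_on_subset[OF g(2)])
      (auto intro: has_vector_derivative_at_within)
  show "(\<lambda>n. LINT x|lborel. indicator {- real n..real n} x *\<^sub>R g' x) \<longlonglongrightarrow> 0"
  proof (rule Lim_null_comparison)
    show "\<forall>\<^sub>F n in sequentially. norm (LINT x|lborel. indicator {- real n..real n} x *\<^sub>R g' x) \<le> 2 * K / real n"
    proof (rule eventually_sequentiallyI[of 1])
      fix n :: nat assume "1 \<le> n"
      then have "norm (g (real n)) \<le> K / real n" "norm (g (- real n)) \<le> K / real n"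
        using g(4)[of "real n"] g(4)[of "- real n"] by (auto simp: field_simps)
      then show "norm (LINT x|lborel. indicator {- real n..real n} x *\<^sub>R g' x) \<le> 2 * K / real n"
        unfolding e using norm_triangle_ineq4[of "g (real n)" "g (- real n)"] by linarith
    qed
    show "(\<lambda>n. 2 * K / real n) \<longlonglongrightarrow> 0"
      by (rule lim_const_over_n)
  qed
qed

lemma int2_pdt:
  assumes "rapid_diff 1 h"
  shows "int2 (pdt h) = 0"
proof -
  note h = assms[unfolded One_nat_def]
  have r: "rapid (pdt h)" using rapid_diff_SucD(3)[OF h] by simp
  have "(LINT t|lborel. indicator {0..2*pi} t *\<^sub>R pdt h (t, x)) = h (2 * pi, x) - h (0, x)" for x
    using rapid_diff_SucD(1)[OF h] section_measurable[OF rapidD(2)[OF r]]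
    by (intro integral_FTC_atLeastAtMost) (auto intro: has_vector_derivative_at_within)
  moreover have "h (2 * pi, x) = h (0, x)" for x
    using rapidD(1)[OF rapid_diff_imp_rapid[OF h], of 0] by simp
  ultimately show ?thesis by (simp add: int2_iterated'[OF r])
qed

lemma int2_pdx:
  assumes "rapid_diff 1 h" "temperate (\<lambda>p. a (fst p))"
  shows "int2 (\<lambda>p. a (fst p) * pdx h p) = 0"
proof -
  note h = assms(1)[unfolded One_nat_def]
  have r: "rapid (pdx h)" using rapid_diff_SucD(4)[OF h] by simp
  obtain K where K: "\<And>t x. \<bar>x\<bar> ^ 1 * norm (h (t, x)) \<le> K"
    using rapid_bound[OF rapid_diff_imp_rapid[OF h]] by metis
  have "(LINT x|lborel. pdx h (t, x)) = 0" for t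
    using rapid_diff_SucD(2)[OF h] section_measurable[OF rapidD(2)[OF r]] rapid_integrable_x[OF r] K
    by (intro lborel_integral_derivative_eq_0[where g="\<lambda>x. h (t, x)" and K=K]) auto
  then show ?thesis
    by (subst int2_iterated[OF rapid_temperate_mult[OF assms(2) r]]) simp
qed

text \<open>With h = f g the two integrands differ by the t-derivative of h plus c times its
  x-derivative. The first integrates to 0 by periodicity, the second because c does not depend on x
  and h decays. It is stated for one derivative because f will also be the packet, which is not
  Schwartz.\<close>

lemma integration_by_parts:
  assumes "rapid_diff 1 f" "rapid_diff 1 g" "smooth1 c" "periodic1 c" "smooth1 q" "periodic1 q"
  shows "int2 (\<lambda>p. f p * L_transpose c q g p) = int2 (\<lambda>p. (pdt f p + c (fst p) * pdx f p + q (fst p) * f p) * g p)"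
proof -
  note f = assms(1)[unfolded One_nat_def] and g = assms(2)[unfolded One_nat_def]
  note fr = rapid_diff_imp_rapid[OF f] and gr = rapid_diff_imp_rapid[OF g]
  have r: "rapid (pdt f)" "rapid (pdx f)" "rapid (pdt g)" "rapid (pdx g)"
    using rapid_diff_SucD(3,4)[OF f] rapid_diff_SucD(3,4)[OF g] by simp_all
  define h where "h = (\<lambda>p. f p * g p)"
  have h: "rapid_diff 1 h"
    unfolding h_def by (intro rapid_diff_temperate_mult rapid_diff_imp_temperate_diff assms)
  note h' = h[unfolded One_nat_def]
  have ht: "pdt h (t, x) = f (t, x) * pdt g (t, x) + pdt f (t, x) * g (t, x)" for t x
  proof -
    have "((\<lambda>s. f (s, x) * g (s, x)) has_vector_derivative pdt h (t, x)) (at t)"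
      using rapid_diff_SucD(1)[OF h', where x=x and t=t] by (simp only: h_def)
    then show ?thesis
      by (rule vector_derivative_unique_at)
        (rule has_vector_derivative_mult[OF rapid_diff_SucD(1)[OF f] rapid_diff_SucD(1)[OF g]])
  qed
  have hx: "pdx h (t, x) = f (t, x) * pdx g (t, x) + pdx f (t, x) * g (t, x)" for t x
  proof -
    have "((\<lambda>s. f (t, s) * g (t, s)) has_vector_derivative pdx h (t, x)) (at x)"
      using rapid_diff_SucD(2)[OF h', where x=x and t=t] by (simp only: h_def)
    then show ?thesis
      by (rule vector_derivative_unique_at)
        (rule has_vector_derivative_mult[OF rapid_diff_SucD(2)[OF f] rapid_diff_SucD(2)[OF g]])
  qed
  note c = temperate_diff_imp_temperate[OF temperate_diff_t[OF assms(3,4)]]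
    and q = temperate_diff_imp_temperate[OF temperate_diff_t[OF assms(5,6)]]
  note T = rapid_imp_temperate[OF fr] rapid_imp_temperate[OF gr]
  have R: "rapid (\<lambda>p. f p * L_transpose c q g p)"
  proof -
    have "rapid (\<lambda>p. f p * ((- 1) * pdt g p + (-1) * (c (fst p) * pdx g p) + q (fst p) * g p))"
      by (intro rapid_temperate_mult[OF T(1)] rapid_add rapid_temperate_mult[OF c] rapid_temperate_mult[OF q]
          r gr rapid_temperate_mult[OF temperate_diff_imp_temperate[OF temperate_diff_const]])
    then show ?thesis by (simp add: L_transpose_def)
  qed
  have "(pdt f p + c (fst p) * pdx f p + q (fst p) * f p) * g p
     = f p * L_transpose c q g p + (pdt h p + c (fst p) * pdx h p)" for p
    by (cases p) (simp add: L_transpose_def ht hx algebra_simps)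
  then have "int2 (\<lambda>p. (pdt f p + c (fst p) * pdx f p + q (fst p) * f p) * g p)
     = int2 (\<lambda>p. f p * L_transpose c q g p) + (int2 (pdt h) + int2 (\<lambda>p. c (fst p) * pdx h p))"
    using R rapid_diff_SucD(3,4)[OF h'] by (simp add: int2_add rapid_add rapid_temperate_mult[OF c])
  then show ?thesis
    by (simp add: int2_pdt[OF h] int2_pdx[OF h c])
qed

section \<open>The Fourier transform in the real variable\<close>

lemma norm_diff_le_of_vector_derivative:
  fixes f :: "real \<Rightarrow> 'a :: real_normed_vector"
  assumes "\<And>t. (f has_vector_derivative f' t) (at t)" "\<And>t. norm (f' t) \<le> m"
  shows "norm (f x - f y) \<le> m * \<bar>x - y\<bar>"
proof -
  have "norm (f x - f y) \<le> m * norm (x - y)"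
  proof (rule differentiable_bound[where S=UNIV])
    show "(f has_derivative (\<lambda>z. z *\<^sub>R f' t)) (at t within UNIV)" for t
      using assms(1)[of t] by (simp add: has_vector_derivative_def)
    have "norm (z *\<^sub>R f' t) \<le> m * norm z" for z t
      using mult_left_mono[OF assms(2)[of t], of "\<bar>z\<bar>"] by (simp add: mult.commute)
    then show "onorm (\<lambda>z. z *\<^sub>R f' t) \<le> m" for t
      by (rule onorm_le)
  qed auto
  then show ?thesis by simp
qed

text \<open>By the mean value inequality the difference quotients are bounded by w, hence the
  normalised remainder \<open>r y\<close> by 2 w for all y. Dominated convergence along sequences
  sends its integral to 0.\<close>

lemma has_vector_derivative_lborel_integral:
  fixes h h' :: "real \<Rightarrow> real \<Rightarrow> complex"
  assumes d: "\<And>s x. ((\<lambda>s. h s x) has_vector_derivative h' s x) (at s)"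
    and b: "\<And>s x. norm (h' s x) \<le> w x" and w: "integrable lborel w"
    and h: "\<And>s. integrable lborel (h s)" and h': "integrable lborel (h' s0)"
  shows "((\<lambda>s. LINT x|lborel. h s x) has_vector_derivative (LINT x|lborel. h' s0 x)) (at s0)"
proof -
  define r where "r y x = inverse \<bar>y\<bar> *\<^sub>R (h (s0 + y) x - h s0 x - y *\<^sub>R h' s0 x)" for y x
  have r_int: "integrable lborel (r y)" for y
    unfolding r_def by (intro integrable_scaleR_right Bochner_Integration.integrable_diff h h')
  have lip: "norm (h (s0 + y) x - h s0 x) \<le> w x * \<bar>y\<bar>" for y x
    using norm_diff_le_of_vector_derivative[where f="\<lambda>s. h s x" and x="s0 + y" and y=s0, OF d b] by simp
  have r_bound: "norm (r y x) \<le> 2 * w x" for y x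
  proof (cases "y = 0")
    case True
    then show ?thesis using order_trans[OF norm_ge_zero b[of s0 x]] by (simp add: r_def)
  next
    case False
    have "norm (h (s0 + y) x - h s0 x - y *\<^sub>R h' s0 x) \<le> w x * \<bar>y\<bar> + \<bar>y\<bar> * w x"
      by (rule order_trans[OF norm_triangle_ineq4 add_mono[OF lip]]) (simp add: b mult_left_mono)
    moreover have "norm (r y x) = norm (h (s0 + y) x - h s0 x - y *\<^sub>R h' s0 x) / \<bar>y\<bar>"
      by (simp only: r_def norm_scaleR abs_inverse abs_abs abs_idempotent real_norm_def divide_inverse mult.commute)
    ultimately show ?thesis using False by (simp add: pos_divide_le_eq mult_ac)
  qed
  have r_lim: "((\<lambda>y. norm (r y x)) \<longlongrightarrow> 0) (at 0)" for x
    using d[of x s0] unfolding has_vector_derivative_def has_derivative_at r_def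
    by (simp add: divide_inverse mult.commute)
  have "((\<lambda>y. LINT x|lborel. r y x) \<longlongrightarrow> 0) (at 0)"
    unfolding tendsto_at_iff_sequentially
  proof (intro allI impI)
    fix X :: "nat \<Rightarrow> real"
    assume X: "\<forall>i. X i \<in> UNIV - {0}" "X \<longlonglongrightarrow> 0"
    have "(\<lambda>i. LINT x|lborel. r (X i) x) \<longlonglongrightarrow> (LINT x|(lborel :: real measure). 0)"
    proof (rule integral_dominated_convergence[where w="\<lambda>x. 2 * w x"])
      show "AE x in lborel. (\<lambda>i. r (X i) x) \<longlonglongrightarrow> 0"
      proof (rule AE_I2)
        fix x
        have "((\<lambda>y. norm (r y x)) \<circ> X) \<longlonglongrightarrow> 0"
          using r_lim[of x] X unfolding tendsto_at_iff_sequentially by blast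
        then show "(\<lambda>i. r (X i) x) \<longlonglongrightarrow> 0"
          by (simp add: o_def tendsto_norm_zero_iff)
      qed
    qed (use r_int w r_bound in \<open>auto intro: borel_measurable_integrable\<close>)
    then show "((\<lambda>y. LINT x|lborel. r y x) \<circ> X) \<longlonglongrightarrow> 0"
      by (simp add: o_def)
  qed
  then have "((\<lambda>y. norm (LINT x|lborel. r y x)) \<longlongrightarrow> 0) (at 0)"
    by (rule tendsto_norm_zero)
  moreover have "(LINT x|lborel. r y x) = inverse \<bar>y\<bar> *\<^sub>R
      ((LINT x|lborel. h (s0 + y) x) - (LINT x|lborel. h s0 x) - y *\<^sub>R (LINT x|lborel. h' s0 x))" for y
    unfolding r_def using h h' by simp
  ultimately show ?thesis
    unfolding has_vector_derivative_def has_derivative_at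
    by (simp add: divide_inverse mult.commute bounded_linear_scaleR_left)
qed

text \<open>The parameter s selects the direction: - 1 for the transform in x, 1 for its inverse up
  to the factor 2 pi. The first variable is a parameter and the frequency takes the place of x, so
  the result is again a function on the cylinder.\<close>

definition fourier :: "real \<Rightarrow> (real \<times> real \<Rightarrow> complex) \<Rightarrow> real \<times> real \<Rightarrow> complex" where
  "fourier s f = (\<lambda>p. LINT x|lborel. iexp (s * snd p * x) * f (fst p, x))"

lemma fourier_integrable:
  assumes "rapid f"
  shows "integrable lborel (\<lambda>x. iexp (a * x) * f (t, x))"
proof (rule Bochner_Integration.integrable_bound[OF rapid_integrable_x[OF assms, where t=t]])
  show "(\<lambda>x. iexp (a * x) * f (t, x)) \<in> borel_measurable lborel"
    using section_measurable(1)[OF rapidD(2)[OF assms]]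
    by (intro borel_measurable_times) (auto intro!: borel_measurable_continuous_onI continuous_intros)
qed (simp add: norm_mult)

lemma fourier_bounded:
  assumes "rapid f"
  obtains M where "\<And>p. norm (fourier s f p) \<le> M"
proof -
  obtain K where K0: "K \<ge> 0" and K: "\<And>t x. norm (f (t, x)) \<le> K * inverse (1 + x\<^sup>2)"
    using rapid_Cauchy_bound[OF assms] by metis
  have "norm (fourier s f p) \<le> (LINT x|lborel. K * inverse (1 + x\<^sup>2))" for p
    unfolding fourier_def
    by (rule order_trans[OF integral_norm_bound integral_mono])
      (use rapid_integrable_x[OF assms] integrable_Cauchy_density K in \<open>auto simp: norm_mult\<close>)
  then show ?thesis by (rule that)
qed

lemma fourier_continuous:
  assumes "rapid f"
  shows "continuous_on UNIV (fourier s f)"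
proof -
  obtain K where K0: "K \<ge> 0" and K: "\<And>t x. norm (f (t, x)) \<le> K * inverse (1 + x\<^sup>2)"
    using rapid_Cauchy_bound[OF assms] by metis
  have "isCont (fourier s f) p" for p
    unfolding continuous_at_sequentially o_def
  proof (intro allI impI)
    fix X :: "nat \<Rightarrow> real \<times> real" assume X: "X \<longlonglongrightarrow> p"
    show "(\<lambda>n. fourier s f (X n)) \<longlonglongrightarrow> fourier s f p"
      unfolding fourier_def
    proof (rule integral_dominated_convergence[where w="\<lambda>x. K * inverse (1 + x\<^sup>2)"])
      show "AE x in lborel. (\<lambda>i. iexp (s * snd (X i) * x) * f (fst (X i), x))
          \<longlonglongrightarrow> iexp (s * snd p * x) * f (fst p, x)"
      proof (rule AE_I2)
        fix x
        have "continuous_on UNIV (\<lambda>p. iexp (s * snd p * x) * f (fst p, x))"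
          by (intro continuous_intros continuous_on_compose2[OF rapidD(2)[OF assms]]) auto
        then have "isCont (\<lambda>p. iexp (s * snd p * x) * f (fst p, x)) p"
          by (simp only: continuous_on_eq_continuous_at[OF open_UNIV]) blast
        from isCont_tendsto_compose[OF this X]
        show "(\<lambda>i. iexp (s * snd (X i) * x) * f (fst (X i), x)) \<longlonglongrightarrow> iexp (s * snd p * x) * f (fst p, x)" .
      qed
    qed ((rule borel_measurable_integrable[OF fourier_integrable[OF assms]])+,
        use integrable_Cauchy_density K in \<open>auto simp: norm_mult\<close>)
  qed
  then show ?thesis by (simp add: continuous_at_imp_continuous_on)
qed

lemma fourier_dt:
  assumes "f \<in> schwartz"
  shows "((\<lambda>s. fourier \<sigma> f (s, \<xi>)) has_vector_derivative fourier \<sigma> (pdt f) (t, \<xi>)) (at t)"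
proof -
  note r = schwartz_imp_rapid[OF assms] and r' = schwartz_imp_rapid[OF schwartz_pdt[OF assms]]
  obtain K where K0: "K \<ge> 0" and K: "\<And>t x. norm (pdt f (t, x)) \<le> K * inverse (1 + x\<^sup>2)"
    using rapid_Cauchy_bound[OF r'] by metis
  show ?thesis
    unfolding fourier_def fst_conv snd_conv
  proof (rule has_vector_derivative_lborel_integral)
    show "((\<lambda>s. iexp (\<sigma> * \<xi> * x) * f (s, x)) has_vector_derivative iexp (\<sigma> * \<xi> * x) * pdt f (s, x)) (at s)" for s x
      by (intro has_vector_derivative_mult_right schwartz_derivs assms)
    show "norm (iexp (\<sigma> * \<xi> * x) * pdt f (s, x)) \<le> K * inverse (1 + x\<^sup>2)" for s x
      using K by (simp add: norm_mult)
    show "integrable lborel (\<lambda>x. K * inverse (1 + x\<^sup>2))"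
      using integrable_Cauchy_density by simp
  qed (rule fourier_integrable r r')+
qed

lemma fourier_dx:
  assumes "f \<in> schwartz"
  shows "((\<lambda>y. fourier \<sigma> f (t, y)) has_vector_derivative
    (\<i> * of_real \<sigma>) * fourier \<sigma> (\<lambda>p. of_real (snd p) * f p) (t, \<xi>)) (at \<xi>)"
proof -
  define g where "g = (\<lambda>p. (\<i> * of_real \<sigma>) * (of_real (snd p) * f p))"
  note r = schwartz_imp_rapid[OF assms]
  have r': "rapid g"
    unfolding g_def by (intro schwartz_imp_rapid schwartz_cmult schwartz_mult_x assms)
  obtain K where K0: "K \<ge> 0" and K: "\<And>t x. norm (g (t, x)) \<le> K * inverse (1 + x\<^sup>2)"
    using rapid_Cauchy_bound[OF r'] by metis
  have "((\<lambda>y. fourier \<sigma> f (t, y)) has_vector_derivative fourier \<sigma> g (t, \<xi>)) (at \<xi>)"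
    unfolding fourier_def fst_conv snd_conv
  proof (rule has_vector_derivative_lborel_integral)
    fix y x
    have "((\<lambda>y. iexp (\<sigma> * y * x)) has_vector_derivative \<i> * of_real (\<sigma> * x) * iexp (\<sigma> * y * x)) (at y)"
      using has_vector_derivative_iexp[of "\<sigma> * x" y] by (simp add: mult_ac)
    from has_vector_derivative_mult_left[OF this, of "f (t, x)"]
    show "((\<lambda>y. iexp (\<sigma> * y * x) * f (t, x)) has_vector_derivative iexp (\<sigma> * y * x) * g (t, x)) (at y)"
      by (simp add: g_def mult_ac)
    show "norm (iexp (\<sigma> * y * x) * g (t, x)) \<le> K * inverse (1 + x\<^sup>2)"
      using K by (simp add: norm_mult)
  next
    show "integrable lborel (\<lambda>x. K * inverse (1 + x\<^sup>2))"
      using integrable_Cauchy_density by simp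
  qed (rule fourier_integrable r r')+
  moreover have "fourier \<sigma> g (t, \<xi>) = (\<i> * of_real \<sigma>) * fourier \<sigma> (\<lambda>p. of_real (snd p) * f p) (t, \<xi>)"
    unfolding fourier_def g_def integral_mult_right_zero[symmetric] by (simp add: mult_ac)
  ultimately show ?thesis by simp
qed

lemma fourier_pdx:
  assumes "f \<in> schwartz"
  shows "fourier \<sigma> (pdx f) p = - (\<i> * of_real (\<sigma> * snd p)) * fourier \<sigma> f p"
proof -
  obtain t \<xi> where p: "p = (t, \<xi>)" by (cases p)
  note r = schwartz_imp_rapid[OF assms] and r' = schwartz_imp_rapid[OF schwartz_pdx[OF assms]]
  obtain K where K: "\<And>t x. \<bar>x\<bar> ^ 1 * norm (f (t, x)) \<le> K"
    using rapid_bound[OF r] by metis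
  have "(LINT x|lborel. iexp (\<sigma> * \<xi> * x) * pdx f (t, x) + \<i> * of_real (\<sigma> * \<xi>) * (iexp (\<sigma> * \<xi> * x) * f (t, x))) = 0"
  proof (rule lborel_integral_derivative_eq_0)
    fix x
    from has_vector_derivative_mult[OF has_vector_derivative_iexp[where a="\<sigma> * \<xi>" and x=x] schwartz_derivs(2)[OF assms, where t=t]]
    show "((\<lambda>x. iexp (\<sigma> * \<xi> * x) * f (t, x)) has_vector_derivative
        iexp (\<sigma> * \<xi> * x) * pdx f (t, x) + \<i> * of_real (\<sigma> * \<xi>) * (iexp (\<sigma> * \<xi> * x) * f (t, x))) (at x)"
      by (simp add: mult_ac)
    show "\<bar>x\<bar> * norm (iexp (\<sigma> * \<xi> * x) * f (t, x)) \<le> K"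
      using K by (simp add: norm_mult)
  next
    show "continuous_on UNIV (\<lambda>x. iexp (\<sigma> * \<xi> * x) * pdx f (t, x) + \<i> * of_real (\<sigma> * \<xi>) * (iexp (\<sigma> * \<xi> * x) * f (t, x)))"
      by (intro continuous_intros section_measurable(3) rapidD r r')
    show "integrable lborel (\<lambda>x. iexp (\<sigma> * \<xi> * x) * pdx f (t, x) + \<i> * of_real (\<sigma> * \<xi>) * (iexp (\<sigma> * \<xi> * x) * f (t, x)))"
      by (intro Bochner_Integration.integrable_add integrable_mult_right fourier_integrable r r')
  qed
  then have "fourier \<sigma> (pdx f) p + \<i> * of_real (\<sigma> * \<xi>) * fourier \<sigma> f p = 0"
    unfolding p fourier_def fst_conv snd_conv
    using Bochner_Integration.integral_add[OF fourier_integrable[OF r', of "\<sigma> * \<xi>" t]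
        integrable_mult_right[OF fourier_integrable[OF r, of "\<sigma> * \<xi>" t], of "\<i> * of_real (\<sigma> * \<xi>)"]]
    by simp
  then show ?thesis by (simp add: p eq_neg_iff_add_eq_0)
qed

text \<open>A factor \<xi> is traded for an x-derivative and a \<xi>-derivative for a factor x, so
  both inductions stay among transforms of Schwartz functions. The condition on \<sigma> covers the
  transform and its inverse.\<close>

lemma fourier_schwartz:
  assumes "f \<in> schwartz" "\<bar>\<sigma>\<bar> = 1"
  shows "fourier \<sigma> f \<in> schwartz"
proof -
  have dec: "\<exists>K. \<forall>t x. \<bar>x\<bar> ^ \<gamma> * norm (fourier \<sigma> f (t, x)) \<le> K" if "f \<in> schwartz" for f \<gamma>
    using that
  proof (induction \<gamma> arbitrary: f)
    case 0
    then show ?case using fourier_bounded[OF schwartz_imp_rapid[OF 0]] by (metis mult_1 power_0)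
  next
    case (Suc \<gamma>)
    have "norm (fourier \<sigma> (pdx f) (t, x)) = \<bar>x\<bar> * norm (fourier \<sigma> f (t, x))" for t x
      using assms(2) by (simp add: fourier_pdx[OF Suc.prems] norm_mult abs_mult)
    with Suc.IH[OF schwartz_pdx[OF Suc.prems]] show ?case by (simp add: mult_ac)
  qed
  have rap: "rapid (fourier \<sigma> f)" if "f \<in> schwartz" for f
  proof (rule rapidI)
    show "periodic_t (fourier \<sigma> f)"
      by (simp add: periodic_t_def fourier_def rapidD[OF schwartz_imp_rapid[OF that]])
  qed (use dec fourier_continuous schwartz_imp_rapid that in auto)
  have "rapid_diff n (fourier \<sigma> f)" if "f \<in> schwartz" for n f
    using that
  proof (induction n arbitrary: f)
    case (Suc n)
    show ?case
    proof (rule rapid_diff_SucI[OF rap[OF Suc.prems] fourier_dt[OF Suc.prems] fourier_dx[OF Suc.prems]])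
      show "rapid_diff n (fourier \<sigma> (pdt f))"
        by (rule Suc.IH[OF schwartz_pdt[OF Suc.prems]])
      show "rapid_diff n (\<lambda>p. \<i> * of_real \<sigma> * fourier \<sigma> (\<lambda>p. of_real (snd p) * f p) p)"
        by (rule rapid_diff_cmult[OF Suc.IH[OF schwartz_mult_x[OF Suc.prems]]])
    qed
  qed (simp add: rap)
  with assms(1) show ?thesis by (simp add: schwartz_iff)
qed

text \<open>Read off from the characteristic function of the standard normal distribution, whose
  density is the Gaussian divided by sqrt (2 pi).\<close>

lemma fourier_gaussian:
  "integrable lborel (\<lambda>x::real. exp (- x\<^sup>2 / 2))"
  "(LINT x|lborel. exp (- x\<^sup>2 / 2)) = sqrt (2 * pi)"
  "(LINT x|lborel. iexp (a * x) * of_real (exp (- x\<^sup>2 / 2))) = of_real (sqrt (2 * pi) * exp (- a\<^sup>2 / 2))"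
proof -
  have e: "exp (- x\<^sup>2 / 2) = sqrt (2 * pi) * std_normal_density x" for x
    by (simp add: std_normal_density_def)
  have i: "integrable lborel std_normal_density" and I: "(LINT x|lborel. std_normal_density x) = 1"
    using integrable_std_normal_moment[of 0] integral_std_normal_moment_even[of 0] by simp_all
  show "integrable lborel (\<lambda>x::real. exp (- x\<^sup>2 / 2))"
    unfolding e using i by simp
  show "(LINT x|lborel. exp (- x\<^sup>2 / 2)) = sqrt (2 * pi)"
    unfolding e using I by simp
  have "char std_normal_distribution a = (LINT x|lborel. std_normal_density x *\<^sub>R iexp (a * x))"
    unfolding char_def by (subst integral_density) auto
  then have I2: "(LINT x|lborel. std_normal_density x *\<^sub>R iexp (a * x)) = of_real (exp (- a\<^sup>2 / 2))"
    by (simp add: char_std_normal_distribution)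
  have e2: "iexp (a * x) * of_real (exp (- x\<^sup>2 / 2))
      = of_real (sqrt (2 * pi)) * (std_normal_density x *\<^sub>R iexp (a * x))" for x
    unfolding e by (simp add: scaleR_conv_of_real)
  show "(LINT x|lborel. iexp (a * x) * of_real (exp (- x\<^sup>2 / 2))) = of_real (sqrt (2 * pi) * exp (- a\<^sup>2 / 2))"
    unfolding e2 integral_mult_right_zero I2 by simp
qed


text \<open>\<open>A n\<close> is the inverse transform with a Gaussian damping factor, and its
  limit is computed twice: letting the damping tend to 1 gives the left-hand side, while Fubini
  gives Gaussian averages of f that concentrate at y. The factor 2 pi is sqrt (2 pi) squared, one
  root from the transform of the Gaussian and one from its mass.\<close>

lemma fourier_inversion:
  assumes "f \<in> schwartz"
  shows "fourier 1 (fourier (-1) f) p = of_real (2 * pi) * f p"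
proof -
  obtain t y where p: "p = (t, y)" by (cases p)
  note r = schwartz_imp_rapid[OF assms]
  note r' = schwartz_imp_rapid[OF fourier_schwartz[OF assms, of "-1"], simplified]
  obtain K where K: "\<And>t x. \<bar>x\<bar> ^ 0 * norm (f (t, x)) \<le> K"
    using rapid_bound[OF r] by metis
  \<comment> \<open>Without this factor the double integral in x and \<xi> need not converge
    absolutely, so Fubini could not be applied.\<close>
  define G where "G n \<xi> = exp (- (\<xi> / real (Suc n))\<^sup>2 / 2)" for n \<xi>
  have G_int: "integrable lborel (G n)" for n
    using lborel_integrable_real_affine[OF fourier_gaussian(1), of "1 / real (Suc n)" 0]
    by (simp add: G_def[abs_def] del: of_nat_Suc)
  have G_bound: "0 \<le> G n \<xi>" "G n \<xi> \<le> 1" for n \<xi>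
    by (auto simp: G_def)
  have G_cont: "continuous_on S (G n)" for n S
    unfolding G_def by (intro continuous_intros) auto
  define A where "A n = (LINT \<xi>|lborel. iexp (1 * y * \<xi>) * fourier (-1) f (t, \<xi>) * of_real (G n \<xi>))" for n
  have lim1: "A \<longlonglongrightarrow> fourier 1 (fourier (-1) f) (t, y)"
    unfolding A_def fourier_def[of 1] fst_conv snd_conv
  proof (rule integral_dominated_convergence[where w="\<lambda>\<xi>. norm (fourier (-1) f (t, \<xi>))"])
    have "(\<lambda>n. G n \<xi>) \<longlonglongrightarrow> exp (- 0\<^sup>2 / 2)" for \<xi>
      unfolding G_def by (intro tendsto_intros lim_const_over_n[THEN LIMSEQ_Suc]) auto
    then have "(\<lambda>n. iexp (1 * y * \<xi>) * fourier (-1) f (t, \<xi>) * of_real (G n \<xi>))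
        \<longlonglongrightarrow> iexp (1 * y * \<xi>) * fourier (-1) f (t, \<xi>) * of_real (exp (- 0\<^sup>2 / 2))" for \<xi>
      by (intro tendsto_intros)
    then show "AE \<xi> in lborel. (\<lambda>n. iexp (1 * y * \<xi>) * fourier (-1) f (t, \<xi>) * of_real (G n \<xi>))
        \<longlonglongrightarrow> iexp (1 * y * \<xi>) * fourier (-1) f (t, \<xi>)"
      by simp
    show "AE \<xi> in lborel. norm (iexp (1 * y * \<xi>) * fourier (-1) f (t, \<xi>) * of_real (G n \<xi>))
        \<le> norm (fourier (-1) f (t, \<xi>))" for n
      using G_bound by (intro AE_I2) (simp add: norm_mult mult_left_le)
    show "(\<lambda>\<xi>. iexp (1 * y * \<xi>) * fourier (-1) f (t, \<xi>) * of_real (G n \<xi>)) \<in> borel_measurable lborel" for n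
      using section_measurable(3)[OF rapidD(2)[OF r']] G_cont
      by (simp, intro borel_measurable_continuous_onI continuous_intros) auto
  qed (rule borel_measurable_integrable[OF fourier_integrable[OF r']], use rapid_integrable_x[OF r'] in simp)
  \<comment> \<open>After Fubini and the scaling of \<xi> by N the inner integral is the transform
    of a Gaussian at N (y - x); substituting x = y + u / N then turns the rest into an average of f
    near y.\<close>
  have A_eq: "A n = of_real (sqrt (2 * pi)) * (LINT u|lborel. f (t, y + u / real (Suc n)) * of_real (exp (- u\<^sup>2 / 2)))" for n
  proof -
    define N where "N = real (Suc n)"
    have N: "N > 0" by (simp add: N_def)
    define H where "H x \<xi> = iexp (y * \<xi>) * (iexp (- 1 * \<xi> * x) * f (t, x)) * of_real (G n \<xi>)" for x \<xi>
    have nH: "norm (H x \<xi>) = norm (f (t, x)) * G n \<xi>" for x \<xi>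
      using G_bound by (simp add: H_def norm_mult)
    have cH: "continuous_on UNIV (\<lambda>(x, \<xi>). H x \<xi>)"
      unfolding H_def case_prod_unfold
      by (intro continuous_intros continuous_on_compose2[OF G_cont]
          continuous_on_compose2[OF section_measurable(3)[OF rapidD(2)[OF r]]]) auto
    have mH: "(\<lambda>(x, \<xi>). H x \<xi>) \<in> borel_measurable (lborel \<Otimes>\<^sub>M lborel)"
      using cH by (simp add: lborel_prod borel_measurable_continuous_onI)
    have H_int: "integrable (lborel \<Otimes>\<^sub>M lborel) (\<lambda>(x, \<xi>). H x \<xi>)"
    proof (rule lborel_pair.Fubini_integrable[OF mH])
      show "integrable lborel (\<lambda>x. LINT \<xi>|lborel. norm (case (x, \<xi>) of (x, \<xi>) \<Rightarrow> H x \<xi>))"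
        using rapid_integrable_x[OF r] by (simp add: nH)
      have "integrable lborel (\<lambda>\<xi>. H x \<xi>)" for x
      proof (rule Bochner_Integration.integrable_bound)
        show "integrable lborel (\<lambda>\<xi>. norm (f (t, x)) * G n \<xi>)"
          using G_int by simp
        show "(\<lambda>\<xi>. H x \<xi>) \<in> borel_measurable lborel"
          using continuous_on_compose2[OF cH, of UNIV "\<lambda>\<xi>. (x, \<xi>)"]
          by (simp add: borel_measurable_continuous_onI continuous_on_Pair)
      qed (use G_bound in \<open>auto simp: nH abs_mult\<close>)
      then show "AE x in lborel. integrable lborel (\<lambda>\<xi>. case (x, \<xi>) of (x, \<xi>) \<Rightarrow> H x \<xi>)" by simp
    qed
    have "A n = (LINT \<xi>|lborel. LINT x|lborel. H x \<xi>)"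
      unfolding A_def fourier_def[of "-1"] H_def by simp
    also have "\<dots> = (LINT x|lborel. LINT \<xi>|lborel. H x \<xi>)"
      by (rule lborel_pair.Fubini_integral[OF H_int])
    also have "\<dots> = (LINT x|lborel. f (t, x) * of_real (N * sqrt (2 * pi) * exp (- (N * (y - x))\<^sup>2 / 2)))"
    proof (rule Bochner_Integration.integral_cong[OF refl])
      fix x
      have "(LINT \<xi>|lborel. H x \<xi>) = \<bar>N\<bar> *\<^sub>R (LINT u|lborel. H x (0 + N * u))"
        by (rule lborel_integral_real_affine) (use N in simp)
      also have "(\<lambda>u. H x (0 + N * u)) = (\<lambda>u. f (t, x) * (iexp (N * (y - x) * u) * of_real (exp (- u\<^sup>2 / 2))))"
      proof
        fix u
        have "G n (0 + N * u) = exp (- u\<^sup>2 / 2)"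
          using N by (simp add: G_def N_def[symmetric] del: of_nat_Suc)
        moreover have "iexp (N * (y - x) * u) = iexp (y * (0 + N * u)) * iexp (- 1 * (0 + N * u) * x)"
          by (simp add: algebra_simps flip: exp_add)
        ultimately show "H x (0 + N * u) = f (t, x) * (iexp (N * (y - x) * u) * of_real (exp (- u\<^sup>2 / 2)))"
          by (simp only: H_def mult_ac)
      qed
      also have "(LINT u|lborel. f (t, x) * (iexp (N * (y - x) * u) * of_real (exp (- u\<^sup>2 / 2))))
         = f (t, x) * of_real (sqrt (2 * pi) * exp (- (N * (y - x))\<^sup>2 / 2))"
        by (simp only: integral_mult_right_zero fourier_gaussian(3))
      finally show "(LINT \<xi>|lborel. H x \<xi>) = f (t, x) * of_real (N * sqrt (2 * pi) * exp (- (N * (y - x))\<^sup>2 / 2))"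
        using N by (simp add: scaleR_conv_of_real mult_ac)
    qed
    also have "\<dots> = \<bar>1 / N\<bar> *\<^sub>R (LINT u|lborel. f (t, y + 1 / N * u) *
        of_real (N * sqrt (2 * pi) * exp (- (N * (y - (y + 1 / N * u)))\<^sup>2 / 2)))"
      by (rule lborel_integral_real_affine) (use N in simp)
    also have "(\<lambda>u. f (t, y + 1 / N * u) * of_real (N * sqrt (2 * pi) * exp (- (N * (y - (y + 1 / N * u)))\<^sup>2 / 2)))
       = (\<lambda>u. of_real (N * sqrt (2 * pi)) * (f (t, y + u / N) * of_real (exp (- u\<^sup>2 / 2))))"
    proof -
      have "N * (y - (y + 1 / N * u)) = - u" for u
        using N by (simp add: field_simps)
      then show ?thesis by (simp add: mult_ac)
    qed
    also have "\<bar>1 / N\<bar> *\<^sub>R (LINT u|lborel. of_real (N * sqrt (2 * pi)) * (f (t, y + u / N) * of_real (exp (- u\<^sup>2 / 2))))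
       = of_real (sqrt (2 * pi)) * (LINT u|lborel. f (t, y + u / N) * of_real (exp (- u\<^sup>2 / 2)))"
      using N by (simp add: scaleR_conv_of_real)
    finally show ?thesis by (simp only: N_def)
  qed
  have lim2: "A \<longlonglongrightarrow> of_real (sqrt (2 * pi)) * (LINT u|lborel. f (t, y) * of_real (exp (- u\<^sup>2 / 2)))"
    unfolding A_eq
  proof (intro tendsto_intros integral_dominated_convergence[where w="\<lambda>u. K * exp (- u\<^sup>2 / 2)"])
    have "(\<lambda>n. f (t, y + u / real (Suc n))) \<longlonglongrightarrow> f (t, y + 0)" for u
      using section_measurable(3)[OF rapidD(2)[OF r], of UNIV t]
      by (intro isCont_tendsto_compose[of "y + 0" "\<lambda>x. f (t, x)"] tendsto_intros lim_const_over_n[THEN LIMSEQ_Suc])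
        (simp add: continuous_on_eq_continuous_at)
    then show "AE u in lborel. (\<lambda>n. f (t, y + u / real (Suc n)) * of_real (exp (- u\<^sup>2 / 2)))
        \<longlonglongrightarrow> f (t, y) * of_real (exp (- u\<^sup>2 / 2))"
      by (intro AE_I2 tendsto_intros) simp
    show "integrable lborel (\<lambda>u. K * exp (- u\<^sup>2 / 2))"
      using fourier_gaussian(1) by simp
    show "AE u in lborel. norm (f (t, y + u / real (Suc n)) * of_real (exp (- u\<^sup>2 / 2))) \<le> K * exp (- u\<^sup>2 / 2)" for n
      using K by (auto simp: norm_mult intro!: AE_I2 mult_right_mono)
    show "(\<lambda>u. f (t, y + u / real (Suc n)) * of_real (exp (- u\<^sup>2 / 2))) \<in> borel_measurable lborel" for n
      by (simp, intro borel_measurable_continuous_onI continuous_intros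
          continuous_on_compose2[OF section_measurable(3)[OF rapidD(2)[OF r]]]) auto
    show "(\<lambda>u. f (t, y) * of_real (exp (- u\<^sup>2 / 2))) \<in> borel_measurable lborel"
      by measurable
  qed
  have "of_real (sqrt (2 * pi)) * (LINT u|lborel. f (t, y) * of_real (exp (- u\<^sup>2 / 2))) = of_real (2 * pi) * f (t, y)"
  proof -
    have "(LINT u|lborel. f (t, y) * of_real (exp (- u\<^sup>2 / 2))) = f (t, y) * of_real (sqrt (2 * pi))"
      by (simp only: integral_mult_right_zero integral_complex_of_real fourier_gaussian(2))
    moreover have "of_real (2 * pi) = complex_of_real (sqrt (2 * pi)) * of_real (sqrt (2 * pi))"
      by (simp flip: of_real_mult)
    ultimately show ?thesis by (simp only: mult_ac)
  qed
  with LIMSEQ_unique[OF lim1 lim2] show ?thesis by (simp add: p)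
qed

section \<open>Periodic solutions of the Fourier-transformed equation\<close>

lemma antiderivative_exists:
  fixes c :: "real \<Rightarrow> complex"
  assumes "continuous_on UNIV c"
  obtains C where "\<And>t. (C has_vector_derivative c t) (at t)" "C 0 = 0"
proof
  define C where "C t = (if t \<ge> 0 then integral {0..t} c else - integral {t..0} c)" for t
  show "(C has_vector_derivative c t) (at t)" for t
  proof -
    define N where "N = \<bar>t\<bar> + 1"
    have int: "c integrable_on {a..b}" for a b
      by (rule integrable_continuous_interval[OF continuous_on_subset[OF assms]]) simp
    have "((\<lambda>u. integral {-N..u} c - integral {-N..0} c) has_vector_derivative c t - 0) (at t within {-N..N})"
      by (intro has_vector_derivative_diff integral_has_vector_derivative continuous_on_subset[OF assms])
        (auto simp: N_def)
    then have "((\<lambda>u. integral {-N..u} c - integral {-N..0} c) has_vector_derivative c t) (at t)"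
      by (subst (asm) at_within_interior) (auto simp: N_def)
    then show ?thesis
    proof (rule has_vector_derivative_transform_within_open)
      show "open {-N<..<N}" "t \<in> {-N<..<N}" by (auto simp: N_def)
      show "integral {-N..u} c - integral {-N..0} c = C u" if "u \<in> {-N<..<N}" for u
        using that Henstock_Kurzweil_Integration.integral_combine[of "-N" 0 u c]
          Henstock_Kurzweil_Integration.integral_combine[of "-N" u 0 c] int
        by (auto simp: C_def algebra_simps)
    qed
  qed
  show "C 0 = 0" by (simp add: C_def)
qed

text \<open>The increment over one period has derivative c (t + 2 pi) - c t = 0, so it equals its
  value at t = 0.\<close>

lemma antiderivative_shift:
  fixes c C :: "real \<Rightarrow> complex"
  assumes "\<And>t. (C has_vector_derivative c t) (at t)" "periodic1 c"
  shows "C (t + 2 * pi) - C t = of_real (2 * pi) * mean_T c"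
proof -
  have "((\<lambda>t. C (t + 2 * pi) - C t) has_vector_derivative 0) (at t within UNIV)" for t
  proof -
    have "((\<lambda>s. C (s + 2 * pi)) has_vector_derivative c (t + 2 * pi)) (at t)"
      by (rule has_vector_derivative_shift[OF assms(1)])
    from has_vector_derivative_diff[OF this assms(1)] show ?thesis
      using assms(2) by (simp add: periodic1_def)
  qed
  then obtain k where k: "\<And>t. C (t + 2 * pi) - C t = k"
    using has_vector_derivative_zero_constant[of UNIV "\<lambda>t. C (t + 2 * pi) - C t"] by auto
  have "(c has_integral C (2 * pi) - C 0) {0..2 * pi}"
    by (rule fundamental_theorem_of_calculus) (auto intro: has_vector_derivative_at_within assms(1))
  then have "of_real (2 * pi) * mean_T c = C (2 * pi) - C 0"
    by (simp add: mean_T_def integral_unique)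
  with k[of 0] k[of t] show ?thesis by simp
qed

text \<open>The assumption \<open>K\<close> is the only form in which nonresonance and the sign
  condition enter the locale. At s = 0 its left-hand side is 1, so it also says that the denominator
  never vanishes.\<close>

locale periodic_ode =
  fixes c q C Q :: "real \<Rightarrow> complex" and K :: real
  assumes c: "smooth1 c" "periodic1 c" and q: "smooth1 q" "periodic1 q"
    and C: "\<And>t. (C has_vector_derivative c t) (at t)"
    and Q: "\<And>t. (Q has_vector_derivative q t) (at t)"
    and K: "\<And>\<xi> t s. 0 \<le> s \<Longrightarrow> s \<le> 2 * pi \<Longrightarrow>
      norm (exp (\<i> * of_real \<xi> * (C (t - s) - C t) + (Q (t - s) - Q t)))
      \<le> K * norm (1 - exp (- (of_real (2 * pi) * (\<i> * of_real \<xi> * mean_T c + mean_T q))))"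
begin

definition lam :: "real \<Rightarrow> real \<Rightarrow> complex" where
  "lam \<xi> t = \<i> * of_real \<xi> * c t + q t"

text \<open>The integrating factor exp (i \<xi> C + Q) at t - s, divided by its value at t: it
  transports data from time t - s to time t along the homogeneous equation.\<close>

definition kern :: "real \<Rightarrow> real \<Rightarrow> real \<Rightarrow> complex" where
  "kern \<xi> t s = exp (\<i> * of_real \<xi> * (C (t - s) - C t) + (Q (t - s) - Q t))"

text \<open>One minus the multiplier of the homogeneous equation over a full period, see
  \<open>kern_2pi\<close>.\<close>

definition D :: "real \<Rightarrow> complex" where
  "D \<xi> = 1 - exp (- (of_real (2 * pi) * (\<i> * of_real \<xi> * mean_T c + mean_T q)))"

text \<open>The operator that sends F to the periodic solution v of v' + \<open>lam\<close> v = F,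
  with \<xi> in the second variable.\<close>

definition T :: "(real \<times> real \<Rightarrow> complex) \<Rightarrow> real \<times> real \<Rightarrow> complex" where
  "T F = (\<lambda>p. integral {0..2 * pi} (\<lambda>s. kern (snd p) (fst p) s * F (fst p - s, snd p)) / D (snd p))"

lemma kern_bound: "0 \<le> s \<Longrightarrow> s \<le> 2 * pi \<Longrightarrow> norm (kern \<xi> t s) \<le> K * norm (D \<xi>)"
  unfolding kern_def D_def by (rule K)

lemma D_nonzero: "D \<xi> \<noteq> 0"
proof
  assume "D \<xi> = 0"
  with kern_bound[of 0 \<xi> 0] show False by (simp add: kern_def)
qed

lemma kern_0: "kern \<xi> t 0 = 1"
  by (simp add: kern_def)

lemma kern_2pi: "kern \<xi> t (2 * pi) = 1 - D \<xi>"
proof -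
  have "C (t - 2 * pi) - C t = - (of_real (2 * pi) * mean_T c)"
    using antiderivative_shift[OF C c(2), of "t - 2 * pi"] by (simp add: algebra_simps)
  moreover have "Q (t - 2 * pi) - Q t = - (of_real (2 * pi) * mean_T q)"
    using antiderivative_shift[OF Q q(2), of "t - 2 * pi"] by (simp add: algebra_simps)
  ultimately show ?thesis
    by (simp only: kern_def D_def) (simp add: distrib_left mult.left_commute)
qed

lemma kern_periodic: "kern \<xi> (t + 2 * pi) s = kern \<xi> t s"
proof -
  have "C (t + 2 * pi - s) - C (t + 2 * pi) = C (t - s) - C t"
    using antiderivative_shift[OF C c(2), of "t - s"] antiderivative_shift[OF C c(2), of t]
    by (simp add: algebra_simps)
  moreover have "Q (t + 2 * pi - s) - Q (t + 2 * pi) = Q (t - s) - Q t"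
    using antiderivative_shift[OF Q q(2), of "t - s"] antiderivative_shift[OF Q q(2), of t]
    by (simp add: algebra_simps)
  ultimately show ?thesis by (simp add: kern_def)
qed

lemma continuous_CQ: "continuous_on UNIV C" "continuous_on UNIV Q"
  by (auto intro!: continuous_at_imp_continuous_on has_vector_derivative_continuous C Q)

lemma continuous_kern [continuous_intros]:
  assumes "continuous_on S f" "continuous_on S g" "continuous_on S h"
  shows "continuous_on S (\<lambda>x. kern (f x) (g x) (h x))"
  unfolding kern_def
  by (intro continuous_intros assms continuous_on_compose2[OF continuous_CQ(1)]
      continuous_on_compose2[OF continuous_CQ(2)]) auto

lemma continuous_D [continuous_intros]: "continuous_on S D"
  unfolding D_def by (intro continuous_intros)

lemma kern_deriv: "((\<lambda>s. kern \<xi> t s) has_vector_derivative - lam \<xi> (t - s) * kern \<xi> t s) (at s)"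
proof -
  have "((\<lambda>s. C (t - s)) has_vector_derivative - c (t - s)) (at s)"
    "((\<lambda>s. Q (t - s)) has_vector_derivative - q (t - s)) (at s)"
    by (rule has_vector_derivative_reflect[OF C] has_vector_derivative_reflect[OF Q])+
  then have "((\<lambda>s. \<i> * of_real \<xi> * (C (t - s) - C t) + (Q (t - s) - Q t)) has_vector_derivative
      \<i> * of_real \<xi> * (- c (t - s) - 0) + (- q (t - s) - 0)) (at s)"
    by (intro has_vector_derivative_add has_vector_derivative_mult_right has_vector_derivative_diff
        has_vector_derivative_const)
  from field_vector_diff_chain_at[OF this DERIV_exp] show ?thesis
    by (simp add: o_def kern_def lam_def algebra_simps)
qed

text \<open>The integrand is the s-derivative of - kern \<xi> t s * v (t - s). Over one period the
  boundary terms are v t and (1 - D \<xi>) * v t, by periodicity of v.\<close>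

lemma periodic_solution_unique:
  assumes per: "\<And>t. v (t + 2 * pi) = v t"
    and v: "\<And>t. (v has_vector_derivative g t - lam \<xi> t * v t) (at t)"
  shows "v t * D \<xi> = integral {0..2 * pi} (\<lambda>s. kern \<xi> t s * g (t - s))"
proof -
  have "((\<lambda>s. v (t - s)) has_vector_derivative - (g (t - s) - lam \<xi> (t - s) * v (t - s))) (at s)" for s
    by (rule has_vector_derivative_reflect[OF v])
  from has_vector_derivative_mult[OF kern_deriv this]
  have "((\<lambda>s. - (kern \<xi> t s * v (t - s))) has_vector_derivative kern \<xi> t s * g (t - s)) (at s)" for s
    by (rule has_vector_derivative_minus[THEN has_vector_derivative_eq_rhs]) (simp add: algebra_simps)
  then have "((\<lambda>s. kern \<xi> t s * g (t - s)) has_integral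
      - (kern \<xi> t (2 * pi) * v (t - 2 * pi)) - (- (kern \<xi> t 0 * v (t - 0)))) {0..2 * pi}"
    by (intro fundamental_theorem_of_calculus) (auto intro: has_vector_derivative_at_within)
  moreover have "v (t - 2 * pi) = v t"
    using per[of "t - 2 * pi"] by simp
  ultimately have "integral {0..2 * pi} (\<lambda>s. kern \<xi> t s * g (t - s)) = v t - (1 - D \<xi>) * v t"
    by (simp add: integral_unique kern_2pi kern_0)
  then show ?thesis by (simp add: left_diff_distrib)
qed

text \<open>F is only continuous, so the integral is not differentiated under its sign. Splitting
  \<open>kern\<close> as E' t * E (t - s) and substituting r = t - s gives E' t * (P t - P (t - 2
  pi)) / D \<xi> with P a primitive of E F, and all t-dependence becomes explicit.\<close>

lemma T_dt:
  assumes F: "continuous_on UNIV F" and per: "\<And>t. F (t + 2 * pi, \<xi>) = F (t, \<xi>)"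
  shows "((\<lambda>t. T F (t, \<xi>)) has_vector_derivative F (t, \<xi>) - lam \<xi> t * T F (t, \<xi>)) (at t)"
proof -
  define E where "E t = exp (\<i> * of_real \<xi> * C t + Q t)" for t
  define E' where "E' t = exp (- (\<i> * of_real \<xi> * C t + Q t))" for t
  have EE': "E' t * E r = kern \<xi> t (t - r)" for t r
    by (simp add: E_def E'_def kern_def algebra_simps flip: exp_add)
  have "continuous_on UNIV (\<lambda>t. E t * F (t, \<xi>))"
    unfolding E_def by (intro continuous_intros continuous_CQ section_measurable(4) F)
  then obtain P where P: "\<And>t. (P has_vector_derivative E t * F (t, \<xi>)) (at t)"
    using antiderivative_exists by blast
  have T_eq: "T F (t, \<xi>) = E' t * (P t - P (t - 2 * pi)) / D \<xi>" for t
  proof -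
    have "((\<lambda>s. - (E' t) * P (t - s)) has_vector_derivative - (E' t) * - (E (t - s) * F (t - s, \<xi>))) (at s)" for s
      by (rule has_vector_derivative_mult_right[OF has_vector_derivative_reflect[OF P]])
    moreover have "- (E' t) * - (E (t - s) * F (t - s, \<xi>)) = kern \<xi> t s * F (t - s, \<xi>)" for s
      using EE'[of t "t - s"] by (simp flip: mult.assoc)
    ultimately have "((\<lambda>s. - (E' t) * P (t - s)) has_vector_derivative kern \<xi> t s * F (t - s, \<xi>)) (at s)" for s
      by (simp only:)
    then have "((\<lambda>s. kern \<xi> t s * F (t - s, \<xi>)) has_integral - (E' t) * P (t - 2 * pi) - (- (E' t) * P (t - 0))) {0..2 * pi}"
      by (intro fundamental_theorem_of_calculus) (auto intro: has_vector_derivative_at_within)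
    then show ?thesis by (simp add: T_def integral_unique algebra_simps)
  qed
  have "((\<lambda>t. - (\<i> * of_real \<xi> * C t + Q t)) has_vector_derivative - lam \<xi> t) (at t)"
    unfolding lam_def
    by (intro has_vector_derivative_minus has_vector_derivative_add has_vector_derivative_mult_right C Q)
  from field_vector_diff_chain_at[OF this DERIV_exp]
  have E'_deriv: "(E' has_vector_derivative - lam \<xi> t * E' t) (at t)"
    unfolding E'_def[abs_def] by (simp add: o_def)
  have "((\<lambda>t. P (t - 2 * pi)) has_vector_derivative E (t - 2 * pi) * F (t, \<xi>)) (at t)"
    using has_vector_derivative_shift[OF P, where t=t and a="- (2 * pi)"] per[of "t - 2 * pi"] by simp
  from has_vector_derivative_mult[OF E'_deriv has_vector_derivative_diff[OF P this]]
  have "((\<lambda>t. E' t * (P t - P (t - 2 * pi))) has_vector_derivative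
      E' t * (E t * F (t, \<xi>) - E (t - 2 * pi) * F (t, \<xi>)) + - lam \<xi> t * E' t * (P t - P (t - 2 * pi))) (at t)" .
  from has_vector_derivative_mult_left[OF this, of "inverse (D \<xi>)"]
  have "((\<lambda>t. E' t * (P t - P (t - 2 * pi)) * inverse (D \<xi>)) has_vector_derivative
      (E' t * E t - E' t * E (t - 2 * pi)) * F (t, \<xi>) * inverse (D \<xi>)
       - lam \<xi> t * (E' t * (P t - P (t - 2 * pi)) * inverse (D \<xi>))) (at t)"
    by (rule has_vector_derivative_eq_rhs) (simp add: algebra_simps)
  moreover have "D \<xi> * F (t, \<xi>) * inverse (D \<xi>) = F (t, \<xi>)"
    using D_nonzero[of \<xi>] by simp
  ultimately show ?thesis
    unfolding T_eq divide_inverse EE' by (simp add: kern_0 kern_2pi)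
qed

lemma T_continuous:
  assumes "continuous_on UNIV F"
  shows "continuous_on UNIV (T F)"
proof -
  have "continuous_on (UNIV \<times> cbox 0 (2 * pi)) (\<lambda>(p, s). kern (snd p) (fst p) s * F (fst p - s, snd p))"
    unfolding case_prod_unfold
    by (intro continuous_intros continuous_on_compose2[OF assms]) auto
  from integral_continuous_on_param[OF this] show ?thesis
    unfolding T_def by (intro continuous_on_divide continuous_on_compose2[OF continuous_D continuous_on_snd])
      (auto simp: D_nonzero continuous_on_id)
qed

text \<open>The bound on \<open>kern\<close> carries the factor norm (D \<xi>), which cancels the
  denominator for every \<xi> at once; the decay of F therefore passes to T F with the same power of
  \<xi>.\<close>

lemma T_rapid:
  assumes "rapid F"
  shows "rapid (T F)"
proof (rule rapidI)
  show "periodic_t (T F)"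
  proof -
    have "F (t + 2 * pi - s, x) = F (t - s, x)" for t s x
      using rapidD(1)[OF assms, of "t - s" x] by (simp add: algebra_simps)
    then show ?thesis by (simp add: periodic_t_def T_def kern_periodic)
  qed
  show "continuous_on UNIV (T F)"
    by (rule T_continuous[OF rapidD(2)[OF assms]])
  fix \<gamma>
  obtain M where M0: "M \<ge> 0" and M: "\<And>t x. \<bar>x\<bar> ^ \<gamma> * norm (F (t, x)) \<le> M"
    using rapid_bound[OF assms] by metis
  have "\<bar>\<xi>\<bar> ^ \<gamma> * norm (T F (t, \<xi>)) \<le> K * M * (2 * pi)" for t \<xi>
  proof -
    have "norm (integral {0..2 * pi} (\<lambda>s. of_real (\<bar>\<xi>\<bar> ^ \<gamma>) * (kern \<xi> t s * F (t - s, \<xi>))))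
        \<le> K * norm (D \<xi>) * M * (2 * pi - 0)"
    proof (rule integral_bound)
      show "continuous_on {0..2 * pi} (\<lambda>s. of_real (\<bar>\<xi>\<bar> ^ \<gamma>) * (kern \<xi> t s * F (t - s, \<xi>)))"
        by (intro continuous_intros continuous_on_compose2[OF rapidD(2)[OF assms]]) auto
      show "norm (of_real (\<bar>\<xi>\<bar> ^ \<gamma>) * (kern \<xi> t s * F (t - s, \<xi>))) \<le> K * norm (D \<xi>) * M"
        if "s \<in> {0..2 * pi}" for s
      proof -
        have k: "norm (kern \<xi> t s) \<le> K * norm (D \<xi>)"
          using that by (intro kern_bound) auto
        have "norm (of_real (\<bar>\<xi>\<bar> ^ \<gamma>) * (kern \<xi> t s * F (t - s, \<xi>)))
            = norm (kern \<xi> t s) * (\<bar>\<xi>\<bar> ^ \<gamma> * norm (F (t - s, \<xi>)))"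
          by (simp add: norm_mult norm_power)
        also have "\<dots> \<le> K * norm (D \<xi>) * M"
          by (intro mult_mono k M) (use order_trans[OF norm_ge_zero k] in auto)
        finally show ?thesis .
      qed
    qed simp
    then have "norm (of_real (\<bar>\<xi>\<bar> ^ \<gamma>) * integral {0..2 * pi} (\<lambda>s. kern \<xi> t s * F (t - s, \<xi>)))
        \<le> K * norm (D \<xi>) * M * (2 * pi)"
      by simp
    then have "norm (of_real (\<bar>\<xi>\<bar> ^ \<gamma>) * T F (t, \<xi>)) * norm (D \<xi>) \<le> (K * M * (2 * pi)) * norm (D \<xi>)"
      using D_nonzero[of \<xi>] by (simp add: T_def norm_mult norm_divide mult_ac)
    then show ?thesis
      using D_nonzero[of \<xi>] by (simp add: norm_mult norm_power)
  qed
  then show "\<exists>K. \<forall>t x. \<bar>x\<bar> ^ \<gamma> * norm (T F (t, x)) \<le> K" by blast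
qed

text \<open>Decay of the \<xi>-derivative V is not visible from the quotient rule. But V is periodic
  in t, and differentiating the equation for T F in \<xi> shows that it solves the same equation
  with right-hand side \<open>G\<close>; uniqueness gives V = T G, where \<open>T_rapid\<close>
  applies again.\<close>

lemma T_dx:
  assumes F: "rapid_diff 1 F"
  shows "((\<lambda>y. T F (t, y)) has_vector_derivative
    T (\<lambda>p. pdx F p + (- \<i>) * (c (fst p) * T F p)) (t, \<xi>)) (at \<xi>)"
proof -
  note F' = F[unfolded One_nat_def]
  note Fr = rapid_diff_imp_rapid[OF F']
  have Fx: "rapid (pdx F)" using rapid_diff_SucD(4)[OF F'] by simp
  define G where "G = (\<lambda>p. pdx F p + (- \<i>) * (c (fst p) * T F p))"
  have G: "rapid G"
    unfolding G_def by (intro rapid_add Fx T_rapid Fr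
        rapid_temperate_mult[OF temperate_diff_imp_temperate[OF temperate_diff_const]]
        rapid_temperate_mult[OF temperate_diff_imp_temperate[OF temperate_diff_t[OF c]]])
  define h where "h = (\<lambda>t \<xi> s. kern \<xi> t s * pdx F (t - s, \<xi>) + \<i> * (C (t - s) - C t) * kern \<xi> t s * F (t - s, \<xi>))"
  define N where "N = (\<lambda>p. integral {0..2 * pi} (\<lambda>s. kern (snd p) (fst p) s * F (fst p - s, snd p)))"
  define N1 where "N1 = (\<lambda>p. integral {0..2 * pi} (h (fst p) (snd p)))"
  define D1 where "D1 \<xi> = of_real (2 * pi) * \<i> * mean_T c * (1 - D \<xi>)" for \<xi>
  \<comment> \<open>The quotient rule for T F = N / D, which provides existence and continuity of
    the derivative.\<close>
  define V where "V = (\<lambda>p. N1 p / D (snd p) - N p * D1 (snd p) / (D (snd p))\<^sup>2)"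
  have kx: "((\<lambda>\<xi>. kern \<xi> t s) has_vector_derivative \<i> * (C (t - s) - C t) * kern \<xi> t s) (at \<xi>)" for t s \<xi>
  proof -
    have "((\<lambda>\<xi>. \<i> * of_real \<xi> * (C (t - s) - C t) + (Q (t - s) - Q t)) has_vector_derivative
        \<i> * (C (t - s) - C t)) (at \<xi>)"
      by (auto intro!: derivative_eq_intros)
    from field_vector_diff_chain_at[OF this DERIV_exp] show ?thesis
      by (simp add: o_def kern_def)
  qed
  have Dx: "(D has_vector_derivative D1 \<xi>) (at \<xi>)" for \<xi>
  proof -
    have "((\<lambda>\<xi>. - (of_real (2 * pi) * (\<i> * of_real \<xi> * mean_T c + mean_T q))) has_vector_derivative
        - (of_real (2 * pi) * (\<i> * mean_T c))) (at \<xi>)"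
      by (auto intro!: derivative_eq_intros)
    from has_vector_derivative_diff[OF has_vector_derivative_const[of 1] field_vector_diff_chain_at[OF this DERIV_exp]]
    show ?thesis
      unfolding D_def[abs_def] D1_def by (simp add: o_def algebra_simps)
  qed
  have h_cont: "continuous_on (UNIV \<times> cbox 0 (2 * pi)) (\<lambda>(p, s). h (fst p) (snd p) s)"
    unfolding case_prod_unfold h_def
    by (intro continuous_intros continuous_on_compose2[OF rapidD(2)[OF Fr]] continuous_on_compose2[OF rapidD(2)[OF Fx]]
        continuous_on_compose2[OF continuous_CQ(1)]) auto
  have Nx: "((\<lambda>\<xi>. N (t, \<xi>)) has_vector_derivative N1 (t, \<xi>)) (at \<xi>)" for t \<xi>
  proof -
    have "((\<lambda>\<xi>. integral (cbox 0 (2 * pi)) (\<lambda>s. kern \<xi> t s * F (t - s, \<xi>))) has_vector_derivative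
        integral (cbox 0 (2 * pi)) (h t \<xi>)) (at \<xi> within UNIV)"
    proof (rule leibniz_rule_vector_derivative)
      show "((\<lambda>\<xi>. kern \<xi> t s * F (t - s, \<xi>)) has_vector_derivative h t \<xi> s) (at \<xi> within UNIV)" for \<xi> s
        unfolding h_def using has_vector_derivative_mult[OF kx rapid_diff_SucD(2)[OF F']] by simp
      show "(\<lambda>s. kern \<xi> t s * F (t - s, \<xi>)) integrable_on cbox 0 (2 * pi)" for \<xi>
        by (intro integrable_continuous continuous_intros continuous_on_compose2[OF rapidD(2)[OF Fr]]) auto
      have "continuous_on (UNIV \<times> cbox 0 (2 * pi)) (\<lambda>(\<xi>, s). (\<lambda>(p, s). h (fst p) (snd p) s) ((t, \<xi>), s))"
        unfolding case_prod_unfold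
        by (rule continuous_on_compose2[OF h_cont[unfolded case_prod_unfold]]) (auto intro!: continuous_intros)
      then show "continuous_on (UNIV \<times> cbox 0 (2 * pi)) (\<lambda>(\<xi>, s). h t \<xi> s)" by simp
    qed auto
    then show ?thesis by (simp add: N_def N1_def)
  qed
  have TN: "T F p = N p * inverse (D (snd p))" for p
    by (simp add: T_def N_def divide_inverse)
  have inv: "((\<lambda>\<xi>. inverse (D \<xi>)) has_vector_derivative D1 \<xi> * (- (inverse (D \<xi>) ^ 2))) (at \<xi>)" for \<xi>
    using field_vector_diff_chain_at[OF Dx DERIV_inverse[OF D_nonzero]]
    by (simp add: o_def numeral_2_eq_2)
  have Vx: "((\<lambda>\<xi>. T F (t, \<xi>)) has_vector_derivative V (t, \<xi>)) (at \<xi>)" for t \<xi>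
    using has_vector_derivative_mult[OF Nx inv, of t \<xi>]
    by (simp add: TN V_def divide_inverse power_inverse algebra_simps)
  have N_cont: "continuous_on UNIV N"
  proof -
    have "N = (\<lambda>p. T F p * D (snd p))" by (auto simp: TN D_nonzero)
    then show ?thesis
      by (simp, intro continuous_intros T_continuous rapidD(2)[OF Fr] continuous_on_compose2[OF continuous_D continuous_on_snd[OF continuous_on_id]]) auto
  qed
  have Dsnd: "continuous_on UNIV (\<lambda>p::real\<times>real. D (snd p))"
    by (rule continuous_on_compose2[OF continuous_D continuous_on_snd[OF continuous_on_id]]) auto
  have V_cont: "continuous_on UNIV V"
    using integral_continuous_on_param[OF h_cont] N_cont Dsnd
    unfolding V_def D1_def N1_def by (intro continuous_intros) (auto simp: D_nonzero)
  have lamT: "\<i> * of_real \<xi> * c t + q t = lam \<xi> t" for \<xi> t by (simp add: lam_def)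
  have lam_cont: "continuous_on UNIV (\<lambda>p. lam (snd p) (fst p))"
    unfolding lam_def
    by (intro continuous_intros continuous_on_compose2[OF smooth1_continuous[OF c(1)]]
        continuous_on_compose2[OF smooth1_continuous[OF q(1)]]) auto
  have swap_cont: "continuous_on UNIV (g \<circ> prod.swap)" if "continuous_on UNIV g" for g :: "real \<times> real \<Rightarrow> complex"
    using that by (intro continuous_on_compose continuous_on_swap) (simp add: surj_swap)
  have Vt: "((\<lambda>t. V (t, \<xi>)) has_vector_derivative G (t, \<xi>) - lam \<xi> t * V (t, \<xi>)) (at t)" for t \<xi>
  proof -
    have "((\<lambda>y. (V \<circ> prod.swap) (\<xi>, y)) has_vector_derivative
        ((\<lambda>p. G p - lam (snd p) (fst p) * V p) \<circ> prod.swap) (\<xi>, t)) (at t)"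
    \<comment> \<open>V must be differentiated in t, but it is given as a \<xi>-derivative of T F.
      The coordinates are swapped because the lemma yields differentiability in the second variable;
      its mixed derivative is the \<xi>-derivative of F - lam * T F.\<close>
    proof (rule mixed_partials_commute[where f="T F \<circ> prod.swap" and
          fx="(\<lambda>p. F p - lam (snd p) (fst p) * T F p) \<circ> prod.swap"])
      show "((\<lambda>s. (T F \<circ> prod.swap) (s, x)) has_vector_derivative (V \<circ> prod.swap) (t, x)) (at t)" for t x
        using Vx by simp
      show "((\<lambda>y. (T F \<circ> prod.swap) (t, y)) has_vector_derivative
          ((\<lambda>p. F p - lam (snd p) (fst p) * T F p) \<circ> prod.swap) (t, x)) (at x)" for t x
        using T_dt[OF rapidD(2)[OF Fr]] rapidD(1)[OF Fr] by simp
      show "((\<lambda>s. ((\<lambda>p. F p - lam (snd p) (fst p) * T F p) \<circ> prod.swap) (s, x)) has_vector_derivative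
          ((\<lambda>p. G p - lam (snd p) (fst p) * V p) \<circ> prod.swap) (t, x)) (at t)" for t x
      proof -
        have "((\<lambda>s. lam s x) has_vector_derivative \<i> * c x) (at t)"
          unfolding lam_def by (auto intro!: derivative_eq_intros)
        from has_vector_derivative_diff[OF rapid_diff_SucD(2)[OF F'] has_vector_derivative_mult[OF this Vx]]
        show ?thesis
          by (simp add: G_def algebra_simps)
      qed
      show "continuous_on UNIV ((\<lambda>p. F p - lam (snd p) (fst p) * T F p) \<circ> prod.swap)"
        by (intro swap_cont continuous_intros lam_cont rapidD(2) Fr T_rapid)
      show "continuous_on UNIV ((\<lambda>p. G p - lam (snd p) (fst p) * V p) \<circ> prod.swap)"
        by (intro swap_cont continuous_intros lam_cont rapidD(2) G V_cont)
    qed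
    then show ?thesis by simp
  qed
  have Vper: "V (t + 2 * pi, \<xi>) = V (t, \<xi>)" for t \<xi>
  proof -
    have "(\<lambda>\<xi>. T F (t + 2 * pi, \<xi>)) = (\<lambda>\<xi>. T F (t, \<xi>))"
      using rapidD(1)[OF T_rapid[OF Fr]] by simp
    then show ?thesis
      using vector_derivative_unique_at[OF Vx[of "t + 2 * pi" \<xi>]] Vx[of t \<xi>] by simp
  qed
  have "V (t, \<xi>) * D \<xi> = integral {0..2 * pi} (\<lambda>s. kern \<xi> t s * G (t - s, \<xi>))"
    by (rule periodic_solution_unique[where v="\<lambda>t. V (t, \<xi>)" and g="\<lambda>t. G (t, \<xi>)", OF Vper Vt])
  then have "V (t, \<xi>) = T G (t, \<xi>)"
    using D_nonzero[of \<xi>] by (simp add: T_def field_simps)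
  with Vx[of t \<xi>] show ?thesis by (simp add: G_def)
qed

text \<open>Both partial derivatives of T F are again made of T and temperate multipliers: in t by
  the equation itself, whose factor \<xi> is polynomial, and in \<xi> by \<open>T_dx\<close>, whose
  new right-hand side contains T F at the order n of the induction hypothesis.\<close>

lemma T_rapid_diff: "rapid_diff n F \<Longrightarrow> rapid_diff n (T F)"
proof (induction n arbitrary: F)
  case 0
  then show ?case by (simp add: T_rapid)
next
  case (Suc n)
  note F0 = rapid_diff_mono[OF Suc.prems]
  note Fr = rapid_diff_imp_rapid[OF F0]
  have F1: "rapid_diff 1 F" using rapid_diff_le[OF Suc.prems, of 1] by simp
  note mult_c = rapid_diff_temperate_mult[OF temperate_diff_t[OF c]]
    and mult_q = rapid_diff_temperate_mult[OF temperate_diff_t[OF q]]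
    and mult_x = rapid_diff_temperate_mult[OF temperate_diff_x]
  show ?case
  proof (rule rapid_diff_SucI[OF T_rapid[OF Fr] _ T_dx[OF F1]])
    show "((\<lambda>s. T F (s, x)) has_vector_derivative (\<lambda>p. F p + (-1) * (\<i> * (of_real (snd p) * (c (fst p) * T F p))
        + q (fst p) * T F p)) (t, x)) (at t)" for t x
      using T_dt[OF rapidD(2)[OF Fr], of x t] rapidD(1)[OF Fr] by (simp add: lam_def algebra_simps)
    show "rapid_diff n (\<lambda>p. F p + (-1) * (\<i> * (of_real (snd p) * (c (fst p) * T F p)) + q (fst p) * T F p))"
      by (intro rapid_diff_add F0 rapid_diff_cmult mult_x mult_c mult_q Suc.IH)
    show "rapid_diff n (T (\<lambda>p. pdx F p + (- \<i>) * (c (fst p) * T F p)))"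
      using rapid_diff_SucD(4)[OF Suc.prems]
      by (intro Suc.IH rapid_diff_add rapid_diff_cmult mult_c F0)
  qed
qed

lemma L_surjective:
  assumes "f \<in> schwartz"
  obtains u where "u \<in> schwartz" "\<And>p. pdt u p + c (fst p) * pdx u p + q (fst p) * u p = f p"
proof -
  define F where "F = fourier (-1) f"
  have F: "F \<in> schwartz" unfolding F_def by (intro fourier_schwartz assms) simp
  have TF: "T F \<in> schwartz" using F by (simp add: schwartz_iff T_rapid_diff)
  define w where "w = fourier 1 (T F)"
  have w: "w \<in> schwartz" unfolding w_def by (intro fourier_schwartz TF) simp
  have wt: "pdt w (t, x) = fourier 1 (pdt (T F)) (t, x)" for t x
    using vector_derivative_unique_at[OF schwartz_derivs(1)[OF w]] fourier_dt[OF TF] unfolding w_def by blast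
  have wx: "pdx w (t, x) = \<i> * fourier 1 (\<lambda>p. of_real (snd p) * T F p) (t, x)" for t x
    using vector_derivative_unique_at[OF schwartz_derivs(2)[OF w]] fourier_dx[OF TF, of 1] unfolding w_def by simp
  have TFt: "pdt (T F) (t, x) = F (t, x) - lam x t * T F (t, x)" for t x
    using vector_derivative_unique_at[OF schwartz_derivs(1)[OF TF]]
      T_dt[OF rapidD(2), of F x t] schwartz_imp_rapid[OF F] rapidD(1) by blast
  have "pdt w p + c (fst p) * pdx w p + q (fst p) * w p = of_real (2 * pi) * f p" for p
  proof -
    obtain t x where p: "p = (t, x)" by (cases p)
    note I = fourier_integrable[OF schwartz_imp_rapid]
    have "fourier 1 F (t, x) = (LINT \<xi>|lborel. iexp (1 * x * \<xi>) * pdt (T F) (t, \<xi>)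
       + (c t * \<i> * (iexp (1 * x * \<xi>) * (of_real \<xi> * T F (t, \<xi>)))
          + q t * (iexp (1 * x * \<xi>) * T F (t, \<xi>))))"
      unfolding fourier_def by (intro Bochner_Integration.integral_cong) (auto simp: TFt lam_def algebra_simps)
    also have "\<dots> = fourier 1 (pdt (T F)) (t, x) + (c t * \<i> * fourier 1 (\<lambda>p. of_real (snd p) * T F p) (t, x)
        + q t * fourier 1 (T F) (t, x))"
      using I[OF schwartz_pdt[OF TF], of "1 * x" t] I[OF schwartz_mult_x[OF TF], of "1 * x" t] I[OF TF, of "1 * x" t]
      unfolding fourier_def fst_conv snd_conv
      by (simp only: Bochner_Integration.integral_add integral_mult_right_zero integrable_mult_right
          Bochner_Integration.integrable_add)
    finally have "pdt w p + c (fst p) * pdx w p + q (fst p) * w p = fourier 1 F p"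
      by (simp add: p wt wx) (simp add: w_def mult.assoc)
    then show ?thesis
      by (simp add: F_def fourier_inversion[OF assms])
  qed
  note w_eq = this
  \<comment> \<open>Removes the factor 2 pi of \<open>fourier_inversion\<close>.\<close>
  define a where "a = complex_of_real (inverse (2 * pi))"
  define u where "u = (\<lambda>p. a * w p)"
  have u: "u \<in> schwartz" unfolding u_def by (rule schwartz_cmult[OF w])
  have ut: "pdt u (t, x) = a * pdt w (t, x)" and ux: "pdx u (t, x) = a * pdx w (t, x)" for t x
    using vector_derivative_unique_at[OF schwartz_derivs(1)[OF u, of x t]]
      vector_derivative_unique_at[OF schwartz_derivs(2)[OF u, of t x]]
      has_vector_derivative_mult_right[OF schwartz_derivs(1)[OF w, of x t], of a]
      has_vector_derivative_mult_right[OF schwartz_derivs(2)[OF w, of t x], of a]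
    unfolding u_def by blast+
  have "pdt u p + c (fst p) * pdx u p + q (fst p) * u p
      = a * (pdt w p + c (fst p) * pdx w p + q (fst p) * w p)" for p
    by (cases p) (simp add: u_def ut[unfolded u_def] ux[unfolded u_def] algebra_simps)
  then have "pdt u p + c (fst p) * pdx u p + q (fst p) * u p = f p" for p
    unfolding w_eq by (simp add: a_def)
  with u that show ?thesis by blast
qed

end

section \<open>Sufficiency\<close>

text \<open>The exponential is 1 only if i \<xi> c0 + q0 = - i n for an integer n, with c0 and q0
  the means of c and q; multiplied by - i this is the equation that defines
  \<open>Z_L0\<close>.\<close>

lemma nonresonant_denominator:
  assumes "Z_L0 c q = {}"
  shows "1 - exp (- (of_real (2 * pi) * (\<i> * of_real \<xi> * mean_T c + mean_T q))) \<noteq> 0"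
proof
  assume "1 - exp (- (of_real (2 * pi) * (\<i> * of_real \<xi> * mean_T c + mean_T q))) = 0"
  then have "exp (- (of_real (2 * pi) * (\<i> * of_real \<xi> * mean_T c + mean_T q))) = 1"
    by simp
  moreover define z where "z = \<i> * of_real \<xi> * mean_T c + mean_T q"
  ultimately have "exp (- (of_real (2 * pi) * z)) = 1" by simp
  then obtain n :: int where "Re (- (of_real (2 * pi) * z)) = 0"
      "Im (- (of_real (2 * pi) * z)) = of_int (2 * n) * pi"
    unfolding exp_eq_1 by blast
  then have "Re z = 0" "pi * (Im z + of_int n) = 0" by (simp_all add: algebra_simps)
  then have "Re z = 0" "Im z = - of_int n" by (simp_all add: eq_neg_iff_add_eq_0)
  then have "z = - \<i> * of_int n"
    by (simp add: complex_eq_iff)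
  then have "- \<i> * (\<i> * of_real \<xi> * mean_T c + mean_T q) = - \<i> * (- \<i> * of_int n)"
    by (simp add: z_def)
  then have "of_int n + mean_T c * of_real \<xi> - \<i> * mean_T q = 0"
    by (simp add: algebra_simps)
  then have "(n, \<xi>) \<in> Z_L0 c q" by (simp add: Z_L0_def)
  with assms show False by simp
qed

text \<open>The exponential has modulus exp y with y = 2 pi (b0 \<xi> - r), so norm (W \<xi>) is at
  least the distance of exp y from 1. This suffices for y away from 0. If b0 is nonzero, the
  remaining \<xi> form a compact set on which W does not vanish. If b0 = 0, the modulus is constant:
  either it differs from 1, or r = 0 and nonresonance forces mean_T c = 0, so W is constant.\<close>

lemma exp_le_denominator_bound:
  assumes "Z_L0 c q = {}"
  shows "\<exists>K. \<forall>\<xi>. max 1 (exp (2 * pi * (Im (mean_T c) * \<xi>)))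
    \<le> K * norm (1 - exp (- (of_real (2 * pi) * (\<i> * of_real \<xi> * mean_T c + mean_T q))))"
proof -
  define W where "W \<xi> = 1 - exp (- (of_real (2 * pi) * (\<i> * of_real \<xi> * mean_T c + mean_T q)))" for \<xi>
  define b0 r where "b0 = Im (mean_T c)" and "r = Re (mean_T q)"
  have W0: "W \<xi> \<noteq> 0" for \<xi>
    unfolding W_def by (rule nonresonant_denominator[OF assms])
  have W_lower: "\<bar>1 - exp (2 * pi * (b0 * \<xi> - r))\<bar> \<le> norm (W \<xi>)" for \<xi>
    using norm_triangle_ineq3[of 1 "exp (- (of_real (2 * pi) * (\<i> * of_real \<xi> * mean_T c + mean_T q)))"]
    by (simp add: W_def b0_def r_def algebra_simps)
  have "\<exists>K. \<forall>\<xi>. max 1 (exp (2 * pi * (b0 * \<xi>))) \<le> K * norm (W \<xi>)"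
  proof (cases "b0 = 0")
    case True
    have "\<exists>d>0. \<forall>\<xi>. d \<le> norm (W \<xi>)"
    proof (cases "r = 0")
      case False
      then show ?thesis
        using W_lower True by (intro exI[of _ "\<bar>1 - exp (- (2 * pi * r))\<bar>"]) auto
    next
      case r0: True
      have "mean_T c = 0"
      proof (rule ccontr)
        assume "mean_T c \<noteq> 0"
        with True have "Re (mean_T c) \<noteq> 0" by (simp add: complex_eq_iff b0_def)
        \<comment> \<open>For b0 = r = 0 and k = 0 the resonance equation is real and linear in
          \<xi>, hence solvable.\<close>
        with True r0 have "(0, - Im (mean_T q) / Re (mean_T c)) \<in> Z_L0 c q"
          by (simp add: Z_L0_def complex_eq_iff b0_def r_def)
        with assms show False by simp
      qed
      then have "W \<xi> = W 0" for \<xi> by (simp add: W_def)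
      then show ?thesis using W0[of 0] by (intro exI[of _ "norm (W 0)"]) (metis order_refl zero_less_norm_iff)
    qed
    then obtain d where "d > 0" "\<And>\<xi>. d \<le> norm (W \<xi>)" by blast
    then show ?thesis using True by (intro exI[of _ "1 / d"]) (auto simp: field_simps)
  next
    case False
    \<comment> \<open>y serves as coordinate instead of \<xi>; on {-1..1} the lower bound by the
      modulus degenerates and compactness takes over.\<close>
    have cont: "continuous_on {-1..1} (\<lambda>y. norm (W ((y / (2 * pi) + r) / b0)))"
      unfolding W_def by (intro continuous_intros) (use False in auto)
    obtain y0 where y0: "\<And>y. y \<in> {-1..1} \<Longrightarrow> norm (W ((y0 / (2 * pi) + r) / b0)) \<le> norm (W ((y / (2 * pi) + r) / b0))"
      using continuous_attains_inf[OF compact_Icc _ cont] by fastforce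
    define d where "d = norm (W ((y0 / (2 * pi) + r) / b0))"
    have d: "d > 0" using W0 by (simp add: d_def)
    \<comment> \<open>The first summand serves y outside (-1, 1), the second y in {-1..1}.\<close>
    define k where "k = 1 / (1 - exp (- 1 :: real)) + exp 1 / d"
    have e1: "0 < 1 - exp (- 1 :: real)" by simp
    have main: "max 1 (exp (2 * pi * (b0 * \<xi> - r))) \<le> k * norm (W \<xi>)" for \<xi>
    proof -
      define y where "y = 2 * pi * (b0 * \<xi> - r)"
      have lower: "\<bar>1 - exp y\<bar> \<le> norm (W \<xi>)" unfolding y_def by (rule W_lower)
      have k1: "max 1 (exp y) \<le> k * norm (W \<xi>)"
        if "max 1 (exp y) \<le> 1 / (1 - exp (- 1)) * norm (W \<xi>) \<or> max 1 (exp y) \<le> exp 1 / d * norm (W \<xi>)"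
        using that
      proof (rule disjE)
        assume "max 1 (exp y) \<le> 1 / (1 - exp (- 1)) * norm (W \<xi>)"
        moreover have "0 \<le> exp 1 / d * norm (W \<xi>)" using d by simp
        ultimately show ?thesis unfolding k_def distrib_right by linarith
      next
        assume "max 1 (exp y) \<le> exp 1 / d * norm (W \<xi>)"
        moreover have "0 \<le> 1 / (1 - exp (- 1)) * norm (W \<xi>)" using e1 by simp
        ultimately show ?thesis unfolding k_def distrib_right by linarith
      qed
      consider "y \<le> -1" | "y \<ge> 1" | "\<bar>y\<bar> \<le> 1" by linarith
      then have "max 1 (exp y) \<le> k * norm (W \<xi>)"
      proof cases
        case 1
        then have "exp y \<le> exp (-1)" by simp
        then have "1 - exp (-1) \<le> norm (W \<xi>)" using lower by linarith
        moreover have "max 1 (exp y) = 1" using 1 by simp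
        ultimately have "max 1 (exp y) \<le> 1 / (1 - exp (- 1)) * norm (W \<xi>)"
          using e1 by (simp add: pos_le_divide_eq)
        then show ?thesis using k1 by blast
      next
        case 2
        have "1 = exp y * exp (- y)" by (simp flip: exp_add)
        also have "\<dots> \<le> exp y * exp (- 1)" using 2 by (intro mult_left_mono) auto
        finally have "exp y * (1 - exp (- 1)) \<le> norm (W \<xi>)"
          using lower by (simp add: algebra_simps)
        moreover have "max 1 (exp y) = exp y" using 2 by simp
        ultimately have "max 1 (exp y) \<le> 1 / (1 - exp (- 1)) * norm (W \<xi>)"
          using e1 by (simp add: pos_le_divide_eq)
        then show ?thesis using k1 by blast
      next
        case 3
        have "(y / (2 * pi) + r) / b0 = \<xi>" using False by (simp add: y_def)
        then have "d \<le> norm (W \<xi>)" using y0[of y] 3 by (simp add: d_def abs_le_iff)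
        moreover have "max 1 (exp y) \<le> exp 1" using 3 by simp
        ultimately have "max 1 (exp y) * d \<le> exp 1 * norm (W \<xi>)"
          using d by (intro mult_mono) auto
        then have "max 1 (exp y) \<le> exp 1 / d * norm (W \<xi>)"
          using d by (simp only: pos_le_divide_eq times_divide_eq_left)
        then show ?thesis using k1 by blast
      qed
      then show ?thesis by (simp only: y_def)
    qed
    \<comment> \<open>Passing from b0 \<xi> - r to b0 \<xi> costs at most the factor exp (2 pi
      \<bar>r\<bar>).\<close>
    have "max 1 (exp (2 * pi * (b0 * \<xi>))) \<le> exp (2 * pi * \<bar>r\<bar>) * k * norm (W \<xi>)" for \<xi>
    proof -
      have "max 1 (exp (2 * pi * (b0 * \<xi>))) \<le> exp (2 * pi * \<bar>r\<bar>) * max 1 (exp (2 * pi * (b0 * \<xi> - r)))"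
      proof (rule max.boundedI)
        have "1 * 1 \<le> exp (2 * pi * \<bar>r\<bar>) * max 1 (exp (2 * pi * (b0 * \<xi> - r)))"
          by (intro mult_mono) auto
        then show "1 \<le> exp (2 * pi * \<bar>r\<bar>) * max 1 (exp (2 * pi * (b0 * \<xi> - r)))" by simp
        have "exp (2 * pi * (b0 * \<xi>)) = exp (2 * pi * r) * exp (2 * pi * (b0 * \<xi> - r))"
          by (simp add: algebra_simps flip: exp_add)
        also have "\<dots> \<le> exp (2 * pi * \<bar>r\<bar>) * max 1 (exp (2 * pi * (b0 * \<xi> - r)))"
          by (intro mult_mono) auto
        finally show "exp (2 * pi * (b0 * \<xi>)) \<le> exp (2 * pi * \<bar>r\<bar>) * max 1 (exp (2 * pi * (b0 * \<xi> - r)))" .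
      qed
      also have "\<dots> \<le> exp (2 * pi * \<bar>r\<bar>) * (k * norm (W \<xi>))"
        by (intro mult_left_mono main) auto
      finally show ?thesis by (simp add: mult.assoc)
    qed
    then show ?thesis by blast
  qed
  then show ?thesis unfolding W_def b0_def .
qed

text \<open>B = Im C is monotone by the sign condition, so for s within one period B t - B (t - s)
  lies between 0 and 2 pi Im (mean_T c). For either sign of \<xi> the growth exponent is thus at
  most the larger of 0 and 2 pi Im (mean_T c) \<xi>, and \<open>exp_le_denominator_bound\<close>
  absorbs it. The part from Q is bounded because q is.\<close>

lemma kernel_bound_exists:
  assumes c: "smooth1 c" "periodic1 c" and q: "smooth1 q" "periodic1 q"
    and Z: "Z_L0 c q = {}" and sgn: "(\<forall>t. Im (c t) \<ge> 0) \<or> (\<forall>t. Im (c t) \<le> 0)"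
    and C: "\<And>t. (C has_vector_derivative c t) (at t)"
    and Q: "\<And>t. (Q has_vector_derivative q t) (at t)"
  obtains K where "periodic_ode c q C Q K"
proof -
  obtain k where k: "\<And>\<xi>. max 1 (exp (2 * pi * (Im (mean_T c) * \<xi>)))
    \<le> k * norm (1 - exp (- (of_real (2 * pi) * (\<i> * of_real \<xi> * mean_T c + mean_T q))))"
    using exp_le_denominator_bound[OF Z] by blast
  have per: "q (t + 2 * pi) = q t" for t using q(2) by (simp add: periodic1_def)
  obtain m where m0: "m \<ge> 0" and m: "\<And>t. norm (q t) \<le> m"
    by (rule periodic_bounded[of q, OF per smooth1_continuous[OF q(1)]]) (rule that)
  have Qb: "norm (Q (t - s) - Q t) \<le> m * (2 * pi)" if "0 \<le> s" "s \<le> 2 * pi" for t s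
  proof -
    have "norm (Q (t - s) - Q t) \<le> m * \<bar>t - s - t\<bar>"
      by (rule norm_diff_le_of_vector_derivative[OF Q m])
    also have "\<dots> \<le> m * (2 * pi)"
      using that m0 by (intro mult_left_mono) auto
    finally show ?thesis .
  qed
  define B where "B t = Im (C t)" for t
  have B: "(B has_real_derivative Im (c t)) (at t)" for t
    unfolding B_def[abs_def] has_real_derivative_iff_has_vector_derivative
    by (rule bounded_linear.has_vector_derivative[OF bounded_linear_Im C])
  have B2: "B t - B (t - 2 * pi) = 2 * pi * Im (mean_T c)" for t
    using arg_cong[OF antiderivative_shift[OF C c(2), of "t - 2 * pi"], of Im] by (simp add: B_def)
  have Bb: "\<xi> * (B t - B (t - s)) \<le> max 0 (2 * pi * (Im (mean_T c) * \<xi>))"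
    if s: "0 \<le> s" "s \<le> 2 * pi" for t s \<xi>
    using sgn
  proof
    assume "\<forall>t. Im (c t) \<ge> 0"
    then have mono: "B x \<le> B y" if "x \<le> y" for x y
      using B that by (metis DERIV_nonneg_imp_nondecreasing)
    have 1: "0 \<le> B t - B (t - s)" "B t - B (t - s) \<le> 2 * pi * Im (mean_T c)"
      using mono[of "t - s" t] mono[of "t - 2 * pi" "t - s"] s B2[of t] by auto
    show ?thesis
    proof (cases "\<xi> \<ge> 0")
      case True
      then have "\<xi> * (B t - B (t - s)) \<le> \<xi> * (2 * pi * Im (mean_T c))"
        using 1 by (intro mult_left_mono)
      then show ?thesis by (simp add: mult_ac)
    next
      case False
      then show ?thesis using mult_nonpos_nonneg[of \<xi> "B t - B (t - s)"] 1 by simp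
    qed
  next
    assume "\<forall>t. Im (c t) \<le> 0"
    then have mono: "B y \<le> B x" if "x \<le> y" for x y
      using B that by (metis DERIV_nonpos_imp_nonincreasing)
    have 1: "B t - B (t - s) \<le> 0" "2 * pi * Im (mean_T c) \<le> B t - B (t - s)"
      using mono[of "t - s" t] mono[of "t - 2 * pi" "t - s"] s B2[of t] by auto
    show ?thesis
    proof (cases "\<xi> \<ge> 0")
      case True
      then show ?thesis using mult_nonneg_nonpos[of \<xi> "B t - B (t - s)"] 1 by simp
    next
      case False
      then have "\<xi> * (B t - B (t - s)) \<le> \<xi> * (2 * pi * Im (mean_T c))"
        using 1 by (intro mult_left_mono_neg) auto
      then show ?thesis by (simp add: mult_ac)
    qed
  qed
  have "periodic_ode c q C Q (exp (m * (2 * pi)) * k)"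
  proof
    fix \<xi> t s :: real
    assume s: "0 \<le> s" "s \<le> 2 * pi"
    have "norm (exp (\<i> * of_real \<xi> * (C (t - s) - C t) + (Q (t - s) - Q t)))
        = exp (Re (Q (t - s) - Q t)) * exp (\<xi> * (B t - B (t - s)))"
      by (simp add: B_def algebra_simps flip: exp_add)
    also have "\<dots> \<le> exp (m * (2 * pi)) * max 1 (exp (2 * pi * (Im (mean_T c) * \<xi>)))"
    proof (intro mult_mono)
      show "exp (Re (Q (t - s) - Q t)) \<le> exp (m * (2 * pi))"
        using Qb[OF s, of t] complex_Re_le_cmod[of "Q (t - s) - Q t"] by simp
      have "exp (\<xi> * (B t - B (t - s))) \<le> exp (max 0 (2 * pi * (Im (mean_T c) * \<xi>)))"
        using Bb[OF s] by simp
      also have "\<dots> = max 1 (exp (2 * pi * (Im (mean_T c) * \<xi>)))"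
        by (simp add: max_def)
      finally show "exp (\<xi> * (B t - B (t - s))) \<le> max 1 (exp (2 * pi * (Im (mean_T c) * \<xi>)))" .
    qed auto
    also have "\<dots> \<le> exp (m * (2 * pi)) * (k * norm (1 - exp (- (of_real (2 * pi) * (\<i> * of_real \<xi> * mean_T c + mean_T q)))))"
      by (intro mult_left_mono k) auto
    finally show "norm (exp (\<i> * of_real \<xi> * (C (t - s) - C t) + (Q (t - s) - Q t)))
      \<le> exp (m * (2 * pi)) * k * norm (1 - exp (- (of_real (2 * pi) * (\<i> * of_real \<xi> * mean_T c + mean_T q))))"
      by (simp add: mult.assoc)
  qed (fact c q C Q)+
  then show ?thesis by (rule that)
qed

lemma schwartz_solvable:
  assumes "smooth1 c" "periodic1 c" "smooth1 q" "periodic1 q" "Z_L0 c q = {}"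
    "(\<forall>t. Im (c t) \<ge> 0) \<or> (\<forall>t. Im (c t) \<le> 0)" "f \<in> schwartz"
  obtains u where "u \<in> schwartz" "\<And>p. pdt u p + c (fst p) * pdx u p + q (fst p) * u p = f p"
proof -
  obtain C where C: "\<And>t. (C has_vector_derivative c t) (at t)"
    using antiderivative_exists smooth1_continuous assms(1) by metis
  obtain Q where Q: "\<And>t. (Q has_vector_derivative q t) (at t)"
    using antiderivative_exists smooth1_continuous assms(3) by metis
  obtain K where "periodic_ode c q C Q K"
    using kernel_bound_exists[OF assms(1-6) C Q] by blast
  then show ?thesis using periodic_ode.L_surjective[OF _ assms(7)] that by blast
qed

lemma fun_distr_eq_int2: "fun_distr g \<phi> = int2 (\<lambda>p. g p * \<phi> p)"
  by (simp add: fun_distr_def int2_def)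

lemma schwartz_imp_rapid_diff: "f \<in> schwartz \<Longrightarrow> rapid_diff n f"
  by (simp add: schwartz_iff)

text \<open>Needed for the transpose, which has - q in place of q up to an overall sign. The
  reflection of (k, \<xi>) to (- k, - \<xi>) matches the two resonance equations.\<close>

lemma Z_L0_uminus:
  assumes "Z_L0 c q = {}"
  shows "Z_L0 c (\<lambda>t. - q t) = {}"
proof -
  have m: "mean_T (\<lambda>t. - q t) = - mean_T q"
    by (simp add: mean_T_def)
  have "(- k, - \<xi>) \<in> Z_L0 c q" if "(k, \<xi>) \<in> Z_L0 c (\<lambda>t. - q t)" for k \<xi>
  proof -
    have "of_int (- k) + mean_T c * of_real (- \<xi>) - \<i> * mean_T q
        = - (of_int k + mean_T c * of_real \<xi> - \<i> * mean_T (\<lambda>t. - q t))"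
      by (simp add: m)
    also have "\<dots> = 0" using that by (simp add: Z_L0_def)
    finally show ?thesis unfolding Z_L0_def by blast
  qed
  then show ?thesis using assms by auto
qed

text \<open>Choose f with L f = g and, for each \<phi>, a \<psi> whose image under
  \<open>L_transpose\<close> is \<phi>. Then u \<phi> is the integral of g \<psi> = (L f) \<psi>,
  which equals the integral of f \<phi> by parts.\<close>

lemma schwartz_GH_if:
  assumes "smooth1 c" "periodic1 c" "smooth1 q" "periodic1 q" "Z_L0 c q = {}"
    "(\<forall>t. Im (c t) \<ge> 0) \<or> (\<forall>t. Im (c t) \<le> 0)"
  shows "schwartz_GH c q"
  unfolding schwartz_GH_def
proof (intro allI impI)
  fix u assume "\<exists>g\<in>schwartz. \<forall>\<phi>\<in>schwartz. u (L_transpose c q \<phi>) = fun_distr g \<phi>"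
  then obtain g where g: "g \<in> schwartz" "\<And>\<phi>. \<phi> \<in> schwartz \<Longrightarrow> u (L_transpose c q \<phi>) = fun_distr g \<phi>"
    by blast
  obtain f where f: "f \<in> schwartz" "\<And>p. pdt f p + c (fst p) * pdx f p + q (fst p) * f p = g p"
    using schwartz_solvable[OF assms g(1)] by blast
  have "u \<phi> = fun_distr f \<phi>" if \<phi>: "\<phi> \<in> schwartz" for \<phi>
  proof -
    \<comment> \<open>The right-hand side is - \<phi> because the transpose is minus the operator
      with coefficient - q.\<close>
    obtain \<psi> where \<psi>: "\<psi> \<in> schwartz" "\<And>p. pdt \<psi> p + c (fst p) * pdx \<psi> p + - q (fst p) * \<psi> p = (-1) * \<phi> p"
      using schwartz_solvable[OF assms(1,2) smooth1_minus[OF assms(3)] _ Z_L0_uminus[OF assms(5)] assms(6)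
          schwartz_cmult[OF \<phi>, of "-1"]] assms(4) by (auto simp: periodic1_def)
    have "L_transpose c q \<psi> p = \<phi> p" for p
      using \<psi>(2)[of p] unfolding L_transpose_def by (simp add: algebra_simps eq_neg_iff_add_eq_0 neg_eq_iff_add_eq_0)
    then have "L_transpose c q \<psi> = \<phi>" by auto
    then have "u \<phi> = int2 (\<lambda>p. g p * \<psi> p)"
      using g(2)[OF \<psi>(1)] by (simp add: fun_distr_eq_int2)
    also have "\<dots> = int2 (\<lambda>p. f p * L_transpose c q \<psi> p)"
      using integration_by_parts[OF schwartz_imp_rapid_diff[OF f(1)] schwartz_imp_rapid_diff[OF \<psi>(1)] assms(1-4)]
      by (simp add: f(2))
    also have "\<dots> = fun_distr f \<phi>"
      by (simp add: fun_distr_eq_int2 \<open>L_transpose c q \<psi> = \<phi>\<close>)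
    finally show ?thesis .
  qed
  with f(1) show "\<exists>f\<in>schwartz. \<forall>\<phi>\<in>schwartz. u \<phi> = fun_distr f \<phi>" by blast
qed

section \<open>Distributions given by functions\<close>

lemma schwartz_seminorm_upper:
  assumes "\<phi> \<in> schwartz"
  shows "\<bar>x\<bar> ^ \<gamma> * norm (dmix \<alpha> \<beta> \<phi> (t, x)) \<le> seminorm_S \<alpha> \<beta> \<gamma> \<phi>"
proof -
  have "bounded (range (\<lambda>p. of_real (snd p ^ \<gamma>) * dmix \<alpha> \<beta> \<phi> p))"
    using assms by (simp add: schwartz_def)
  then have "bdd_above (range (\<lambda>p. norm (of_real (snd p ^ \<gamma>) * dmix \<alpha> \<beta> \<phi> p)))"
    by (auto simp: bounded_iff bdd_above_def)
  from cSUP_upper[OF UNIV_I this, of "(t, x)"] show ?thesis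
    by (simp add: seminorm_S_def norm_mult norm_power)
qed

lemma schwartz_seminorm_nonneg: "\<phi> \<in> schwartz \<Longrightarrow> 0 \<le> seminorm_S \<alpha> \<beta> \<gamma> \<phi>"
  by (rule order_trans[OF _ schwartz_seminorm_upper[of \<phi> 0 \<gamma> \<alpha> \<beta> 0]]) simp_all

lemma temperate_bounded:
  assumes "periodic_t g" "continuous_on UNIV g" "\<And>p. norm (g p) \<le> M"
  shows "temperate g"
proof -
  have "\<exists>M m. \<forall>t x. norm (g (t, x)) \<le> M * \<bar>x\<bar> ^ m"
    using assms(3) by (intro exI[of _ M] exI[of _ 0]) simp
  with assms show ?thesis by (simp add: temperate_def)
qed

text \<open>The pairing is bounded through the majorant 1 / (1 + x^2). That takes the seminorms
  without derivatives for \<gamma> = 0 and \<gamma> = 2, hence N = 2.\<close>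

lemma tempered_fun_distr:
  assumes g: "periodic_t g" "continuous_on UNIV g" "\<And>p. norm (g p) \<le> M"
  shows "tempered (fun_distr g)"
  unfolding tempered_def
proof (intro conjI ballI allI)
  note gT = temperate_bounded[OF g]
  have r: "rapid (\<lambda>p. g p * \<phi> p)" if "\<phi> \<in> schwartz" for \<phi>
    by (rule rapid_temperate_mult[OF gT schwartz_imp_rapid[OF that]])
  fix \<phi> assume \<phi>: "\<phi> \<in> schwartz"
  show "fun_distr g (\<lambda>p. \<phi> p + \<psi> p) = fun_distr g \<phi> + fun_distr g \<psi>" if "\<psi> \<in> schwartz" for \<psi>
    unfolding fun_distr_eq_int2 distrib_left by (rule int2_add[OF r[OF \<phi>] r[OF that]])
  show "fun_distr g (\<lambda>p. a * \<phi> p) = a * fun_distr g \<phi>" for a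
    unfolding fun_distr_eq_int2 int2_cmult[symmetric] by (simp add: mult_ac)
next
  note gT = temperate_bounded[OF g]
  define J where "J = (LINT p|lborel. indicator {0..2*pi} (fst p) * inverse (1 + (snd p :: real)\<^sup>2) :: real)"
  have J0: "J \<ge> 0"
    unfolding J_def by (rule integral_nonneg_AE) (auto simp: indicator_def)
  have M0: "M \<ge> 0" using g(3)[of 0] norm_ge_zero order_trans by blast
  have "norm (fun_distr g \<phi>) \<le> M * J * (\<Sum>\<alpha>\<le>2. \<Sum>\<beta>\<le>2. \<Sum>\<gamma>\<le>2. seminorm_S \<alpha> \<beta> \<gamma> \<phi>)"
    if \<phi>: "\<phi> \<in> schwartz" for \<phi>
  proof -
    define S where "S = seminorm_S 0 0 0 \<phi> + seminorm_S 0 0 2 \<phi>"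
    note nn = schwartz_seminorm_nonneg[OF \<phi>]
    have S0: "S \<ge> 0" unfolding S_def using nn by simp
    have \<phi>S: "norm (\<phi> (t, x)) \<le> S * inverse (1 + x\<^sup>2)" for t x
    proof -
      have "(1 + x\<^sup>2) * norm (\<phi> (t, x)) \<le> S"
        using schwartz_seminorm_upper[OF \<phi>, of x 0 0 0 t] schwartz_seminorm_upper[OF \<phi>, of x 2 0 0 t]
        by (simp add: S_def dmix_def algebra_simps)
      moreover have "1 + x\<^sup>2 > 0" by (simp add: add_pos_nonneg)
      ultimately show ?thesis by (simp add: field_simps)
    qed
    have "norm (int2 (\<lambda>p. g p * \<phi> p))
       \<le> (LINT p|lborel. (M * S) * (indicator {0..2*pi} (fst p) * inverse (1 + (snd p)\<^sup>2)))"
      unfolding int2_def set_lebesgue_integral_def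
    proof (rule order_trans[OF integral_norm_bound integral_mono])
      have "integrable lborel (\<lambda>p. indicator ({0..2*pi} \<times> UNIV) p *\<^sub>R (g p * \<phi> p))"
        using int2_integrable[OF rapid_temperate_mult[OF gT schwartz_imp_rapid[OF \<phi>]]]
        by (simp add: set_integrable_def)
      then show "integrable lborel (\<lambda>p. norm (indicator ({0..2*pi} \<times> UNIV) p *\<^sub>R (g p * \<phi> p)))"
        by (rule integrable_norm)
      show "integrable lborel (\<lambda>p. (M * S) * (indicator {0..2*pi} (fst p) * inverse (1 + (snd p)\<^sup>2)))"
        using integrable_cylinder_density by simp
      show "norm (indicator ({0..2*pi} \<times> UNIV) p *\<^sub>R (g p * \<phi> p))
        \<le> (M * S) * (indicator {0..2*pi} (fst p) * inverse (1 + (snd p)\<^sup>2))" for p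
      proof (cases p)
        case (Pair t x)
        have "norm (g p) * norm (\<phi> p) \<le> M * (S * inverse (1 + x\<^sup>2))"
          unfolding Pair by (intro mult_mono g \<phi>S M0) auto
        then show ?thesis by (auto simp: Pair indicator_def norm_mult mult.assoc)
      qed
    qed
    also have "\<dots> = M * J * S"
      by (simp add: J_def mult_ac)
    also have "\<dots> \<le> M * J * (\<Sum>\<alpha>\<le>2. \<Sum>\<beta>\<le>2. \<Sum>\<gamma>\<le>2. seminorm_S \<alpha> \<beta> \<gamma> \<phi>)"
    proof (rule mult_left_mono)
      have "S \<le> (\<Sum>\<gamma>\<le>2. seminorm_S 0 0 \<gamma> \<phi>)"
        unfolding S_def numeral_2_eq_2 using nn by (simp add: numeral_2_eq_2)
      also have "\<dots> \<le> (\<Sum>\<beta>\<le>2. \<Sum>\<gamma>\<le>2. seminorm_S 0 \<beta> \<gamma> \<phi>)"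
        by (rule member_le_sum[where f="\<lambda>\<beta>. \<Sum>\<gamma>\<le>2. seminorm_S 0 \<beta> \<gamma> \<phi>"]) (auto intro!: sum_nonneg nn)
      also have "\<dots> \<le> (\<Sum>\<alpha>\<le>2. \<Sum>\<beta>\<le>2. \<Sum>\<gamma>\<le>2. seminorm_S \<alpha> \<beta> \<gamma> \<phi>)"
        by (rule member_le_sum[where f="\<lambda>\<alpha>. \<Sum>\<beta>\<le>2. \<Sum>\<gamma>\<le>2. seminorm_S \<alpha> \<beta> \<gamma> \<phi>"]) (auto intro!: sum_nonneg nn)
      finally show "S \<le> (\<Sum>\<alpha>\<le>2. \<Sum>\<beta>\<le>2. \<Sum>\<gamma>\<le>2. seminorm_S \<alpha> \<beta> \<gamma> \<phi>)" .
    qed (use M0 J0 in simp)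
    finally show ?thesis by (simp add: fun_distr_eq_int2)
  qed
  then show "\<exists>C N. \<forall>\<phi>\<in>schwartz. norm (fun_distr g \<phi>)
      \<le> C * (\<Sum>\<alpha>\<le>N. \<Sum>\<beta>\<le>N. \<Sum>\<gamma>\<le>N. seminorm_S \<alpha> \<beta> \<gamma> \<phi>)"
    by blast
qed

lemma vd_eq_0:
  assumes "\<forall>\<^sub>F s in nhds t. f s = a"
  shows "vd f t = 0"
proof -
  obtain S where S: "open S" "t \<in> S" "\<And>s. s \<in> S \<Longrightarrow> f s = a"
    using assms unfolding eventually_nhds by blast
  have "((\<lambda>_. a) has_vector_derivative 0) (at t)" by simp
  then have "(f has_vector_derivative 0) (at t)"
    by (rule has_vector_derivative_transform_within_open[OF _ S(1,2)]) (simp add: S(3))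
  then show ?thesis by (simp add: vd_def vector_derivative_at)
qed

lemma schwartz_of_compact_support:
  assumes "smooth1 \<eta>" "\<And>x. \<bar>x\<bar> > R \<Longrightarrow> \<eta> x = 0"
  shows "(\<lambda>p. \<eta> (snd p)) \<in> schwartz"
proof -
  have rap: "rapid (\<lambda>p. \<eta> (snd p))" if \<eta>: "smooth1 \<eta>" "\<And>x. \<bar>x\<bar> > R \<Longrightarrow> \<eta> x = 0" for \<eta>
  proof (rule rapidI)
    show "continuous_on UNIV (\<lambda>p::real\<times>real. \<eta> (snd p))"
      by (rule continuous_on_compose2[OF smooth1_continuous[OF \<eta>(1)]]) (auto intro: continuous_intros)
    fix \<gamma>
    have "continuous_on {-R..R} (\<lambda>x. \<bar>x\<bar> ^ \<gamma> * norm (\<eta> x))"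
      by (intro continuous_intros continuous_on_subset[OF smooth1_continuous[OF \<eta>(1)]]) auto
    then have "bounded ((\<lambda>x. \<bar>x\<bar> ^ \<gamma> * norm (\<eta> x)) ` {-R..R})"
      by (intro compact_imp_bounded compact_continuous_image) auto
    then obtain K where K: "\<And>x. x \<in> {-R..R} \<Longrightarrow> norm (\<bar>x\<bar> ^ \<gamma> * norm (\<eta> x)) \<le> K"
      unfolding bounded_iff by blast
    have "\<bar>x\<bar> ^ \<gamma> * norm (\<eta> x) \<le> max K 0" for x
    proof (cases "\<bar>x\<bar> > R")
      case False
      then have "x \<in> {-R..R}" by auto
      from K[OF this] show ?thesis by (simp add: max_def)
    qed (simp add: \<eta>(2))
    then show "\<exists>K. \<forall>t x. \<bar>x\<bar> ^ \<gamma> * norm (\<eta> (snd (t :: real, x))) \<le> K"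
      unfolding snd_conv by blast
  qed (simp add: periodic_t_def)
  have "rapid_diff n (\<lambda>p. \<eta> (snd p))" if "smooth1 \<eta>" "\<And>x. \<bar>x\<bar> > R \<Longrightarrow> \<eta> x = 0" for n \<eta>
    using that
  proof (induction n arbitrary: \<eta>)
    case (Suc n)
    have vd0: "vd \<eta> x = 0" if "\<bar>x\<bar> > R" for x
    proof (rule vd_eq_0)
      have "open {y. R < \<bar>y\<bar>}" by (intro open_Collect_less continuous_intros)
      then show "\<forall>\<^sub>F s in nhds x. \<eta> s = 0"
        unfolding eventually_nhds using that Suc.prems(2) by blast
    qed
    show ?case
    proof (rule rapid_diff_SucI[where ft="\<lambda>_. 0" and fx="\<lambda>p. vd \<eta> (snd p)"])
      show "rapid_diff n (\<lambda>p. vd \<eta> (snd p))"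
        by (rule Suc.IH[OF smooth1_deriv(2)[OF Suc.prems(1)] vd0])
      have "rapid_diff n (\<lambda>p. 0 * vd \<eta> (snd p))"
        by (rule rapid_diff_cmult) fact
      then show "rapid_diff n (\<lambda>_. 0)" by simp
    qed (use rap[OF Suc.prems] smooth1_deriv(1)[OF Suc.prems(1)] in auto)
  qed (simp add: rap)
  with assms show ?thesis by (simp add: schwartz_iff)
qed

section \<open>Bumps on the circle and the fundamental lemma\<close>

lemma periodic_t_multiple:
  assumes "periodic_t w"
  shows "w (t + of_int k * (2 * pi), x) = w (t, x)"
  using periodic1_multiple[of "\<lambda>t. w (t, x)"] assms by (simp add: periodic_t_def)

text \<open>Cosine is decreasing on {0..pi}, so after this translation inequalities between cosines
  become inequalities between distances on the circle.\<close>

lemma cos_reduce: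
  fixes s :: real
  obtains k :: int where "\<bar>s + of_int k * (2 * pi)\<bar> \<le> pi" "cos \<bar>s + of_int k * (2 * pi)\<bar> = cos s"
proof -
  obtain k :: int where k: "- pi \<le> s + of_int k * (2 * pi)" "s + of_int k * (2 * pi) < - pi + 2 * pi"
    by (rule periodic_shift)
  have "cos \<bar>s + of_int k * (2 * pi)\<bar> = cos s"
    using periodic1_multiple[of cos s k] by (simp only: cos_abs_real cos_periodic)
  with k show ?thesis by (intro that[of k]) (auto simp: abs_le_iff)
qed

lemma smooth1_flat_cos: "smooth1 (\<lambda>t. flat 0 (a + b * cos (t - m)))"
proof (rule smooth1_compose_real[OF smooth1_flat])
  show "smooth1 (\<lambda>t. of_real (a + b * cos (t - m)))"
    using smooth1_add[OF smooth1_const smooth1_mult[OF smooth1_const smooth1_cos], of "of_real a" "of_real b" m]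
    by simp
qed

lemma flat_Re: "Re (flat k x) \<ge> 0" "x > 0 \<Longrightarrow> Re (flat k x) > 0" "Im (flat k x) = 0" "x \<le> 0 \<Longrightarrow> flat k x = 0"
  by (auto simp: flat_def)

text \<open>The test function is the conjugate value of \<open>w\<close> times a bump at the point; periodicity
  in \<open>t\<close> comes for free by taking the bump as a function of \<open>cos (t - t0)\<close>.\<close>

lemma fundamental_lemma_cylinder:
  assumes w: "periodic_t w" "continuous_on UNIV w" "\<And>p. norm (w p) \<le> M"
    and zero: "\<And>\<phi>. \<phi> \<in> schwartz \<Longrightarrow> int2 (\<lambda>p. w p * \<phi> p) = 0"
  shows "w p = 0"
proof (rule ccontr)
  assume "w p \<noteq> 0"
  obtain t x0 where p: "p = (t, x0)" by (cases p)
  obtain k :: int where k: "0 \<le> t + of_int k * (2 * pi)" "t + of_int k * (2 * pi) < 0 + 2 * pi"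
    by (rule periodic_shift)
  define t' where "t' = t + of_int k * (2 * pi)"
  have t': "0 \<le> t'" "t' < 2 * pi" "w (t', x0) \<noteq> 0"
    using k periodic_t_multiple[OF w(1)] \<open>w p \<noteq> 0\<close> by (simp_all add: t'_def p)
  have "open {t. w (t, x0) \<noteq> 0}"
    by (intro open_Collect_neq section_measurable(4)[OF w(2)] continuous_intros)
  then obtain e where e: "e > 0" "\<And>t. \<bar>t - t'\<bar> < e \<Longrightarrow> w (t, x0) \<noteq> 0"
    using t'(3) unfolding open_dist dist_real_def by blast
  \<comment> \<open>Moves the point off the boundary of {0..2 pi}, where the domain of integration
    would cut its neighbourhood in half.\<close>
  define t0 where "t0 = t' + min (e / 2) ((2 * pi - t') / 2)"
  have t0: "0 < t0" "t0 < 2 * pi"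
    using t' e(1) by (auto simp: t0_def min_def field_simps)
  have "\<bar>t0 - t'\<bar> < e" using t' e(1) by (auto simp: t0_def min_def)
  with e have w0: "w (t0, x0) \<noteq> 0" by blast
  define \<omega> where "\<omega> = cnj (w (t0, x0))"
  define h where "h = (\<lambda>p. Re (w p * \<omega>))"
  have h_cont: "continuous_on UNIV h"
    unfolding h_def by (intro continuous_intros w)
  have h0: "h (t0, x0) > 0"
    using w0 by (simp add: h_def \<omega>_def complex_mult_cnj complex_neq_0 power2_eq_square)
  have "open {p. h p > 0}"
    by (intro open_Collect_less continuous_intros h_cont)
  then obtain d where d: "d > 0" "\<And>p. dist p (t0, x0) < d \<Longrightarrow> h p > 0"
    using h0 unfolding open_dist by blast
  \<comment> \<open>d / 2 because both coordinates contribute to the distance; the bound 1 keeps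
    \<delta> below pi, where cosine is monotone.\<close>
  define \<delta> where "\<delta> = min (d / 2) 1"
  have \<delta>: "0 < \<delta>" "\<delta> \<le> pi" "\<delta> \<le> d / 2"
    using d(1) pi_gt3 by (auto simp: \<delta>_def)
  have near: "h (t, x) > 0" if "\<bar>t - t0\<bar> < \<delta>" "\<bar>x - x0\<bar> < \<delta>" for t x
  proof (rule d(2))
    have "dist (t, x) (t0, x0) \<le> \<bar>t - t0\<bar> + \<bar>x - x0\<bar>"
      using sqrt_sum_squares_le_sum_abs[of "t - t0" "x - x0"] by (simp add: dist_Pair_Pair dist_real_def)
    then show "dist (t, x) (t0, x0) < d" using that \<delta>(3) by linarith
  qed
  define \<beta> where "\<beta> t = flat 0 (- cos \<delta> + 1 * cos (t - t0))" for t
  define \<eta> where "\<eta> x = flat 0 (\<delta>\<^sup>2 - (x - x0)\<^sup>2)" for x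
  define \<phi> where "\<phi> = (\<lambda>p. \<omega> * (\<beta> (fst p) * \<eta> (snd p)))"
  have \<eta>: "smooth1 \<eta>"
    unfolding \<eta>_def
  proof (rule smooth1_compose_real[OF smooth1_flat])
    have "smooth1 (\<lambda>x. of_real (\<delta>\<^sup>2) - (of_real x - of_real x0) * (of_real x - of_real x0))"
      by (intro smooth1_diff smooth1_mult smooth1_const smooth1_of_real_id)
    then show "smooth1 (\<lambda>x. of_real (\<delta>\<^sup>2 - (x - x0)\<^sup>2))" by (simp add: power2_eq_square)
  qed
  have \<eta>0: "\<eta> x = 0" if "\<bar>x - x0\<bar> \<ge> \<delta>" for x
  proof -
    have "\<delta>\<^sup>2 \<le> (x - x0)\<^sup>2" using power_mono[OF that, of 2] \<delta>(1) by simp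
    then show ?thesis by (simp add: \<eta>_def flat_Re)
  qed
  have \<phi>: "\<phi> \<in> schwartz"
    unfolding \<phi>_def
  proof (intro schwartz_cmult schwartz_mult_t schwartz_of_compact_support[where R="\<bar>x0\<bar> + \<delta>"])
    show "smooth1 \<beta>" unfolding \<beta>_def by (rule smooth1_flat_cos)
    have "cos (t + 2 * pi - t0) = cos (t - t0)" for t
      using cos_periodic[of "t - t0"] by (simp add: algebra_simps)
    then show "periodic1 \<beta>" by (simp add: periodic1_def \<beta>_def)
  qed (use \<eta> \<eta>0 in auto)
  have pos: "Re (w (t, x) * \<phi> (t, x)) \<ge> 0" for t x
  \<comment> \<open>Elsewhere \<phi> vanishes; here a translate of t by periods lies within \<delta>
    of t0.\<close>
  proof (cases "cos (t - t0) > cos \<delta> \<and> \<bar>x - x0\<bar> < \<delta>")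
    case True
    obtain k :: int where "\<bar>t - t0 + of_int k * (2 * pi)\<bar> \<le> pi"
      "cos \<bar>t - t0 + of_int k * (2 * pi)\<bar> = cos (t - t0)"
      by (rule cos_reduce)
    then have "\<not> \<delta> \<le> \<bar>t - t0 + of_int k * (2 * pi)\<bar>"
      using cos_monotone_0_pi_le[of \<delta> "\<bar>t - t0 + of_int k * (2 * pi)\<bar>"] True \<delta> by linarith
    then have "h (t + of_int k * (2 * pi), x) > 0"
      using True by (intro near) (auto simp: algebra_simps)
    then have "Re (w (t, x) * \<omega>) \<ge> 0"
      by (simp only: h_def periodic_t_multiple[OF w(1)])
    moreover have "w (t, x) * \<phi> (t, x) = of_real (Re (\<beta> t) * Re (\<eta> x)) * (w (t, x) * \<omega>)"
      by (simp add: \<phi>_def complex_eq_iff \<beta>_def \<eta>_def flat_Re algebra_simps)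
    ultimately show ?thesis
      by (simp only: Re_complex_of_real Im_complex_of_real times_complex.sel(1)) (simp add: \<beta>_def \<eta>_def flat_Re)
  next
    case False
    then have "\<phi> (t, x) = 0" using \<eta>0[of x] by (auto simp: \<phi>_def \<beta>_def flat_Re)
    then show ?thesis by simp
  qed
  have pos': "Re (w (t, x) * \<phi> (t, x)) > 0" if "\<bar>t - t0\<bar> < \<delta>" "\<bar>x - x0\<bar> < \<delta>" for t x
  proof -
    have "cos \<delta> < cos \<bar>t - t0\<bar>" using that \<delta> by (intro cos_monotone_0_pi) auto
    then have "Re (\<beta> t) > 0" by (simp add: \<beta>_def flat_Re cos_abs_real)
    moreover have "(x - x0)\<^sup>2 < \<delta>\<^sup>2"
      using power_strict_mono[OF that(2), of 2] by simp
    then have "Re (\<eta> x) > 0" by (simp add: \<eta>_def flat_Re)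
    moreover have "Re (w (t, x) * \<phi> (t, x)) = Re (\<beta> t) * Re (\<eta> x) * h (t, x)"
      by (simp add: \<phi>_def h_def \<beta>_def \<eta>_def flat_Re algebra_simps)
    ultimately show ?thesis using near[OF that] by simp
  qed
  note r = rapid_temperate_mult[OF temperate_bounded[OF w] schwartz_imp_rapid[OF \<phi>]]
  define G where "G = (\<lambda>p. indicator ({0..2*pi} \<times> UNIV) p *\<^sub>R (w p * \<phi> p))"
  have G: "integrable lborel G"
    using int2_integrable[OF r] by (simp add: set_integrable_def G_def)
  have "(LINT p|lborel. Re (G p)) = Re (int2 (\<lambda>p. w p * \<phi> p))"
    using G by (simp add: int2_def set_lebesgue_integral_def G_def[symmetric] integral_Re)
  then have "(LINT p|lborel. Re (G p)) = 0" using zero[OF \<phi>] by simp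
  moreover have "integrable lborel (\<lambda>p. Re (G p))" using G by (rule integrable_Re)
  moreover have "AE p in lborel. 0 \<le> Re (G p)"
    using pos by (intro AE_I2) (auto simp: G_def indicator_def split: prod.splits)
  ultimately have AE0: "AE p in lborel. Re (G p) = 0"
    using integral_nonneg_eq_0_iff_AE by blast
  \<comment> \<open>A nonempty open box inside the domain of integration on which the integrand has
    positive real part; it would have to be a null set.\<close>
  define U where "U = {max 0 (t0 - \<delta>)<..<min (2 * pi) (t0 + \<delta>)} \<times> {x0 - \<delta><..<x0 + \<delta>}"
  have GU: "Re (G p) > 0" if "p \<in> U" for p
    using that pos'[of "fst p" "snd p"] by (auto simp: U_def G_def indicator_def abs_less_iff)
  from AE0 have "AE p in lborel. p \<notin> U"
    by eventually_elim (use GU in force)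
  then have "U \<in> null_sets lborel"
    by (subst (asm) AE_iff_null_sets[symmetric]) (auto simp: U_def intro!: borel_open open_Times)
  then have "negligible U"
    using null_sets_completionI negligible_iff_null_sets by blast
  moreover have "open U" by (simp add: U_def open_Times)
  moreover have "(t0, x0) \<in> U" using t0 \<delta>(1) by (simp add: U_def)
  ultimately show False using open_not_negligible by blast
qed

text \<open>The way both counterexamples are refuted: a bounded continuous u with L u = g in the
  weak sense is, as a distribution, a Schwartz function f, and the fundamental lemma applied to u -
  f makes the equality pointwise.\<close>

lemma schwartz_GH_imp_schwartz:
  assumes GH: "schwartz_GH c q"
    and u: "periodic_t u" "continuous_on UNIV u" "\<And>p. norm (u p) \<le> M"
    and g: "g \<in> schwartz" "\<And>\<phi>. \<phi> \<in> schwartz \<Longrightarrow> int2 (\<lambda>p. u p * L_transpose c q \<phi> p) = int2 (\<lambda>p. g p * \<phi> p)"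
  shows "u \<in> schwartz"
proof -
  have "\<exists>g\<in>schwartz. \<forall>\<phi>\<in>schwartz. fun_distr u (L_transpose c q \<phi>) = fun_distr g \<phi>"
    using g by (auto simp: fun_distr_eq_int2)
  with GH tempered_fun_distr[OF u]
  obtain f where f: "f \<in> schwartz" "\<And>\<phi>. \<phi> \<in> schwartz \<Longrightarrow> fun_distr u \<phi> = fun_distr f \<phi>"
    unfolding schwartz_GH_def by blast
  note fr = schwartz_imp_rapid[OF f(1)]
  obtain K where K: "\<And>t x. \<bar>x\<bar> ^ 0 * norm (f (t, x)) \<le> K"
    using rapid_bound[OF fr] by metis
  have "u p + (-1) * f p = 0" for p
  proof (rule fundamental_lemma_cylinder[where M="M + K"])
    show "periodic_t (\<lambda>p. u p + (-1) * f p)"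
      using u(1) rapidD(1)[OF fr] by (simp add: periodic_t_def)
    show "continuous_on UNIV (\<lambda>p. u p + (-1) * f p)"
      by (intro continuous_intros u rapidD(2)[OF fr])
    show "norm (u p + (-1) * f p) \<le> M + K" for p
      using norm_triangle_ineq4[of "u p" "f p"] u(3)[of p] K[where t="fst p" and x="snd p"] by simp
    show "int2 (\<lambda>p. (u p + (-1) * f p) * \<phi> p) = 0" if "\<phi> \<in> schwartz" for \<phi>
    proof -
      note \<phi>r = schwartz_imp_rapid[OF that]
      have "int2 (\<lambda>p. u p * \<phi> p + (-1) * (f p * \<phi> p)) = int2 (\<lambda>p. u p * \<phi> p) + int2 (\<lambda>p. (-1) * (f p * \<phi> p))"
        by (intro int2_add rapid_temperate_mult[OF temperate_bounded[OF u]] \<phi>r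
            rapid_temperate_mult[OF temperate_diff_imp_temperate[OF temperate_diff_const]]
            rapid_temperate_mult[OF rapid_imp_temperate[OF fr]])
      also have "\<dots> = 0"
        using f(2)[OF that] by (simp only: fun_distr_eq_int2 int2_cmult) simp
      finally show ?thesis by (simp add: algebra_simps)
    qed
  qed
  then have "u = f" by auto
  with f(1) show ?thesis by simp
qed

section \<open>Resonant frequencies\<close>

lemma not_schwartz_GH_resonant:
  assumes c: "smooth1 c" "periodic1 c" and q: "smooth1 q" "periodic1 q"
    and Z: "(k, \<xi>) \<in> Z_L0 c q"
  shows "\<not> schwartz_GH c q"
proof
  assume GH: "schwartz_GH c q"
  obtain C where C: "\<And>t. (C has_vector_derivative c t) (at t)"
    using antiderivative_exists smooth1_continuous c(1) by metis
  obtain Q where Q: "\<And>t. (Q has_vector_derivative q t) (at t)"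
    using antiderivative_exists smooth1_continuous q(1) by metis
  define a where "a t = exp (- (\<i> * of_real \<xi> * C t + Q t))" for t
  have a': "(a has_vector_derivative - (\<i> * of_real \<xi> * c t + q t) * a t) (at t)" for t
  proof -
    have "((\<lambda>t. - (\<i> * of_real \<xi> * C t + Q t)) has_vector_derivative - (\<i> * of_real \<xi> * c t + q t)) (at t)"
      by (intro has_vector_derivative_minus has_vector_derivative_add has_vector_derivative_mult_right C Q)
    from field_vector_diff_chain_at[OF this DERIV_exp] show ?thesis
      unfolding a_def[abs_def] by (simp add: o_def)
  qed
  have a_smooth: "smooth1 a"
    unfolding a_def[abs_def]
    by (intro smooth1_exp smooth1_minus smooth1_add smooth1_mult smooth1_const smooth1I[OF C c(1)] smooth1I[OF Q q(1)])
  \<comment> \<open>This is where resonance enters: over one period \<open>a\<close> is multiplied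
    by exp (- 2 pi (i \<xi> c0 + q0)), and the equation for (k, \<xi>) makes the exponent 2 pi i
    k.\<close>
  have a_per: "periodic1 a"
  proof -
    have "a (t + 2 * pi) = a t" for t
    proof -
      have "\<i> * (mean_T c * of_real \<xi> - \<i> * mean_T q) = \<i> * (- of_int k)"
      proof -
        have "of_int k + (mean_T c * of_real \<xi> - \<i> * mean_T q) = 0"
          using Z by (simp add: Z_L0_def add_diff_eq)
        then show ?thesis by (metis add_eq_0_iff)
      qed
      then have sum: "\<i> * of_real \<xi> * mean_T c + mean_T q = - \<i> * of_int k"
        by (simp add: algebra_simps)
      have w: "- (of_real (2 * pi) * (\<i> * of_real \<xi> * mean_T c + mean_T q)) = of_int (2 * k) * of_real pi * \<i>"
        unfolding sum by simp
      have e: "exp (- (of_real (2 * pi) * (\<i> * of_real \<xi> * mean_T c + mean_T q))) = 1"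
        unfolding w exp_eq_1 by (intro conjI exI[of _ k]) simp_all
      have "C (t + 2 * pi) = C t + of_real (2 * pi) * mean_T c" "Q (t + 2 * pi) = Q t + of_real (2 * pi) * mean_T q"
        using antiderivative_shift[OF C c(2), of t] antiderivative_shift[OF Q q(2), of t] by (simp_all add: algebra_simps)
      then have "a (t + 2 * pi) = exp (- (\<i> * of_real \<xi> * C t + Q t) + - (of_real (2 * pi) * (\<i> * of_real \<xi> * mean_T c + mean_T q)))"
        by (simp only: a_def) (simp add: algebra_simps)
      then show ?thesis by (simp only: exp_add e a_def mult_1_right)
    qed
    then show ?thesis by (simp add: periodic1_def)
  qed
  define e where "e = (\<lambda>p::real\<times>real. 1 * iexp (\<xi> * snd p))"
  define u where "u = (\<lambda>p. a (fst p) * e p)"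
  have T: "temperate_diff n (\<lambda>p. a (fst p))" "temperate_diff n e" for n
    unfolding e_def by (intro temperate_diff_t a_smooth a_per, rule temperate_diff_wave)
  have ex: "((\<lambda>y. e (t, y)) has_vector_derivative \<i> * of_real \<xi> * e (t, x)) (at x)" for t x
    using has_vector_derivative_iexp[of \<xi> x] by (simp add: e_def)
  obtain M where M: "\<And>t. norm (a t) \<le> M"
    by (rule periodic_bounded[of a])
      (use a_per smooth1_continuous[OF a_smooth] that in \<open>auto simp: periodic1_def\<close>)
  have "u \<in> schwartz"
  proof (rule schwartz_GH_imp_schwartz[OF GH])
    show "periodic_t u" using a_per by (simp add: periodic_t_def periodic1_def u_def e_def)
    show "continuous_on UNIV u"
      unfolding u_def e_def
      by (intro continuous_intros continuous_on_compose2[OF smooth1_continuous[OF a_smooth]]) auto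
    show "norm (u p) \<le> M" for p
      using M by (simp add: u_def e_def norm_mult)
    show z: "(\<lambda>_. 0) \<in> schwartz"
      using schwartz_of_compact_support[OF smooth1_const, of 0 0] by simp
    fix \<phi> assume \<phi>: "\<phi> \<in> schwartz"
    \<comment> \<open>u does not decay, so \<open>integration_by_parts\<close> cannot be applied to
      it; the product h = u \<phi> does decay, and since L u = 0 the integrand is minus the
      t-derivative of h minus c times its x-derivative.\<close>
    define h where "h = (\<lambda>p. a (fst p) * (e p * \<phi> p))"
    have h: "rapid_diff 1 h"
      unfolding h_def by (intro rapid_diff_temperate_mult T schwartz_imp_rapid_diff \<phi>)
    note h' = h[unfolded One_nat_def]
    have ht: "pdt h (t, x) = a t * (e (t, x) * pdt \<phi> (t, x)) - (\<i> * of_real \<xi> * c t + q t) * a t * (e (t, x) * \<phi> (t, x))" for t x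
    proof -
      have "e (s, x) = e (t, x)" for s by (simp add: e_def)
      then have "h (s, x) = a s * (e (t, x) * \<phi> (s, x))" for s by (simp add: h_def)
      then have "((\<lambda>s. a s * (e (t, x) * \<phi> (s, x))) has_vector_derivative pdt h (t, x)) (at t)"
        using rapid_diff_SucD(1)[OF h', where x=x and t=t] by simp
      from vector_derivative_unique_at[OF this has_vector_derivative_mult[OF a'
            has_vector_derivative_mult_right[OF schwartz_derivs(1)[OF \<phi>]]]]
      show ?thesis by (simp add: algebra_simps)
    qed
    have hx: "pdx h (t, x) = a t * (e (t, x) * pdx \<phi> (t, x) + \<i> * of_real \<xi> * e (t, x) * \<phi> (t, x))" for t x
    proof -
      have "((\<lambda>y. a t * (e (t, y) * \<phi> (t, y))) has_vector_derivative pdx h (t, x)) (at x)"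
        using rapid_diff_SucD(2)[OF h', where x=x and t=t] by (simp only: h_def fst_conv)
      then show ?thesis
        by (rule vector_derivative_unique_at)
          (rule has_vector_derivative_mult_right[OF has_vector_derivative_mult[OF ex schwartz_derivs(2)[OF \<phi>]]])
    qed
    have "u p * L_transpose c q \<phi> p = (-1) * (pdt h p + c (fst p) * pdx h p)" for p
      by (cases p) (simp add: L_transpose_def u_def ht hx algebra_simps)
    then have "int2 (\<lambda>p. u p * L_transpose c q \<phi> p) = (-1) * (int2 (pdt h) + int2 (\<lambda>p. c (fst p) * pdx h p))"
      using rapid_diff_SucD(3,4)[OF h'] temperate_diff_imp_temperate[OF temperate_diff_t[OF c]]
      by (simp only: int2_cmult int2_add rapid_temperate_mult rapid_diff.simps)
    also have "\<dots> = 0"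
      using int2_pdt[OF h] int2_pdx[OF h temperate_diff_imp_temperate[OF temperate_diff_t[OF c]]] by simp
    finally show "int2 (\<lambda>p. u p * L_transpose c q \<phi> p) = int2 (\<lambda>p. 0 * \<phi> p)"
      using int2_cmult[of 0 \<phi>] by simp
  qed
  then obtain K where K: "\<And>t x. \<bar>x\<bar> ^ 1 * norm (u (t, x)) \<le> K"
    using rapid_bound[OF schwartz_imp_rapid] by metis
  have "\<bar>x\<bar> * norm (a 0) \<le> K" for x
    using K[of x 0] by (simp add: u_def e_def norm_mult)
  \<comment> \<open>At this x the left-hand side of the decay estimate is \<bar>K\<bar> + 1.\<close>
  from this[of "(\<bar>K\<bar> + 1) / norm (a 0)"] show False by (simp add: a_def)
qed

section \<open>Change of sign\<close>

text \<open>The square root is taken with its cut in the lower half-plane, so that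
  \<open>z\<^sup>n (- i z)\<^sup>1\<^sup>/\<^sup>2 exp (- z\<^sup>2)\<close> is holomorphic on the upper half-plane, but for \<open>n = 1\<close> it is not
  twice differentiable along the reals at the origin.\<close>

definition wave :: "int \<Rightarrow> complex \<Rightarrow> complex" where
  "wave n z = z powi n * csqrt (- \<i> * z) * exp (- z\<^sup>2)"

text \<open>Up to a constant, \<open>wave n z\<close> is z^(n + 1/2) exp (- z^2), so differentiation
  stays in the family and shifts n by one. Repeated differentiation makes n negative, which is why n
  is an integer.\<close>

definition wave' :: "int \<Rightarrow> complex \<Rightarrow> complex" where
  "wave' n z = (of_int n + 1 / 2) * wave (n - 1) z + (- 2) * wave (n + 1) z"

text \<open>Re (- i z) = Im z: the closed upper half-plane is turned into the closed right
  half-plane, which meets the cut of the root only at 0.\<close>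

lemma csqrt_upper_nonpos: "Im z \<ge> 0 \<Longrightarrow> z \<noteq> 0 \<Longrightarrow> - \<i> * z \<notin> \<real>\<^sub>\<le>\<^sub>0"
  by (auto simp: complex_nonpos_Reals_iff complex_eq_iff)

lemma isCont_csqrt_upper:
  assumes "Im z \<ge> 0"
  shows "isCont (\<lambda>z. csqrt (- \<i> * z)) z"
proof (cases "z = 0")
  case True
  have "((\<lambda>z::complex. sqrt (norm z)) \<longlongrightarrow> sqrt (norm (0::complex))) (at 0)"
    by (intro tendsto_intros)
  then have "((\<lambda>z. norm (csqrt (- \<i> * z))) \<longlongrightarrow> 0) (at 0)"
    by (simp add: norm_mult)
  then show ?thesis
    using True tendsto_norm_zero_cancel by (fastforce simp: isCont_def)
next
  case False
  with assms have "- \<i> * z \<notin> \<real>\<^sub>\<le>\<^sub>0" by (rule csqrt_upper_nonpos)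
  then show ?thesis
    by (intro isCont_o2[OF _ continuous_at_csqrt] continuous_intros) auto
qed

lemma wave_0: "wave n 0 = 0"
  by (simp add: wave_def)

lemma isCont_wave:
  assumes "Im z \<ge> 0" "z \<noteq> 0 \<or> n \<ge> 0"
  shows "isCont (wave n) z"
proof -
  have "isCont (\<lambda>z::complex. z powi n) z"
  proof (cases "n \<ge> 0")
    case True
    then have "(\<lambda>z::complex. z powi n) = (\<lambda>z. z ^ nat n)"
      by (simp add: power_int_def)
    then show ?thesis by simp
  next
    case False
    with assms show ?thesis by (intro continuous_intros) auto
  qed
  moreover have "isCont (\<lambda>z::complex. exp (- z\<^sup>2)) z" by (intro continuous_intros)
  ultimately show ?thesis
    unfolding wave_def[abs_def] by (intro isCont_mult isCont_csqrt_upper[OF assms(1)])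
qed

text \<open>Away from 0 the cut is avoided even at real points, so a full complex derivative exists
  there. At 0 the difference quotient is \<open>wave (n - 1)\<close>, which tends to 0 exactly
  because n is at least 1.\<close>

lemma wave_deriv:
  assumes "Im z \<ge> 0" "z \<noteq> 0 \<or> n \<ge> 1"
  shows "(wave n has_field_derivative wave' n z) (at z)"
proof (cases "z = 0")
  case True
  with assms have n: "n \<ge> 1" by simp
  have "wave n w / w = wave (n - 1) w" if "w \<noteq> 0" for w
    using that by (simp add: wave_def power_int_diff)
  moreover have "(wave (n - 1) \<longlongrightarrow> 0) (at 0)"
    using isCont_wave[of 0 "n - 1"] n by (simp add: isCont_def wave_0)
  ultimately have "((\<lambda>w. wave n w / w) \<longlongrightarrow> 0) (at 0)"
    by (subst tendsto_cong[where g="wave (n - 1)"]) (auto simp: eventually_at_filter)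
  then show ?thesis
    using True by (simp add: has_field_derivative_iff wave'_def wave_0)
next
  case False
  with assms(1) have nonpos: "- \<i> * z \<notin> \<real>\<^sub>\<le>\<^sub>0" by (rule csqrt_upper_nonpos)
  define w where "w = csqrt (- \<i> * z)"
  have w: "w \<noteq> 0" "w * w = - \<i> * z"
    using False by (simp_all add: w_def flip: power2_eq_square)
  \<comment> \<open>Because w * w = - i z, the derivative of the root is the root itself divided by
    2 z; this produces the 1 / 2 in \<open>wave'\<close>.\<close>
  have dq: "((\<lambda>z. csqrt (- \<i> * z)) has_field_derivative w / (2 * z)) (at z)"
  proof -
    have m: "((*) (- \<i>) has_field_derivative - \<i>) (at z)"
      by (auto intro!: derivative_eq_intros)
    have "((\<lambda>z. csqrt (- \<i> * z)) has_field_derivative inverse (2 * w) * (- \<i>)) (at z)"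
      using DERIV_chain2[OF has_field_derivative_csqrt[OF nonpos] m] by (simp add: w_def)
    moreover have "inverse (2 * w) * (- \<i>) = w / (2 * z)"
      using w False by (simp add: field_simps)
    ultimately show ?thesis by simp
  qed
  have dp: "((\<lambda>z. z powi n) has_field_derivative of_int n * z powi (n - 1)) (at z)"
    by (rule DERIV_cong[OF DERIV_power_int[OF DERIV_ident]]) (use False in simp_all)
  have de: "((\<lambda>z. exp (- z\<^sup>2)) has_field_derivative - (2 * z) * exp (- z\<^sup>2)) (at z)"
    by (auto intro!: derivative_eq_intros)
  have wd: "csqrt (- (\<i> * z)) = w" by (simp add: w_def)
  have p1: "z powi n = z powi (n - 1) * z" and p2: "z powi (n + 1) = z powi (n - 1) * z * z"
    using False by (simp_all add: power_int_diff power_int_add)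
  show ?thesis
    unfolding wave_def[abs_def]
    by (rule DERIV_cong[OF DERIV_mult[OF DERIV_mult[OF dp dq] de]])
      (use False in \<open>simp add: wave'_def wave_def p1 p2 wd\<close>, simp add: field_simps)
qed

lemma wave_0_square: "(wave 0 z)\<^sup>2 = - \<i> * z * exp (- (2 * z\<^sup>2))"
  by (simp add: wave_def power_mult_distrib flip: exp_double)

lemma power_mult_exp_minus_le:
  fixes y :: real
  assumes "y \<ge> 0"
  shows "y ^ k * exp (- y) \<le> fact k"
proof -
  have "(\<Sum>n\<in>{k}. y ^ n /\<^sub>R fact n) \<le> (\<Sum>n. y ^ n /\<^sub>R fact n)"
    using assms by (intro sum_le_suminf summable_exp_generic) auto
  then have "y ^ k / fact k \<le> exp y"
    by (simp add: exp_def divide_inverse mult.commute)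
  then show ?thesis
    by (simp add: exp_minus field_simps)
qed

text \<open>On a horizontal strip exp (- z^2) decays like a Gaussian in Re z and beats every power;
  for e > 0 negative powers of z are bounded by powers of 1 / e. Here x is the space variable, from
  which the real part of the phase differs by a bounded amount.\<close>

lemma wave_bound:
  assumes "e > 0 \<or> n \<ge> 0" "M \<ge> 0" "R \<ge> 0"
  obtains K where "\<And>z x. e \<le> Im z \<Longrightarrow> 0 \<le> Im z \<Longrightarrow> Im z \<le> M \<Longrightarrow> \<bar>Re z - x\<bar> \<le> R \<Longrightarrow> \<bar>x\<bar> ^ \<gamma> * norm (wave n z) \<le> K"
proof -
  define N where "N = nat \<bar>n\<bar>"
  define A where "A = (if e > 0 then (1 / e) ^ N else 0)"
  define c where "c = R + M + 1"
  \<comment> \<open>The exponents of y collected below: \<gamma> from x, N from the power of z, 1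
    from the root.\<close>
  define k where "k = \<gamma> + (N + 1)"
  have A0: "A \<ge> 0" by (simp add: A_def)
  have "\<bar>x\<bar> ^ \<gamma> * norm (wave n z) \<le> (A + 1) * exp (M\<^sup>2) * exp (c + 1) * fact k"
    if z: "e \<le> Im z" "0 \<le> Im z" "Im z \<le> M" "\<bar>Re z - x\<bar> \<le> R" for z x
  proof -
    \<comment> \<open>One quantity that dominates norm z, \<bar>x\<bar> and 1, so all polynomial
      factors become powers of y.\<close>
    define y where "y = \<bar>Re z\<bar> + c"
    have y1: "y \<ge> 1" using assms by (simp add: y_def c_def)
    have nz: "norm z \<le> y"
      using cmod_le[of z] z assms by (simp add: y_def c_def)
    have x: "\<bar>x\<bar> \<le> y" using z assms by (simp add: y_def c_def)
    have powi: "norm (z powi n) \<le> (A + 1) * y ^ N"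
    proof (cases "n \<ge> 0")
      case True
      then have "norm (z powi n) = norm z ^ N"
        by (simp add: power_int_def N_def norm_power)
      also have "\<dots> \<le> 1 * y ^ N" by (simp add: power_mono nz)
      also have "\<dots> \<le> (A + 1) * y ^ N" using A0 y1 by (intro mult_right_mono) auto
      finally show ?thesis .
    next
      case False
      with assms(1) have e: "e > 0" by simp
      have "e \<le> norm z" using z abs_Im_le_cmod[of z] by simp
      then have "inverse (norm z) \<le> 1 / e" using e by (simp add: divide_inverse le_imp_inverse_le)
      moreover have "norm (z powi n) = inverse (norm z) ^ N"
        using False by (simp add: power_int_def N_def norm_power norm_inverse)
      ultimately have "norm (z powi n) \<le> A * 1"
        using e by (simp add: A_def power_mono)
      also have "\<dots> \<le> (A + 1) * y ^ N"
        using A0 y1 by (intro mult_mono) auto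
      finally show ?thesis .
    qed
    have sq: "norm (csqrt (- \<i> * z)) \<le> y"
    proof -
      have "y * 1 \<le> y * y" using y1 by (intro mult_left_mono) auto
      then have "sqrt (norm z) \<le> sqrt (y * y)" using nz by (intro real_sqrt_le_mono) linarith
      then show ?thesis using y1 by (simp add: norm_mult)
    qed
    have ex: "norm (exp (- z\<^sup>2)) \<le> exp (M\<^sup>2) * (exp (c + 1) * exp (- y))"
    proof -
      \<comment> \<open>Trades the Gaussian for exp (- y), up to a constant, so that
        \<open>power_mult_exp_minus_le\<close> applies.\<close>
      have "(\<bar>Re z\<bar> - 1)\<^sup>2 \<ge> 0" by simp
      then have "2 * \<bar>Re z\<bar> \<le> (Re z)\<^sup>2 + 1" by (simp add: power2_diff)
      then have "\<bar>Re z\<bar> \<le> (Re z)\<^sup>2 + 1" by linarith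
      moreover have "(Im z)\<^sup>2 \<le> M\<^sup>2" using z by (intro power_mono) auto
      ultimately have "(Im z)\<^sup>2 - (Re z)\<^sup>2 \<le> M\<^sup>2 + (c + 1 + - y)" by (simp add: y_def)
      then show ?thesis by (simp add: Re_power2 flip: exp_add)
    qed
    have "\<bar>x\<bar> ^ \<gamma> * norm (wave n z) = \<bar>x\<bar> ^ \<gamma> * ((norm (z powi n) * norm (csqrt (- \<i> * z))) * norm (exp (- z\<^sup>2)))"
      by (simp only: wave_def norm_mult)
    also have "\<dots> \<le> y ^ \<gamma> * ((((A + 1) * y ^ N) * y) * (exp (M\<^sup>2) * (exp (c + 1) * exp (- y))))"
      using y1 A0 by (intro mult_mono power_mono x powi sq ex) auto
    also have "\<dots> = (A + 1) * exp (M\<^sup>2) * exp (c + 1) * (y ^ k * exp (- y))"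
      by (simp add: k_def power_add)
    also have "\<dots> \<le> (A + 1) * exp (M\<^sup>2) * exp (c + 1) * fact k"
      using A0 y1 by (intro mult_left_mono power_mult_exp_minus_le) auto
    finally show ?thesis .
  qed
  then show ?thesis by (rule that)
qed

section \<open>Wave packets\<close>

locale wave_packet =
  fixes P d :: "real \<Rightarrow> complex" and z0 :: complex
  assumes P: "\<And>t. (P has_vector_derivative d t) (at t)" "periodic1 P"
    and d: "smooth1 d" "periodic1 d"
begin

text \<open>A characteristic coordinate: functions of x - P t are annihilated by the operator d/dt +
  d(t) d/dx, so on a packet that operator acts on the amplitude alone. The constant z0 decides where
  the phase reaches the singular point 0.\<close>

definition phase :: "real \<Rightarrow> real \<Rightarrow> complex" where
  "phase t x = of_real x - P t + z0"

definition packet :: "(real \<Rightarrow> complex) \<Rightarrow> int \<Rightarrow> real \<times> real \<Rightarrow> complex" where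
  "packet a n = (\<lambda>p. a (fst p) * wave n (phase (fst p) (snd p)))"

definition height :: "real \<Rightarrow> real" where
  "height t = Im z0 - Im (P t)"

lemma Im_phase: "Im (phase t x) = height t"
  by (simp add: phase_def height_def)

lemma P_cont: "continuous_on UNIV P"
  by (auto intro!: continuous_at_imp_continuous_on has_vector_derivative_continuous P)

lemma P_bound: obtains M where "M \<ge> 0" "\<And>t. norm (P t) \<le> M"
proof -
  have "P (t + 2 * pi) = P t" for t using P(2) by (simp add: periodic1_def)
  from this P_cont show ?thesis by (rule periodic_bounded) (rule that)
qed

text \<open>Amplitudes that live where the phase has height at least e. For e > 0 the phase avoids
  the singularity and every n is allowed; e = 0 lets it touch the real axis. Vanishing is required
  on a neighbourhood, which makes the condition stable under \<open>vd\<close>.\<close>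

definition above :: "real \<Rightarrow> (real \<Rightarrow> complex) \<Rightarrow> bool" where
  "above e a \<longleftrightarrow> smooth1 a \<and> periodic1 a \<and> (\<forall>t. e \<le> height t \<or> (\<forall>\<^sub>F s in nhds t. a s = 0))"

lemma above_vd: "above e a \<Longrightarrow> above e (vd a)"
proof -
  assume a: "above e a"
  have "\<forall>\<^sub>F s in nhds t. vd a s = 0" if "\<forall>\<^sub>F s in nhds t. a s = 0" for t
  proof -
    have "\<forall>\<^sub>F s in nhds t. \<forall>\<^sub>F r in nhds s. a r = 0"
      using that by (simp add: eventually_eventually)
    then show ?thesis by (rule eventually_mono) (rule vd_eq_0)
  qed
  with a show ?thesis
    unfolding above_def using smooth1_deriv(2) periodic1_vd by blast
qed

lemma above_mult:
  assumes "above e a" "smooth1 b" "periodic1 b"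
  shows "above e (\<lambda>t. a t * b t)"
proof -
  have "\<forall>\<^sub>F s in nhds t. a s * b s = 0" if "\<forall>\<^sub>F s in nhds t. a s = 0" for t
    using that by (rule eventually_mono) simp
  with assms show ?thesis
    unfolding above_def periodic1_def by (metis smooth1_mult)
qed

lemma packet_rapid:
  assumes a: "above e a" and e: "e \<ge> 0" "e > 0 \<or> n \<ge> 0"
  shows "rapid (packet a n)"
proof (rule rapidI)
  show "periodic_t (packet a n)"
    using a P(2) by (simp add: periodic_t_def packet_def phase_def above_def periodic1_def)
  show "continuous_on UNIV (packet a n)"
  proof (rule continuous_at_imp_continuous_on, rule ballI)
    fix p :: "real \<times> real"
    obtain t x where p: "p = (t, x)" by (cases p)
    have "continuous_on UNIV (\<lambda>p::real\<times>real. a (fst p))"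
      using a by (intro continuous_on_compose2[OF smooth1_continuous[of a]] continuous_intros) (auto simp: above_def)
    then have ca: "isCont (\<lambda>p. a (fst p)) p"
      by (simp only: continuous_on_eq_continuous_at[OF open_UNIV]) blast
    have "continuous_on UNIV (\<lambda>p. phase (fst p) (snd p))"
      unfolding phase_def by (intro continuous_intros continuous_on_compose2[OF P_cont]) auto
    then have cz: "isCont (\<lambda>p. phase (fst p) (snd p)) p"
      by (simp only: continuous_on_eq_continuous_at[OF open_UNIV]) blast
    consider "e \<le> height t" | "\<forall>\<^sub>F s in nhds t. a s = 0"
      using a unfolding above_def by blast
    then show "isCont (packet a n) p"
    proof cases
      case 1
      have "isCont (wave n) (phase (fst p) (snd p))"
      proof (rule isCont_wave)
        show "0 \<le> Im (phase (fst p) (snd p))" using 1 e by (simp add: p Im_phase)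
        have "phase t x \<noteq> 0" if "e > 0" using that 1 Im_phase[of t x] by auto
        then show "phase (fst p) (snd p) \<noteq> 0 \<or> 0 \<le> n" using e by (auto simp: p)
      qed
      then show ?thesis
        unfolding packet_def by (intro continuous_intros ca isCont_o2[OF cz])
    next
      case 2
      have "filterlim fst (nhds t) (nhds p)"
        using tendsto_fst[OF filterlim_ident, of p] by (simp add: p)
      with 2 have "\<forall>\<^sub>F p in nhds p. a (fst p) = 0"
        by (rule eventually_compose_filterlim)
      then have "\<forall>\<^sub>F p in nhds p. packet a n p = 0"
        by (auto simp: packet_def elim: eventually_mono)
      moreover have "isCont (\<lambda>_. 0 :: complex) p" by simp
      ultimately show ?thesis using isCont_cong[of "packet a n" "\<lambda>_. 0" p] by simp
    qed
  qed
  fix \<gamma>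
  obtain R where R: "R \<ge> 0" "\<And>t. norm (P t) \<le> R" by (rule P_bound) (rule that)
  obtain A where A: "A \<ge> 0" "\<And>t. norm (a t) \<le> A"
  proof -
    have "a (t + 2 * pi) = a t" for t using a by (simp add: above_def periodic1_def)
    moreover have "continuous_on UNIV a" using a smooth1_continuous by (simp add: above_def)
    ultimately show ?thesis by (rule periodic_bounded) (rule that)
  qed
  obtain K where K: "\<And>z x. e \<le> Im z \<Longrightarrow> 0 \<le> Im z \<Longrightarrow> Im z \<le> norm z0 + R \<Longrightarrow> \<bar>Re z - x\<bar> \<le> norm z0 + R
      \<Longrightarrow> \<bar>x\<bar> ^ \<gamma> * norm (wave n z) \<le> K"
    by (rule wave_bound[OF e(2), of "norm z0 + R" "norm z0 + R"]) (use R that in auto)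
  have "\<bar>x\<bar> ^ \<gamma> * norm (packet a n (t, x)) \<le> A * \<bar>K\<bar>" for t x
  proof (cases "e \<le> height t")
    case True
    have "\<bar>x\<bar> ^ \<gamma> * norm (wave n (phase t x)) \<le> K"
    proof (rule K)
      show "e \<le> Im (phase t x)" "0 \<le> Im (phase t x)" using True e by (auto simp: Im_phase)
      have "norm (z0 - P t) \<le> norm z0 + R"
        using norm_triangle_ineq4[of z0 "P t"] R(2)[of t] by linarith
      then show "Im (phase t x) \<le> norm z0 + R" "\<bar>Re (phase t x) - x\<bar> \<le> norm z0 + R"
        using abs_Im_le_cmod[of "z0 - P t"] abs_Re_le_cmod[of "z0 - P t"] by (simp_all add: phase_def)
    qed
    then have "norm (a t) * (\<bar>x\<bar> ^ \<gamma> * norm (wave n (phase t x))) \<le> A * \<bar>K\<bar>"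
      by (intro mult_mono A) auto
    then show ?thesis by (simp add: packet_def norm_mult mult_ac)
  next
    case False
    then have "\<forall>\<^sub>F s in nhds t. a s = 0" using a unfolding above_def by blast
    then have "a t = 0" by (rule eventually_nhds_x_imp_x)
    then show ?thesis using A by (simp add: packet_def)
  qed
  then show "\<exists>K. \<forall>t x. \<bar>x\<bar> ^ \<gamma> * norm (packet a n (t, x)) \<le> K" by blast
qed

text \<open>Where the height drops below e, the amplitude vanishes near t and both formulas read 0 =
  0, whatever \<open>wave\<close> does below the real axis.\<close>

lemma packet_derivs:
  assumes a: "above e a" and e: "e \<ge> 0" "e > 0 \<or> n \<ge> 1"
  shows "((\<lambda>s. packet a n (s, x)) has_vector_derivative
      packet (vd a) n (t, x) + (-1) * (d t * (a t * wave' n (phase t x)))) (at t)"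
    and "((\<lambda>y. packet a n (t, y)) has_vector_derivative a t * wave' n (phase t x)) (at x)"
proof -
  have a': "(a has_vector_derivative vd a t) (at t)"
    using a smooth1_deriv(1) by (simp add: above_def)
  have zt: "((\<lambda>s. phase s x) has_vector_derivative - d t) (at t)"
    unfolding phase_def using P(1)[of t] by (auto intro!: derivative_eq_intros)
  have zx: "((\<lambda>y. phase t y) has_vector_derivative 1) (at x)"
    unfolding phase_def by (auto intro!: derivative_eq_intros)
  consider "e \<le> height t" | "\<forall>\<^sub>F s in nhds t. a s = 0"
    using a unfolding above_def by blast
  then have "((\<lambda>s. packet a n (s, x)) has_vector_derivative
      packet (vd a) n (t, x) + (-1) * (d t * (a t * wave' n (phase t x)))) (at t) \<and>
    ((\<lambda>y. packet a n (t, y)) has_vector_derivative a t * wave' n (phase t x)) (at x)"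
  proof cases
    case 1
    have w: "(wave n has_field_derivative wave' n (phase t x)) (at (phase t x))"
    proof (rule wave_deriv)
      show "0 \<le> Im (phase t x)" using 1 e by (simp add: Im_phase)
      have "phase t x \<noteq> 0" if "e > 0" using that 1 Im_phase[of t x] by auto
      then show "phase t x \<noteq> 0 \<or> 1 \<le> n" using e by auto
    qed
    have wt: "((\<lambda>s. wave n (phase s x)) has_vector_derivative - d t * wave' n (phase t x)) (at t)"
      using field_vector_diff_chain_at[OF zt w] by (simp add: o_def)
    have wx: "((\<lambda>y. wave n (phase t y)) has_vector_derivative wave' n (phase t x)) (at x)"
      using field_vector_diff_chain_at[OF zx w] by (simp add: o_def)
    show ?thesis
      using has_vector_derivative_mult[OF a' wt] has_vector_derivative_mult_right[OF wx, of "a t"]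
      by (simp add: packet_def algebra_simps)
  next
    case 2
    then have a0: "a t = 0" by (rule eventually_nhds_x_imp_x)
    have vd0: "vd a t = 0" by (rule vd_eq_0[OF 2])
    obtain S where S: "open S" "t \<in> S" "\<And>s. s \<in> S \<Longrightarrow> a s = 0"
      using 2 unfolding eventually_nhds by blast
    have "((\<lambda>_. 0::complex) has_vector_derivative 0) (at t)" by simp
    then have "((\<lambda>s. packet a n (s, x)) has_vector_derivative 0) (at t)"
      by (rule has_vector_derivative_transform_within_open[OF _ S(1,2)]) (simp add: packet_def S(3))
    then show ?thesis by (simp add: a0 vd0 packet_def)
  qed
  then show "((\<lambda>s. packet a n (s, x)) has_vector_derivative
      packet (vd a) n (t, x) + (-1) * (d t * (a t * wave' n (phase t x)))) (at t)"
    and "((\<lambda>y. packet a n (t, y)) has_vector_derivative a t * wave' n (phase t x)) (at x)"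
    by blast+
qed

definition packet_x :: "(real \<Rightarrow> complex) \<Rightarrow> int \<Rightarrow> real \<times> real \<Rightarrow> complex" where
  "packet_x a n = (\<lambda>p. (of_int n + 1 / 2) * packet a (n - 1) p + (- 2) * packet a (n + 1) p)"

lemma packet_x_eq: "packet_x a n (t, x) = a t * wave' n (phase t x)"
  by (simp add: packet_x_def packet_def wave'_def algebra_simps)

text \<open>An x-derivative shifts n by one either way, and a t-derivative also differentiates the
  amplitude; three packets therefore close the induction.\<close>

lemma packet_SucI:
  assumes a: "above e a" and e: "e \<ge> 0" "e > 0 \<or> n \<ge> 1"
    and "rapid_diff m (packet (vd a) n)" "rapid_diff m (packet a (n - 1))" "rapid_diff m (packet a (n + 1))"
  shows "rapid_diff (Suc m) (packet a n)"
proof (rule rapid_diff_SucI)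
  show "rapid (packet a n)"
    using e by (intro packet_rapid[OF a]) auto
  show "((\<lambda>s. packet a n (s, x)) has_vector_derivative
      (\<lambda>p. packet (vd a) n p + (-1) * (d (fst p) * packet_x a n p)) (t, x)) (at t)" for t x
    using packet_derivs(1)[OF a e] by (simp add: packet_x_eq)
  show "((\<lambda>y. packet a n (t, y)) has_vector_derivative packet_x a n (t, x)) (at x)" for t x
    using packet_derivs(2)[OF a e] by (simp add: packet_x_eq)
  show x: "rapid_diff m (packet_x a n)"
    unfolding packet_x_def by (intro rapid_diff_add rapid_diff_cmult assms)
  show "rapid_diff m (\<lambda>p. packet (vd a) n p + (-1) * (d (fst p) * packet_x a n p))"
    by (intro rapid_diff_add rapid_diff_cmult rapid_diff_temperate_mult[OF temperate_diff_t[OF d]] x assms)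
qed

lemma packet_schwartz:
  assumes "above e a" "e > 0"
  shows "packet a n \<in> schwartz"
proof -
  have "rapid_diff m (packet a n)" if "above e a" for m a n
    using that
  proof (induction m arbitrary: a n)
    case (Suc m)
    show ?case
      using assms(2) by (intro packet_SucI[OF Suc.prems] Suc.IH above_vd Suc.prems) auto
  qed (use assms(2) packet_rapid in auto)
  with assms(1) show ?thesis by (simp add: schwartz_iff)
qed

text \<open>For e = 0 the phase may reach 0. One derivative leads from n = 1 to n = 0, where
  \<open>wave\<close> is still continuous at that point.\<close>

lemma packet_rapid_diff_1:
  assumes "above 0 a"
  shows "rapid_diff 1 (packet a 1)"
  unfolding One_nat_def
  by (rule packet_SucI[OF assms]) (auto intro!: packet_rapid[OF assms] packet_rapid[OF above_vd[OF assms]])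

text \<open>The square of \<open>wave 0\<close> is \<open>- i x exp (- 2 x\<^sup>2)\<close> on the real axis, with derivative \<open>- i\<close> at \<open>0\<close>,
  although \<open>wave 0\<close> vanishes there.\<close>

lemma packet_not_schwartz:
  assumes a: "above 0 a" and t: "a t \<noteq> 0" "height t = 0"
  shows "packet a 1 \<notin> schwartz"
proof
  assume f: "packet a 1 \<in> schwartz"
  define x0 where "x0 = Re (P t - z0)"
  have ph: "phase t (x0 + x) = of_real x" for x
    using t(2) by (simp add: phase_def x0_def height_def complex_eq_iff)
  have px: "pdx (packet a 1) (t, x) = packet_x a 1 (t, x)" for x
    using vector_derivative_unique_at[OF schwartz_derivs(2)[OF f] packet_derivs(2)[OF a]]
    by (simp add: packet_x_eq)
  have shift: "((\<lambda>x. x0 + x) has_vector_derivative 1) (at 0)"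
    by (auto intro!: derivative_eq_intros)
  obtain D1 where "((\<lambda>y. packet_x a 1 (t, y)) has_vector_derivative D1) (at (x0 + 0))"
    using schwartz_derivs(2)[OF schwartz_pdx[OF f], of t "x0 + 0"] px by auto
  from vector_diff_chain_at[OF shift this]
  have "((\<lambda>x. a t * wave' 1 (of_real x)) has_vector_derivative D1) (at 0)"
    by (simp add: o_def packet_x_eq ph)
  \<comment> \<open>\<open>wave' 1\<close> is (3 / 2) \<open>wave 0\<close> - 2
    \<open>wave 2\<close>. The second term is differentiable at 0, so a second x-derivative of the
    packet would make \<open>wave 0\<close> differentiable there along the reals.\<close>
  moreover obtain D2 where "((\<lambda>x. wave 2 (of_real x)) has_vector_derivative D2) (at 0)"
  proof -
    have "((\<lambda>x. complex_of_real x) has_vector_derivative 1) (at 0)"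
      by (auto intro!: derivative_eq_intros)
    from field_vector_diff_chain_at[OF this, of "wave 2" "wave' 2 0"] wave_deriv[of 0 2] that
    show ?thesis by (simp add: o_def)
  qed
  ultimately have "((\<lambda>x. inverse (a t) * (a t * wave' 1 (of_real x)) + 2 * wave 2 (of_real x)) has_vector_derivative
      inverse (a t) * D1 + 2 * D2) (at 0)"
    by (intro has_vector_derivative_add has_vector_derivative_mult_right)
  moreover have "inverse (a t) * (a t * wave' 1 (of_real x)) + 2 * wave 2 (of_real x) = (3 / 2) * wave 0 (of_real x)" for x
  proof -
    have "inverse (a t) * (a t * wave' 1 (of_real x)) = wave' 1 (of_real x)"
      using t(1) by simp
    then show ?thesis by (simp only:) (simp add: wave'_def)
  qed
  ultimately have "((\<lambda>x. (3 / 2) * wave 0 (of_real x)) has_vector_derivative inverse (a t) * D1 + 2 * D2) (at 0)"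
    by simp
  from has_vector_derivative_mult[OF this this]
  have "((\<lambda>x. (9 / 4) * (wave 0 (of_real x))\<^sup>2) has_vector_derivative 0) (at 0)"
    by (simp add: wave_0 power2_eq_square)
  then have "((\<lambda>x. of_real x * ((9 / 4) * (- \<i>) * exp (- (2 * (of_real x)\<^sup>2)))) has_vector_derivative 0) (at 0)"
    by (simp add: wave_0_square mult_ac)
  moreover have "((\<lambda>x. of_real x * ((9 / 4) * (- \<i>) * exp (- (2 * (of_real x)\<^sup>2)))) has_vector_derivative - (9 / 4) * \<i>) (at 0)"
  proof -
    have "((\<lambda>x. complex_of_real x) has_vector_derivative 1) (at 0)"
      by (auto intro!: derivative_eq_intros)
    moreover have "((\<lambda>z. z * ((9 / 4) * (- \<i>) * exp (- (2 * z\<^sup>2)))) has_field_derivative - (9 / 4) * \<i>) (at (of_real 0))"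
      by (auto intro!: derivative_eq_intros)
    ultimately show ?thesis
      using field_vector_diff_chain_at[of "\<lambda>x. complex_of_real x" 1 0 "\<lambda>z. z * ((9 / 4) * (- \<i>) * exp (- (2 * z\<^sup>2)))"]
      by (simp add: o_def)
  qed
  ultimately have "0 = - (9 / 4) * \<i>"
    by (rule vector_derivative_unique_at)
  then show False by (simp add: complex_eq_iff)
qed

end

text \<open>Subtracting a multiple of a bump supported off the arc makes the mean vanish.\<close>

lemma periodic_antiderivative_on_arc:
  assumes c: "smooth1 c" "periodic1 c" and l: "0 < l" "l < pi"
  obtains P d where "\<And>t. (P has_vector_derivative d t) (at t)" "periodic1 P" "smooth1 d" "periodic1 d"
    "\<And>t. cos (t - m) \<ge> cos l \<Longrightarrow> d t = c t"
proof -
  define \<rho> where "\<rho> t = flat 0 (cos l + - 1 * cos (t - m))" for t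
  have \<rho>: "smooth1 \<rho>" unfolding \<rho>_def by (rule smooth1_flat_cos)
  have "cos (t + 2 * pi - m) = cos (t - m)" for t
    using cos_periodic[of "t - m"] by (simp add: algebra_simps)
  then have \<rho>_per: "periodic1 \<rho>" by (simp add: periodic1_def \<rho>_def)
  obtain C where C: "\<And>t. (C has_vector_derivative c t) (at t)"
    using antiderivative_exists smooth1_continuous c(1) by metis
  obtain R where R: "\<And>t. (R has_vector_derivative \<rho> t) (at t)"
    using antiderivative_exists smooth1_continuous \<rho> by metis
  have mean: "mean_T \<rho> \<noteq> 0"
  proof
    \<comment> \<open>Mean zero would make the primitive R periodic, but Re R is nondecreasing and
      strictly increases at m + pi, the point opposite to m.\<close>
    assume 0: "mean_T \<rho> = 0"
    have D: "((\<lambda>t. Re (R t)) has_real_derivative Re (\<rho> t)) (at t)" for t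
      unfolding has_real_derivative_iff_has_vector_derivative
      by (rule bounded_linear.has_vector_derivative[OF bounded_linear_Re R])
    have nn: "Re (\<rho> t) \<ge> 0" for t by (simp add: \<rho>_def flat_Re)
    have mono: "Re (R s) \<le> Re (R t)" if "s \<le> t" for s t
      by (rule DERIV_nonneg_imp_nondecreasing[OF that]) (use D nn in blast)
    have "cos (m + pi - m) = - 1" by simp
    moreover have "cos l > - 1"
      using cos_monotone_0_pi[of l pi] l by simp
    ultimately have pos: "Re (\<rho> (m + pi)) > 0"
      by (simp only: \<rho>_def) (simp add: flat_Re)
    obtain e where e: "e > 0" "\<And>h. 0 < h \<Longrightarrow> h < e \<Longrightarrow> Re (R (m + pi)) < Re (R (m + pi + h))"
      using DERIV_pos_inc_right[OF D pos] by blast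
    define h where "h = min (e / 2) pi"
    have "Re (R (m + pi)) < Re (R (m + pi + h))"
      using e by (intro e) (auto simp: h_def min_def)
    also have "\<dots> \<le> Re (R (m + pi + 2 * pi))"
      using pi_gt_zero by (intro mono) (simp add: h_def min_le_iff_disj)
    also have "\<dots> = Re (R (m + pi))"
      using antiderivative_shift[OF R \<rho>_per, of "m + pi"] 0 by simp
    finally show False by simp
  qed
  define \<kappa> where "\<kappa> = mean_T c / mean_T \<rho>"
  show ?thesis
  proof (rule that[of "\<lambda>t. C t - \<kappa> * R t" "\<lambda>t. c t - \<kappa> * \<rho> t"])
    show "((\<lambda>t. C t - \<kappa> * R t) has_vector_derivative c t - \<kappa> * \<rho> t) (at t)" for t
      by (intro has_vector_derivative_diff has_vector_derivative_mult_right C R)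
    have "C (t + 2 * pi) - C t - \<kappa> * (R (t + 2 * pi) - R t) = 0" for t
      using mean by (simp add: antiderivative_shift[OF C c(2)] antiderivative_shift[OF R \<rho>_per] \<kappa>_def)
    then show "periodic1 (\<lambda>t. C t - \<kappa> * R t)"
      by (simp add: periodic1_def algebra_simps)
    show "smooth1 (\<lambda>t. c t - \<kappa> * \<rho> t)"
      by (intro smooth1_diff smooth1_mult smooth1_const c \<rho>)
    show "periodic1 (\<lambda>t. c t - \<kappa> * \<rho> t)"
      using c(2) \<rho>_per by (simp add: periodic1_def)
    show "c t - \<kappa> * \<rho> t = c t" if "cos (t - m) \<ge> cos l" for t
      using that by (simp add: \<rho>_def flat_Re)
  qed
qed

text \<open>By periodicity a point with Im c < 0 is found within one period after t1. Then Im P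
  rises at t1 and falls at t2, so its maximum on the arc exceeds both end values. The cutoff can
  thus drop from 1 to 0 near the ends of the arc, where the phase is safely above the real axis,
  while the packet keeps its singularity over the maximum.\<close>

lemma not_schwartz_GH_sign_change:
  assumes c: "smooth1 c" "periodic1 c" and q: "smooth1 q" "periodic1 q"
    and s: "Im (c s1) > 0" "Im (c s2) < 0"
  shows "\<not> schwartz_GH c q"
proof
  assume GH: "schwartz_GH c q"
  define t1 where "t1 = s1"
  obtain k :: int where k: "t1 \<le> s2 + of_int k * (2 * pi)" "s2 + of_int k * (2 * pi) < t1 + 2 * pi"
    by (rule periodic_shift)
  define t2 where "t2 = s2 + of_int k * (2 * pi)"
  have ct: "Im (c t1) > 0" "Im (c t2) < 0"
    using s periodic1_multiple[of c s2 k] c(2) by (simp_all add: t1_def t2_def periodic1_def)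
  then have "t1 \<noteq> t2" by auto
  then have t12: "t1 < t2" "t2 < t1 + 2 * pi" using k by (auto simp: t2_def)
  \<comment> \<open>Midpoint and half-length of the arc, which becomes the set cos (t - m) \<ge> cos
    l; in this form it is automatically periodic.\<close>
  define m l where "m = (t1 + t2) / 2" and "l = (t2 - t1) / 2"
  have l: "0 < l" "l < pi" using t12 by (auto simp: l_def)
  have t12_ml: "t1 = m - l" "t2 = m + l" by (auto simp: m_def l_def field_simps)
  have cosper: "cos (t + 2 * pi - m) = cos (t - m)" for t
    using cos_periodic[of "t - m"] by (simp add: algebra_simps)
  obtain P d where P: "\<And>t. (P has_vector_derivative d t) (at t)" "periodic1 P" "smooth1 d" "periodic1 d"
    and dc: "\<And>t. cos (t - m) \<ge> cos l \<Longrightarrow> d t = c t"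
    using periodic_antiderivative_on_arc[OF c l, of m] by metis
  obtain Q r where Q: "\<And>t. (Q has_vector_derivative r t) (at t)" "periodic1 Q" "smooth1 r"
    and rq: "\<And>t. cos (t - m) \<ge> cos l \<Longrightarrow> r t = q t"
    using periodic_antiderivative_on_arc[OF q l, of m] by metis
  have B: "((\<lambda>t. Im (P t)) has_real_derivative Im (d t)) (at t)" for t
    unfolding has_real_derivative_iff_has_vector_derivative
    by (rule bounded_linear.has_vector_derivative[OF bounded_linear_Im P(1)])
  then have B_cont: "continuous_on S (\<lambda>t. Im (P t))" for S
    by (meson DERIV_isCont continuous_at_imp_continuous_on)
  obtain ts where ts: "ts \<in> {t1..t2}" "\<And>t. t \<in> {t1..t2} \<Longrightarrow> Im (P t) \<le> Im (P ts)"
    using continuous_attains_sup[OF compact_Icc _ B_cont, of t1 t2] t12 by fastforce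
  \<comment> \<open>With z0 = P ts, \<open>height\<close> is the gap between the maximum of Im P on
    the arc and Im P t: nonnegative on the arc and zero at ts.\<close>
  interpret wave_packet P d "P ts"
    using P by unfold_locales
  have height_cont: "continuous_on UNIV height"
    unfolding height_def by (intro continuous_intros B_cont)
  have height_per: "height (t + of_int k * (2 * pi)) = height t" for t k
    using periodic1_multiple[of P t k] P(2) by (simp add: periodic1_def height_def)
  have height_nonneg: "height t \<ge> 0" if "t \<in> {t1..t2}" for t
    using ts(2)[OF that] by (simp add: height_def)
  have "cos (t1 - m) = cos l" "cos (t2 - m) = cos l" by (simp_all add: t12_ml)
  then have dt: "Im (d t1) > 0" "Im (d t2) < 0" using ct by (simp_all add: dc)
  have h1: "height t1 > 0"
  proof -
    obtain e where e: "e > 0" "\<And>h. 0 < h \<Longrightarrow> h < e \<Longrightarrow> Im (P t1) < Im (P (t1 + h))"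
      using DERIV_pos_inc_right[OF B dt(1)] by blast
    define h where "h = min (e / 2) (t2 - t1)"
    have "Im (P t1) < Im (P (t1 + h))"
      using e(1) t12 by (intro e(2)) (auto simp: h_def min_def)
    also have "\<dots> \<le> Im (P ts)"
      using e(1) t12 by (intro ts(2)) (auto simp: h_def min_def)
    finally show ?thesis by (simp add: height_def)
  qed
  have h2: "height t2 > 0"
  proof -
    obtain e where e: "e > 0" "\<And>h. 0 < h \<Longrightarrow> h < e \<Longrightarrow> Im (P t2) < Im (P (t2 - h))"
      using DERIV_neg_dec_left[OF B dt(2)] by blast
    define h where "h = min (e / 2) (t2 - t1)"
    have "Im (P t2) < Im (P (t2 - h))"
      using e(1) t12 by (intro e(2)) (auto simp: h_def min_def)
    also have "\<dots> \<le> Im (P ts)"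
      using e(1) t12 by (intro ts(2)) (auto simp: h_def min_def)
    finally show ?thesis by (simp add: height_def)
  qed
  \<comment> \<open>A level strictly between 0 and the heights at the two ends.\<close>
  define \<epsilon> where "\<epsilon> = min (height t1) (height t2) / 2"
  have \<epsilon>: "\<epsilon> > 0" "\<epsilon> < height t1" "\<epsilon> < height t2" using h1 h2 by (auto simp: \<epsilon>_def min_def)
  have "open {t. \<epsilon> < height t}"
    by (intro open_Collect_less continuous_intros height_cont)
  then have near: "\<exists>e>0. \<forall>y. \<bar>y - x\<bar> < e \<longrightarrow> \<epsilon> < height y" if "\<epsilon> < height x" for x
    using that unfolding open_dist dist_real_def by blast
  obtain e1 where e1: "e1 > 0" "\<And>t. \<bar>t - t1\<bar> < e1 \<Longrightarrow> \<epsilon> < height t"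
    using near[OF \<epsilon>(2)] by blast
  obtain e2 where e2: "e2 > 0" "\<And>t. \<bar>t - t2\<bar> < e2 \<Longrightarrow> \<epsilon> < height t"
    using near[OF \<epsilon>(3)] by blast
  \<comment> \<open>Width of the collars at the two ends in which the cutoff varies: small enough
    for the height to stay above \<epsilon>, and less than l.\<close>
  define \<delta> where "\<delta> = min (min (e1 / 2) (e2 / 2)) (l / 2)"
  have \<delta>: "0 < \<delta>" "\<delta> < e1" "\<delta> < e2" "\<delta> < l"
    using e1(1) e2(1) l by (auto simp: \<delta>_def min_def)
  have high: "\<epsilon> \<le> height t" if "l - \<delta> \<le> \<bar>t - m\<bar>" "\<bar>t - m\<bar> \<le> l" for t
  proof (cases "t \<le> m")
    case True
    then have "\<bar>t - t1\<bar> < e1" using that \<delta> by (auto simp: t12_ml abs_less_iff)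
    then show ?thesis using e1(2) by (simp add: less_imp_le)
  next
    case False
    then have "\<bar>t - t2\<bar> < e2" using that \<delta> by (auto simp: t12_ml abs_less_iff)
    then show ?thesis using e2(2) by (simp add: less_imp_le)
  qed
  define \<kappa> where "\<kappa> = cos (l - \<delta>) - cos l"
  have \<kappa>: "\<kappa> > 0" using cos_monotone_0_pi[of "l - \<delta>" l] \<delta> l by (simp add: \<kappa>_def)
  \<comment> \<open>0 off the arc and 1 within l - \<delta> of m, modulo periods; \<kappa> rescales
    the change of the cosine across a collar to 1.\<close>
  define \<theta> where "\<theta> t = smooth_step ((cos (t - m) - cos l) / \<kappa>)" for t
  have \<theta>: "smooth1 \<theta>"
    unfolding \<theta>_def
  proof (rule smooth1_compose_real[OF smooth1_smooth_step])
    have "smooth1 (\<lambda>t. (of_real (cos (t - m)) - of_real (cos l)) * inverse (of_real \<kappa>))"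
      by (intro smooth1_mult smooth1_diff smooth1_cos smooth1_const)
    then show "smooth1 (\<lambda>t. of_real ((cos (t - m) - cos l) / \<kappa>))"
      by (simp add: divide_inverse)
  qed
  have \<theta>_per: "periodic1 \<theta>"
    by (simp add: periodic1_def \<theta>_def cosper)
  have \<theta>0: "\<theta> t = 0" if "cos (t - m) \<le> cos l" for t
    using that \<kappa> by (simp add: \<theta>_def divide_nonpos_pos)
  have \<theta>1: "\<theta> t = 1" if "cos (t - m) \<ge> cos (l - \<delta>)" for t
    using that \<kappa> by (simp add: \<theta>_def \<kappa>_def)
  have cos_open: "\<forall>\<^sub>F s in nhds t. cos (s - m) < x" if "cos (t - m) < x" for t x
  proof -
    have "open {s. cos (s - m) < x}" by (intro open_Collect_less continuous_intros)
    then show ?thesis using that by (auto simp: eventually_nhds)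
  qed
  have cos_open': "\<forall>\<^sub>F s in nhds t. x < cos (s - m)" if "x < cos (t - m)" for t x
  proof -
    have "open {s. x < cos (s - m)}" by (intro open_Collect_less continuous_intros)
    then show ?thesis using that by (auto simp: eventually_nhds)
  qed
  have \<theta>_above: "above 0 \<theta>"
    unfolding above_def
  proof (intro conjI allI \<theta> \<theta>_per)
    fix t
    show "0 \<le> height t \<or> (\<forall>\<^sub>F s in nhds t. \<theta> s = 0)"
    proof (cases "cos (t - m) \<ge> cos l")
      case True
      obtain k :: int where "\<bar>t - m + of_int k * (2 * pi)\<bar> \<le> pi"
        "cos \<bar>t - m + of_int k * (2 * pi)\<bar> = cos (t - m)"
        by (rule cos_reduce)
      then have "\<not> l < \<bar>t - m + of_int k * (2 * pi)\<bar>"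
        using cos_monotone_0_pi[of l "\<bar>t - m + of_int k * (2 * pi)\<bar>"] True l by linarith
      then have "t + of_int k * (2 * pi) \<in> {t1..t2}"
        by (auto simp: t12_ml abs_le_iff)
      from height_nonneg[OF this] show ?thesis by (simp only: height_per simp_thms)
    next
      case False
      then have "\<forall>\<^sub>F s in nhds t. cos (s - m) < cos l" by (intro cos_open) simp
      then have "\<forall>\<^sub>F s in nhds t. \<theta> s = 0" by (rule eventually_mono) (simp add: \<theta>0)
      then show ?thesis by blast
    qed
  qed
  \<comment> \<open>Off the arc and in its inner part \<theta> is locally constant, so only the
    collars remain, and there \<open>high\<close> gives the height.\<close>
  have vd\<theta>_above: "above \<epsilon> (vd \<theta>)"
    unfolding above_def
  proof (intro conjI allI smooth1_deriv(2) periodic1_vd \<theta> \<theta>_per)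
    fix t
    have flat: "\<forall>\<^sub>F s in nhds t. vd \<theta> s = 0" if "\<forall>\<^sub>F s in nhds t. \<theta> s = a" for a
    proof -
      have "\<forall>\<^sub>F s in nhds t. \<forall>\<^sub>F r in nhds s. \<theta> r = a"
        using that by (simp add: eventually_eventually)
      then show ?thesis by (rule eventually_mono) (rule vd_eq_0)
    qed
    consider "cos (t - m) < cos l" | "cos (t - m) > cos (l - \<delta>)"
      | "cos l \<le> cos (t - m)" "cos (t - m) \<le> cos (l - \<delta>)" by linarith
    then show "\<epsilon> \<le> height t \<or> (\<forall>\<^sub>F s in nhds t. vd \<theta> s = 0)"
    proof cases
      case 1
      have "\<forall>\<^sub>F s in nhds t. \<theta> s = 0"
        by (rule eventually_mono[OF cos_open[OF 1]]) (simp add: \<theta>0)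
      then show ?thesis using flat by blast
    next
      case 2
      have "\<forall>\<^sub>F s in nhds t. \<theta> s = 1"
        by (rule eventually_mono[OF cos_open'[OF 2]]) (simp add: \<theta>1)
      then show ?thesis using flat by blast
    next
      case 3
      obtain k :: int where k: "\<bar>t - m + of_int k * (2 * pi)\<bar> \<le> pi"
        "cos \<bar>t - m + of_int k * (2 * pi)\<bar> = cos (t - m)"
        by (rule cos_reduce)
      define y where "y = t + of_int k * (2 * pi)"
      have "y - m = t - m + of_int k * (2 * pi)" by (simp add: y_def)
      then have y_pi: "\<bar>y - m\<bar> \<le> pi" and y_cos: "cos \<bar>y - m\<bar> = cos (t - m)"
        using k by (simp_all only:)
      have y: "\<bar>y - m\<bar> \<le> l"
        using cos_monotone_0_pi[of l "\<bar>y - m\<bar>"] y_pi y_cos 3(1) l by linarith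
      have "\<not> \<bar>y - m\<bar> < l - \<delta>"
        using cos_monotone_0_pi[of "\<bar>y - m\<bar>" "l - \<delta>"] y_cos 3(2) \<delta> l by auto
      then have "\<epsilon> \<le> height y" using y by (intro high) auto
      then show ?thesis by (simp add: y_def height_per)
    qed
  qed
  define E where "E t = exp (- Q t)" for t
  have E: "smooth1 E" "periodic1 E"
    using Q(2) unfolding E_def[abs_def]
    by (auto intro!: smooth1_exp smooth1_minus smooth1I[OF Q(1) Q(3)] simp: periodic1_def)
  have E': "(E has_vector_derivative - r t * E t) (at t)" for t
    using field_vector_diff_chain_at[OF has_vector_derivative_minus[OF Q(1)] DERIV_exp]
    unfolding E_def[abs_def] by (simp add: o_def)
  \<comment> \<open>E cancels the zeroth-order term and the phase cancels the first-order ones, so L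
    applied to the packet of \<open>a\<close> leaves the packet of \<open>a1\<close>, which carries
    the derivative of the cutoff.\<close>
  define a where "a t = \<theta> t * E t" for t
  define a1 where "a1 t = vd \<theta> t * E t" for t
  have a: "above 0 a" and a1: "above \<epsilon> a1"
    unfolding a_def[abs_def] a1_def[abs_def] by (intro above_mult \<theta>_above vd\<theta>_above E)+
  have vda: "vd a t = a1 t - r t * a t" for t
    unfolding vd_def
  proof (rule vector_derivative_at)
    show "(a has_vector_derivative a1 t - r t * a t) (at t)"
      using has_vector_derivative_mult[OF smooth1_deriv(1)[OF \<theta>] E']
      unfolding a_def[abs_def] a1_def by (rule has_vector_derivative_eq_rhs) (simp add: algebra_simps)
  qed
  \<comment> \<open>Wherever the altered coefficients d, r differ from c, q, the amplitude is zero,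
    so the packet does not notice the alteration.\<close>
  have arc: "a t = 0 \<or> (d t = c t \<and> r t = q t)" for t
    using \<theta>0[of t] dc[of t] rq[of t] by (cases "cos (t - m) \<le> cos l") (auto simp: a_def)
  define u where "u = packet a 1"
  have u: "rapid_diff 1 u" unfolding u_def by (rule packet_rapid_diff_1[OF a])
  note u' = u[unfolded One_nat_def]
  note ur = rapid_diff_imp_rapid[OF u]
  have Lu: "pdt u p + c (fst p) * pdx u p + q (fst p) * u p = packet a1 1 p" for p
  proof -
    obtain t x where p: "p = (t, x)" by (cases p)
    have ut: "pdt u (t, x) = packet (vd a) 1 (t, x) + (-1) * (d t * (a t * wave' 1 (phase t x)))"
      by (rule vector_derivative_unique_at[OF rapid_diff_SucD(1)[OF u']])
        (unfold u_def, rule packet_derivs(1)[OF a], simp_all)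
    have ux: "pdx u (t, x) = a t * wave' 1 (phase t x)"
      by (rule vector_derivative_unique_at[OF rapid_diff_SucD(2)[OF u']])
        (unfold u_def, rule packet_derivs(2)[OF a], simp_all)
    show ?thesis
      using arc[of t] unfolding p ut ux fst_conv
      by (auto simp: u_def packet_def vda algebra_simps)
  qed
  obtain K where K: "\<And>t x. \<bar>x\<bar> ^ 0 * norm (u (t, x)) \<le> K"
    using rapid_bound[OF ur] by metis
  have "u \<in> schwartz"
  proof (rule schwartz_GH_imp_schwartz[OF GH])
    show "periodic_t u" "continuous_on UNIV u" using ur by (auto simp: rapid_def)
    show "norm (u p) \<le> K" for p using K[of "snd p" "fst p"] by simp
    show "packet a1 1 \<in> schwartz" by (rule packet_schwartz[OF a1 \<epsilon>(1)])
    show "int2 (\<lambda>p. u p * L_transpose c q \<phi> p) = int2 (\<lambda>p. packet a1 1 p * \<phi> p)" if "\<phi> \<in> schwartz" for \<phi>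
      using integration_by_parts[OF u schwartz_imp_rapid_diff[OF that] c q] by (simp add: Lu)
  qed
  \<comment> \<open>ts has height 0 and the collars have height at least \<epsilon>, so ts lies in
    the part of the arc where \<theta> = 1.\<close>
  moreover have "a ts \<noteq> 0"
  proof -
    have "height ts = 0" by (simp add: height_def)
    then have "\<not> (l - \<delta> \<le> \<bar>ts - m\<bar> \<and> \<bar>ts - m\<bar> \<le> l)"
      using high[of ts] \<epsilon>(1) by auto
    moreover have "\<bar>ts - m\<bar> \<le> l" using ts(1) by (auto simp: t12_ml abs_le_iff)
    ultimately have "cos (l - \<delta>) \<le> cos \<bar>ts - m\<bar>"
      using \<delta> l by (intro cos_monotone_0_pi_le) auto
    then have "\<theta> ts = 1" by (intro \<theta>1) (simp add: cos_abs_real)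
    then show ?thesis by (simp add: a_def E_def)
  qed
  ultimately show False
    using packet_not_schwartz[OF a, of ts] by (simp add: u_def height_def)
qed

theorem theorem1p1:
  fixes c q :: "real \<Rightarrow> complex"
  assumes "smooth1 c" "periodic1 c" "smooth1 q" "periodic1 q"
  shows "schwartz_GH c q \<longleftrightarrow>
    (Z_L0 c q = {} \<and> ((\<forall>t. Im (c t) \<ge> 0) \<or> (\<forall>t. Im (c t) \<le> 0)))"
proof
  assume GH: "schwartz_GH c q"
  have "Z_L0 c q = {}"
    using not_schwartz_GH_resonant[OF assms] GH by auto
  moreover have "(\<forall>t. Im (c t) \<ge> 0) \<or> (\<forall>t. Im (c t) \<le> 0)"
    using not_schwartz_GH_sign_change[OF assms] GH by (meson not_le)
  ultimately show "Z_L0 c q = {} \<and> ((\<forall>t. Im (c t) \<ge> 0) \<or> (\<forall>t. Im (c t) \<le> 0))" by blast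
next
  assume "Z_L0 c q = {} \<and> ((\<forall>t. Im (c t) \<ge> 0) \<or> (\<forall>t. Im (c t) \<le> 0))"
  then show "schwartz_GH c q"
    using schwartz_GH_if[OF assms] by blast
qed

end
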